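(* There is a constant $C>0$ such that for every $n$ and every $A\in[-1,1]^{n\times n}$ there exists $x\in\{\pm 1\}^n$ with $\|Ax\|_\infty\le 3\sqrt{\tfrac{3n}{2}}+C$. Moreover, for every fixed $\varepsilon>0$ there is a randomized polynomial-time algorithm that, given $A\in[-1,1]^{n\times n}$, finds $x\in\{\pm 1\}^n$ with $\|Ax\|_\infty\le\left(3\sqrt{\tfrac32}+\varepsilon\right)\sqrt{n}+C'$, where $C'$ is a constant independent of $n$ and $A$. *)

theory Defs
  imports
    "HOL-Probability.Probability_Mass_Function"
    "HOL-Computational_Algebra.Polynomial"
    "Jordan_Normal_Form.Matrix"
begin

text \<open>The element 0 only matters for the empty vector, whose norm is 0.\<close>

definition linf_norm :: "real vec \<Rightarrow> real" where
  "linf_norm v = Max (insert 0 (abs ` set\<^sub>v v))"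

text \<open>
  Algorithms on real input are programs of a randomized real-RAM (a uniform
  Blum--Shub--Smale machine with coin tosses), written as structured programs.
  A state has natural-number variables, used as counters and array indices, and named
  two-dimensional arrays of exact real numbers; variables and arrays have literal names in
  \<^typ>\<open>nat\<close>.

  Every assignment, coin toss and evaluation of a test costs one time unit. Expressions occur
  literally in the program, so their sizes are bounded by a constant of the program. To keep the
  unit costs honest, index arithmetic is additive only, there is no rounding from reals to
  indices, no transcendental operation, and real constants are rational (so that no
  non-uniform advice can be hidden in them).
\<close>

datatype iexp =
    IConst nat
  | IVar nat
  | IAdd iexp iexp
  | ISub iexp iexp

datatype rexp =
    RConst rat
  | Cell nat iexp iexp
  | RAdd rexp rexp
  | RSub rexp rexp
  | RMul rexp rexp
  | RDiv rexp rexp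

datatype test =
    ILess iexp iexp
  | RLess rexp rexp
  | Neg test
  | Conj test test

datatype prog =
    Skip
  | IAssign nat iexp
  | RAssign nat iexp iexp rexp
  | Toss nat
  | Seq prog prog
  | Cond test prog prog
  | Loop test prog

record state =
  ivar :: "nat \<Rightarrow> nat"
  cell :: "nat \<Rightarrow> nat \<Rightarrow> nat \<Rightarrow> real"
  coins :: "bool list"

text \<open>Subtraction of indices is truncated, and division by zero yields 0.\<close>

primrec ival :: "iexp \<Rightarrow> state \<Rightarrow> nat" where
  "ival (IConst c) s = c"
| "ival (IVar v) s = ivar s v"
| "ival (IAdd a b) s = ival a s + ival b s"
| "ival (ISub a b) s = ival a s - ival b s"

primrec rval :: "rexp \<Rightarrow> state \<Rightarrow> real" where
  "rval (RConst q) s = of_rat q"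
| "rval (Cell m a b) s = cell s m (ival a s) (ival b s)"
| "rval (RAdd a b) s = rval a s + rval b s"
| "rval (RSub a b) s = rval a s - rval b s"
| "rval (RMul a b) s = rval a s * rval b s"
| "rval (RDiv a b) s = rval a s / rval b s"

primrec holds :: "test \<Rightarrow> state \<Rightarrow> bool" where
  "holds (ILess a b) s \<longleftrightarrow> ival a s < ival b s"
| "holds (RLess a b) s \<longleftrightarrow> rval a s < rval b s"
| "holds (Neg b) s \<longleftrightarrow> \<not> holds b s"
| "holds (Conj b c) s \<longleftrightarrow> holds b s \<and> holds c s"

definition set_ivar :: "nat \<Rightarrow> nat \<Rightarrow> state \<Rightarrow> state" where
  "set_ivar v k s = s\<lparr>ivar := (ivar s)(v := k)\<rparr>"

definition set_cell :: "nat \<Rightarrow> nat \<Rightarrow> nat \<Rightarrow> real \<Rightarrow> state \<Rightarrow> state" where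
  "set_cell m i j r s =
     s\<lparr>cell := (\<lambda>m' i' j'. if m' = m \<and> i' = i \<and> j' = j then r else cell s m' i' j')\<rparr>"

text \<open>
  \<open>exec P s t s'\<close>: started in \<open>s\<close>, the program \<open>P\<close> halts in \<open>s'\<close> after exactly \<open>t\<close> time units.
  The random bits are a list of coins fixed in advance; a toss consumes the first one, and a
  program that tosses when none is left is stuck (no execution is derivable).
\<close>

inductive exec :: "prog \<Rightarrow> state \<Rightarrow> nat \<Rightarrow> state \<Rightarrow> bool" where
  Skip: "exec Skip s 1 s"
| IAssign: "exec (IAssign v a) s 1 (set_ivar v (ival a s) s)"
| RAssign: "exec (RAssign m a b e) s 1 (set_cell m (ival a s) (ival b s) (rval e s) s)"
| Toss: "coins s = c # cs \<Longrightarrow> exec (Toss v) s 1 (set_ivar v (of_bool c) (s\<lparr>coins := cs\<rparr>))"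
| Seq: "exec P s t s' \<Longrightarrow> exec Q s' u s'' \<Longrightarrow> exec (Seq P Q) s (t + u) s''"
| CondTrue: "holds b s \<Longrightarrow> exec P s t s' \<Longrightarrow> exec (Cond b P Q) s (Suc t) s'"
| CondFalse: "\<not> holds b s \<Longrightarrow> exec Q s t s' \<Longrightarrow> exec (Cond b P Q) s (Suc t) s'"
| LoopFalse: "\<not> holds b s \<Longrightarrow> exec (Loop b P) s 1 s"
| LoopTrue: "holds b s \<Longrightarrow> exec P s t s' \<Longrightarrow> exec (Loop b P) s' u s'' \<Longrightarrow>
    exec (Loop b P) s (Suc (t + u)) s''"

lemma exec_deterministic:
  "exec P s t s' \<Longrightarrow> exec P s u s'' \<Longrightarrow> u = t \<and> s'' = s'"
proof (induction arbitrary: u s'' rule: exec.induct)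
  case (Skip s)
  then show ?case by (auto elim: exec.cases)
next
  case (IAssign v a s)
  then show ?case by (auto elim: exec.cases)
next
  case (RAssign m a b e s)
  then show ?case by (auto elim: exec.cases)
next
  case (Toss s c cs v)
  from Toss(2) show ?case by cases (use Toss(1) in auto)
next
  case (Seq P s t s' Q u' s2)
  from Seq.prems show ?case by cases (use Seq.IH in blast)
next
  case (CondTrue b s P t s' Q)
  from CondTrue.prems show ?case by cases (use CondTrue.IH CondTrue.hyps in blast)+
next
  case (CondFalse b s Q t s' P)
  from CondFalse.prems show ?case by cases (use CondFalse.IH CondFalse.hyps in blast)+
next
  case (LoopFalse b s P)
  from LoopFalse.prems show ?case by cases (use LoopFalse.hyps in auto)
next
  case (LoopTrue b s P t s' u' s2)
  from LoopTrue.prems show ?case by cases (use LoopTrue.IH LoopTrue.hyps in blast)+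
qed

text \<open>
  Input and output convention: variable 0 holds \<open>n\<close> and array 0 holds the \<open>n \<times> n\<close> input
  matrix, everything else is 0; the output vector of length \<open>n\<close> is column 0 of array 1.
\<close>

definition input_state :: "nat \<Rightarrow> real mat \<Rightarrow> bool list \<Rightarrow> state" where
  "input_state n A cs =
     \<lparr>ivar = (\<lambda>v. if v = 0 then n else 0),
      cell = (\<lambda>m i j. if m = 0 \<and> i < n \<and> j < n then A $$ (i, j) else 0),
      coins = cs\<rparr>"

definition output_vec :: "nat \<Rightarrow> state \<Rightarrow> real vec" where
  "output_vec n s = Matrix.vec n (\<lambda>i. cell s 1 i 0)"

definition yields :: "prog \<Rightarrow> nat \<Rightarrow> nat \<Rightarrow> real mat \<Rightarrow> bool list \<Rightarrow> real vec \<Rightarrow> bool" where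
  "yields P T n A cs x \<longleftrightarrow>
     (\<exists>t s. t \<le> T \<and> exec P (input_state n A cs) t s \<and> x = output_vec n s)"

definition coin_lists :: "nat \<Rightarrow> bool list set" where
  "coin_lists T = {cs. length cs = T}"

text \<open>
  Monte Carlo search in worst-case polynomial time: on every admissible input and for all
  outcomes of the coin tosses the program halts within \<open>poly p n\<close> steps (hence uses at most
  that many coins), and its output is correct with probability at least \<open>2/3\<close> over uniformly
  random independent coins.
\<close>

definition randomized_poly_time_finds ::
  "prog \<Rightarrow> (nat \<Rightarrow> real mat \<Rightarrow> bool) \<Rightarrow> (nat \<Rightarrow> real mat \<Rightarrow> real vec \<Rightarrow> bool) \<Rightarrow> bool" where
  "randomized_poly_time_finds P admissible correct \<longleftrightarrow>
     (\<exists>p :: nat poly. \<forall>n A. admissible n A \<longrightarrow>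
        (\<forall>cs \<in> coin_lists (poly p n). \<exists>x. yields P (poly p n) n A cs x) \<and>
        measure_pmf.prob (pmf_of_set (coin_lists (poly p n)))
          {cs. \<exists>x. yields P (poly p n) n A cs x \<and> correct n A x} \<ge> 2 / 3)"

definition bounded_square_mat :: "nat \<Rightarrow> real mat \<Rightarrow> bool" where
  "bounded_square_mat n A \<longleftrightarrow> A \<in> carrier_mat n n \<and> elements_mat A \<subseteq> {-1..1}"

definition sign_vec :: "nat \<Rightarrow> real vec \<Rightarrow> bool" where
  "sign_vec n x \<longleftrightarrow> x \<in> carrier_vec n \<and> set\<^sub>v x \<subseteq> {-1, 1}"

end

theory Submission
  imports Defs
begin

text \<open>
  Start at \<open>x = 0\<close> and move in small steps through the cube, freezing coordinates that come close to \<open>1\<close> or \<open>-1\<close>.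
  Let \<open>\<tau> = n - |x|\<^sup>2\<close> and keep a barrier \<open>\<mu>\<close> above all entries of \<open>A x\<close> and \<open>- A x\<close>. With slacks \<open>s\<close> running over
  \<open>\<mu> - (A x)\<^sub>i\<close> and \<open>\<mu> + (A x)\<^sub>i\<close>, the potential is essentially
  \<open>\<mu> + b/5 T\<^sup>2 \<Sum> s^(-5)\<close> with \<open>b = 423\<close> and \<open>T = min \<tau> (3n/4)\<close>.
  While \<open>b T\<^sup>2 \<Sum> s^(-6) > 1\<close>, raising \<open>\<mu>\<close> does not increase the potential.
  Otherwise move orthogonally to \<open>x\<close>, so that \<open>\<tau>\<close> drops by the squared step length, and to the rows with
  smallest slack; among an orthogonal basis of the remaining directions some vector has at most average
  second-order cost, and of its two signs one does not increase the potential to first order. As at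
  least about \<open>\<tau>\<close> coordinates are alive, the resulting growth is paid for by the decay of \<open>T\<^sup>2\<close>
  when \<open>\<tau> \<le> 3n/4\<close>, and totals less than \<open>0.32 sqrt n\<close> before. The barrier thus stays below \<open>3.6741 sqrt n + 2\<close>, and
  \<open>3.6741 < 3 sqrt (3/2)\<close>. Once \<open>\<tau>\<close> is bounded, rounding to signs changes every entry of \<open>A x\<close> by at most \<open>\<tau>\<close>.
  All operations are rational and no coin is tossed, so the same program serves both claims.
\<close>

subsection \<open>Gram--Schmidt residuals\<close>

text \<open>Where the numbers come from: ignoring lower-order terms, raising the barrier at
  \<open>x = 0\<close> stops at \<open>\<mu>^6 = 2 b n T^2\<close>, and there the potential is 6/5
  of \<open>\<mu>\<close>. With \<open>T = tau\<close> throughout, so \<open>T = n\<close> at the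
  start, even the least admissible \<open>b = (15/2)^3\<close> would give about 3.689 sqrt n,
  slightly too much. Starting with \<open>T = 3n/4\<close> lowers this to about 3.353 sqrt n, at the
  price of growth at a rate of about 1.27 / sqrt n per unit of \<open>tau\<close> while
  \<open>tau\<close> falls by the first n/4. The machine shapes the rest. It has no square roots and
  no absolute values, so residuals stay unnormalised, a step is scaled by its maximum norm instead
  of its length, and the level that decides which rows are avoided is compared through sixth powers.
  The index arithmetic is only additive, so the iterations are counted in a real cell. Stopping at
  \<open>tau < 10000\<close> turns all discretisation errors into small relative ones; the gaps
  between 423 and (15/2)^3 and between 3.6741 and the sum of the two costs above absorb
  them.\<close>

definition ip :: "nat \<Rightarrow> (nat \<Rightarrow> real) \<Rightarrow> (nat \<Rightarrow> real) \<Rightarrow> real" where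
  "ip n u v = (\<Sum>j<n. u j * v j)"

lemma ip_commute: "ip n u v = ip n v u"
  by (simp add: ip_def mult.commute)

lemma ip_diff_scale_left: "ip n (\<lambda>j. u j - c * v j) w = ip n u w - c * ip n v w"
  by (simp add: ip_def algebra_simps sum_subtractf sum_distrib_left)

lemma ip_scale_left: "ip n (\<lambda>j. c * u j) w = c * ip n u w"
  by (simp add: ip_def algebra_simps sum_distrib_left)

lemma ip_self_nonneg: "0 \<le> ip n u u"
  by (simp add: ip_def sum_nonneg)

lemma ip_cong: "(\<And>j. j < n \<Longrightarrow> u j = u' j) \<Longrightarrow> (\<And>j. j < n \<Longrightarrow> v j = v' j) \<Longrightarrow> ip n u v = ip n u' v'"
  by (simp add: ip_def)

lemma ip_self_eq_0: "ip n u u = 0 \<Longrightarrow> j < n \<Longrightarrow> u j = 0"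
  by (simp add: ip_def sum_nonneg_eq_0_iff)

lemma ip_zero_left: "(\<And>j. j < n \<Longrightarrow> u j = 0) \<Longrightarrow> ip n u v = 0"
  by (simp add: ip_def)

primrec red :: "nat \<Rightarrow> (nat \<Rightarrow> nat \<Rightarrow> real) \<Rightarrow> (nat \<Rightarrow> real) \<Rightarrow> nat \<Rightarrow> nat \<Rightarrow> real" where
  "red n W v 0 = v"
| "red n W v (Suc r) =
     (\<lambda>j. red n W v r j - ip n (red n W v r) (W r) / ip n (W r) (W r) * W r j)"

text \<open>Needed because an array row agrees with a vector only below \<open>n\<close>, and
  because later rows of the array still change while the earlier residuals are in use.\<close>

lemma red_cong:
  assumes "\<And>j. j < n \<Longrightarrow> v j = v' j" "\<And>t j. t < r \<Longrightarrow> j < n \<Longrightarrow> W t j = W' t j"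
  shows "j < n \<Longrightarrow> red n W v r j = red n W' v' r j"
  using assms
proof (induction r arbitrary: j)
  case (Suc r)
  have eq: "\<And>j. j < n \<Longrightarrow> red n W v r j = red n W' v' r j"
    using Suc.IH Suc.prems by simp
  have "ip n (red n W v r) (W r) = ip n (red n W' v' r) (W' r)"
    "ip n (W r) (W r) = ip n (W' r) (W' r)"
    using eq Suc.prems by (auto intro!: ip_cong)
  then show ?case using eq Suc.prems by simp
qed simp

lemma red_zero:
  assumes "\<And>j. j < n \<Longrightarrow> v j = 0" shows "j < n \<Longrightarrow> red n W v r j = 0"
proof (induction r arbitrary: j)
  case (Suc r)
  have "ip n (red n W v r) (W r) = 0" by (rule ip_zero_left) (rule Suc.IH)
  then show ?case using Suc by simp
qed (use assms in simp)

lemma ip_red_Suc: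
  "ip n (red n W v (Suc r)) u =
     ip n (red n W v r) u - ip n (red n W v r) (W r) / ip n (W r) (W r) * ip n (W r) u"
  unfolding red.simps by (rule ip_diff_scale_left)

lemma ip_red_Suc_self: "ip n (red n W v (Suc r)) (W r) = 0"
proof (cases "ip n (W r) (W r) = 0")
  case True
  then have "ip n (red n W v (Suc r)) (W r) = 0"
    by (subst ip_commute) (rule ip_zero_left, rule ip_self_eq_0)
  then show ?thesis .
next
  case False
  then show ?thesis by (simp add: ip_red_Suc del: red.simps)
qed

text \<open>The residuals of modified Gram--Schmidt; a zero residual is skipped because \<open>x / 0 = 0\<close>.\<close>

definition gram_schmidt :: "nat \<Rightarrow> nat \<Rightarrow> (nat \<Rightarrow> nat \<Rightarrow> real) \<Rightarrow> (nat \<Rightarrow> nat \<Rightarrow> real) \<Rightarrow> bool" where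
  "gram_schmidt n N V W \<longleftrightarrow> (\<forall>m<N. \<forall>j<n. W m j = red n W (V m) m j)"

context
  fixes n N :: nat and V W :: "nat \<Rightarrow> nat \<Rightarrow> real"
  assumes gs: "gram_schmidt n N V W"
begin

lemma gram_schmidt_eq: "m < N \<Longrightarrow> j < n \<Longrightarrow> W m j = red n W (V m) m j"
  using gs by (auto simp: gram_schmidt_def)

lemma red_orthogonal:
  assumes "\<And>t s. t < r \<Longrightarrow> s < t \<Longrightarrow> ip n (W t) (W s) = 0" "t < r"
  shows "ip n (red n W v r) (W t) = 0"
  using assms
proof (induction r)
  case (Suc r)
  show ?case
  proof (cases "t = r")
    case True
    then show ?thesis by (simp add: ip_red_Suc_self del: red.simps)
  next
    case False
    then have "t < r" using Suc.prems by simp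
    then show ?thesis using Suc.IH Suc.prems by (simp add: ip_red_Suc del: red.simps)
  qed
qed simp

lemma gram_schmidt_orthogonal: "m < N \<Longrightarrow> s < m \<Longrightarrow> ip n (W m) (W s) = 0"
proof (induction m arbitrary: s rule: less_induct)
  case (less m)
  have "ip n (W m) (W s) = ip n (red n W (V m) m) (W s)"
    using less.prems gram_schmidt_eq by (auto intro!: ip_cong)
  also have "\<dots> = 0"
    using less by (intro red_orthogonal) auto
  finally show ?case .
qed

text \<open>Before stage \<open>t\<close> only multiples of residuals orthogonal to
  \<open>W t\<close> are subtracted, so the coefficients of modified and classical Gram--Schmidt
  agree.\<close>

lemma ip_red_unchanged:
  "r \<le> t \<Longrightarrow> t < N \<Longrightarrow> ip n (red n W v r) (W t) = ip n v (W t)"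
proof (induction r)
  case (Suc r)
  have "ip n (W r) (W t) = 0"
    using gram_schmidt_orthogonal[of t r] Suc.prems by (simp add: ip_commute)
  then show ?case using Suc by (simp add: ip_red_Suc del: red.simps)
qed simp

lemma red_norm:
  assumes "r \<le> N"
  shows "ip n (red n W v r) (red n W v r) =
    ip n v v - (\<Sum>m<r. (ip n v (W m))\<^sup>2 / ip n (W m) (W m))"
  using assms
proof (induction r)
  case (Suc r)
  let ?u = "red n W v r" and ?c = "ip n (red n W v r) (W r) / ip n (W r) (W r)"
  have c: "ip n ?u (W r) = ip n v (W r)" using Suc.prems by (simp add: ip_red_unchanged)
  have "ip n (red n W v (Suc r)) (red n W v (Suc r)) = ip n (red n W v (Suc r)) ?u - ?c * ip n (red n W v (Suc r)) (W r)"
    by (subst ip_red_Suc) (simp only: ip_commute[of n ?u "red n W v (Suc r)"] ip_commute[of n "W r" "red n W v (Suc r)"])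
  also have "\<dots> = ip n (red n W v (Suc r)) ?u" by (simp add: ip_red_Suc_self del: red.simps)
  also have "\<dots> = ip n ?u ?u - ?c * ip n (W r) ?u" by (simp add: ip_red_Suc del: red.simps)
  also have "\<dots> = ip n ?u ?u - (ip n v (W r))\<^sup>2 / ip n (W r) (W r)"
    by (simp add: c power2_eq_square ip_commute[of n "W r" ?u])
  finally show ?case using Suc by simp
qed simp

lemma bessel: "(\<Sum>m<N. (ip n v (W m))\<^sup>2 / ip n (W m) (W m)) \<le> ip n v v"
  using red_norm[of N v] ip_self_nonneg[of n "red n W v N"] by simp

text \<open>At stage \<open>t\<close> the residual of \<open>V t\<close> is \<open>W t\<close>
  itself, so the next subtraction removes it completely, and zero stays zero.\<close>

lemma red_vanishes:
  assumes "t < m" "m \<le> N" "j < n"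
  shows "red n W (V t) m j = 0"
proof -
  have "red n W (V t) (Suc t + d) j = 0" if "j < n" for d j
    using that
  proof (induction d arbitrary: j)
    case 0
    have eq: "ip n (red n W (V t) t) (W t) = ip n (W t) (W t)"
      using gram_schmidt_eq[of t] assms by (intro ip_cong) auto
    have "red n W (V t) t j = W t j" using gram_schmidt_eq[of t j] assms 0 by simp
    then show ?case using ip_self_eq_0[of n "W t" j] 0 by (cases "ip n (W t) (W t) = 0") (auto simp: eq)
  next
    case (Suc d)
    have "ip n (red n W (V t) (Suc t + d)) (W (Suc t + d)) = 0"
      by (rule ip_zero_left) (rule Suc.IH)
    then show ?case using Suc by simp
  qed
  from this[of j "m - Suc t"] show ?thesis using assms by simp
qed

text \<open>Equality in Bessel's inequality, because the remainder of a generator has vanished by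
  the end.\<close>

lemma parseval:
  assumes "t < N"
  shows "(\<Sum>m<N. (ip n (V t) (W m))\<^sup>2 / ip n (W m) (W m)) = ip n (V t) (V t)"
  using red_norm[of N "V t"] red_vanishes[OF assms order_refl]
    ip_zero_left[of n "red n W (V t) N" "red n W (V t) N"] by simp

text \<open>The remainder of \<open>V t\<close> has the same inner product with \<open>W m\<close>
  as \<open>V t\<close>, and it has vanished. Placing a vector early among the generators thus makes
  it a direction that all later residuals avoid.\<close>

lemma generator_orthogonal:
  assumes "t < m" "m < N"
  shows "ip n (V t) (W m) = 0"
proof -
  have "ip n (red n W (V t) m) (W m) = 0"
    using red_vanishes[of t m] assms by (intro ip_zero_left) auto
  then show ?thesis using assms by (simp add: ip_red_unchanged)
qed

end

subsection \<open>Inequalities for the potential\<close>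

text \<open>The factor 30 is the second derivative of u^(-5) at 1. Adding the fractions cancels the
  odd powers exactly; only the denominator (1 - e^2)^5 is estimated, by Bernoulli, and 10001/10000
  absorbs the terms of order e^4.\<close>

lemma even_part_inverse_fifth_unit:
  fixes e :: real
  assumes "\<bar>e\<bar> \<le> 1/1000"
  shows "1 / (1 - e)^5 + 1 / (1 + e)^5 \<le> 2 + 30 * (10001/10000) * e\<^sup>2"
proof -
  define E where "E = e\<^sup>2"
  have E: "0 \<le> E" "E \<le> 1/1000000"
    using power_mono[OF assms, of 2] by (auto simp: E_def power2_eq_square)
  have e: "1 - e > 0" "1 + e > 0" using assms by auto
  have bern: "1 - 5 * E \<le> (1 - E)^5"
    using Bernoulli_inequality[of "-E" 5] E by simp
  have "1 / (1 - e)^5 + 1 / (1 + e)^5 = ((1 + e)^5 + (1 - e)^5) / ((1 - e) * (1 + e))^5"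
    using e by (subst add_frac_eq) (simp_all add: power_mult_distrib)
  also have "(1 - e) * (1 + e) = 1 - E" by (simp add: E_def algebra_simps power2_eq_square)
  also have "(1 + e)^5 + (1 - e)^5 = 2 + 20 * E + 10 * E\<^sup>2"
    by (simp add: E_def eval_nat_numeral algebra_simps)
  also have "(2 + 20 * E + 10 * E\<^sup>2) / (1 - E)^5 \<le> (2 + 20 * E + 10 * E\<^sup>2) / (1 - 5 * E)"
    using bern E by (intro divide_left_mono) auto
  also have "\<dots> \<le> 2 + 30 * (10001/10000) * E"
  proof -
    have "E * E \<le> E * (1/1000000)" using E by (intro mult_left_mono) auto
    then have "2 + 20 * E + 10 * E\<^sup>2 \<le> (2 + 30 * (10001/10000) * E) * (1 - 5 * E)"
      using E by (simp add: power2_eq_square algebra_simps)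
    then show ?thesis using E by (simp add: pos_divide_le_eq)
  qed
  finally show ?thesis by (simp add: E_def)
qed

lemma even_part_inverse_fifth:
  fixes s d :: real
  assumes "0 < s" "\<bar>d\<bar> \<le> s / 1000"
  shows "1 / (s - d)^5 + 1 / (s + d)^5 \<le> 2 / s^5 + 30 * (10001/10000) * (d\<^sup>2 / s^7)"
proof -
  define e where "e = d / s"
  have d: "d = s * e" using assms by (simp add: e_def)
  have "\<bar>e\<bar> \<le> 1/1000" using assms by (simp add: e_def abs_divide field_simps)
  from even_part_inverse_fifth_unit[OF this]
  have "(1 / s^5) * (1 / (1 - e)^5 + 1 / (1 + e)^5) \<le> (1 / s^5) * (2 + 30 * (10001/10000) * e\<^sup>2)"
    using assms by (intro mult_left_mono) auto
  moreover have "(s - d)^5 = s^5 * (1 - e)^5" "(s + d)^5 = s^5 * (1 + e)^5"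
    by (simp_all add: d power_mult_distrib[symmetric] algebra_simps)
  moreover have "d\<^sup>2 / s^7 = (1 / s^5) * e\<^sup>2"
    using assms by (simp add: e_def power_divide eval_nat_numeral)
  ultimately show ?thesis by (simp add: distrib_left)
qed

text \<open>The tangent inequality of the convex function u^(-5) at the right end
  \<open>s + h\<close>, obtained from Bernoulli's inequality for \<open>h / s\<close>. The sixth
  powers therefore belong to the raised barrier; \<open>inverse_sixth_shift\<close> relates them to
  the old one.\<close>

lemma convex_inverse_fifth:
  fixes s h :: real
  assumes "0 < s" "0 \<le> h"
  shows "1 / (s + h)^5 + 5 * h * (1 / (s + h)^6) \<le> 1 / s^5"
proof -
  define t where "t = s + h"
  have t: "0 < t" using assms by (auto simp: t_def)
  have "- 1 \<le> h / s" using assms by (simp add: order_trans[of "-1" 0])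
  then have "1 + 5 * (h / s) \<le> (1 + h / s)^5"
    using Bernoulli_inequality[of "h / s" 5] by simp
  moreover have "5 * (h / t) \<le> 5 * (h / s)"
    using assms by (intro mult_left_mono divide_left_mono) (auto simp: t_def)
  moreover have "1 + h / s = t / s" using assms by (simp add: t_def field_simps)
  ultimately have "1 + 5 * (h / t) \<le> (t / s)^5" by simp
  then have "(1 + 5 * (h / t)) / t^5 \<le> (t / s)^5 / t^5"
    using t by (intro divide_right_mono) auto
  also have "(t / s)^5 / t^5 = 1 / s^5" using t assms by (simp add: power_divide)
  also have "(1 + 5 * (h / t)) / t^5 = 1 / t^5 + 5 * h * (1 / t^6)"
    using t by (simp add: add_divide_distrib eval_nat_numeral)
  finally show ?thesis by (simp add: t_def)
qed

text \<open>
  Blocking a row costs one dimension. In the last claim the rows of \<open>B\<close>, which no longer move, still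
  contribute to the right-hand side; this pays exactly for the dimensions they take.
\<close>

lemma level_bounds:
  fixes up um :: "nat \<Rightarrow> real" and w k :: real and n :: nat
  assumes pos: "\<And>i. i < n \<Longrightarrow> 0 < up i" "\<And>i. i < n \<Longrightarrow> 0 < um i" and w: "0 < w"
    and n: "0 < n"
    and six: "(\<Sum>i<n. up i ^ 6 + um i ^ 6) \<le> k * w ^ 6"
  defines "B \<equiv> {i. i < n \<and> (w < up i \<or> w < um i)}"
  defines "R \<equiv> {i. i < n \<and> \<not> (w < up i \<or> w < um i)}"
  shows "real (card B) < k"
    and "(\<Sum>i\<in>R. up i ^ 7 + um i ^ 7) \<le> (k - card B) * w ^ 7"
    and "k * (\<Sum>i\<in>R. up i ^ 7 + um i ^ 7) \<le>
           (k - card B) * w\<^sup>2 * (\<Sum>i<n. up i ^ 5 + um i ^ 5)"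
proof -
  have fin: "finite B" "finite R" by (auto simp: B_def R_def)
  have split: "(\<Sum>i<n. f i) = (\<Sum>i\<in>B. f i) + (\<Sum>i\<in>R. f i)" for f :: "nat \<Rightarrow> real"
  proof -
    have "{..<n} = B \<union> R" "B \<inter> R = {}" by (auto simp: B_def R_def)
    then show ?thesis using fin by (simp add: sum.union_disjoint)
  qed
  have Bpow: "w ^ p < up i ^ p + um i ^ p" if "i \<in> B" "0 < p" for i p
  proof -
    have "0 < up i ^ p" "0 < um i ^ p" using that pos by (auto simp: B_def)
    moreover have "w ^ p < up i ^ p \<or> w ^ p < um i ^ p"
      using that w by (auto simp: B_def intro: power_strict_mono)
    ultimately show ?thesis by auto
  qed
  have Bsum: "card B * w ^ p \<le> (\<Sum>i\<in>B. up i ^ p + um i ^ p)" if "0 < p" for p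
  proof -
    have "(\<Sum>i\<in>B. w ^ p) \<le> (\<Sum>i\<in>B. up i ^ p + um i ^ p)"
      by (rule sum_mono) (use Bpow that in \<open>blast intro: less_imp_le\<close>)
    then show ?thesis by simp
  qed
  have R0: "0 \<le> (\<Sum>i\<in>R. up i ^ p + um i ^ p)" for p
    using pos by (intro sum_nonneg) (auto simp: R_def less_imp_le intro!: add_nonneg_nonneg zero_le_power)
  have step: "(\<Sum>i\<in>R. up i ^ (p + q) + um i ^ (p + q)) \<le> w ^ q * (\<Sum>i\<in>R. up i ^ p + um i ^ p)" for p q
    unfolding sum_distrib_left
  proof (rule sum_mono)
    fix i assume "i \<in> R"
    then have "0 < up i" "up i \<le> w" "0 < um i" "um i \<le> w" using pos by (auto simp: R_def)
    then have "up i ^ p * up i ^ q \<le> up i ^ p * w ^ q" "um i ^ p * um i ^ q \<le> um i ^ p * w ^ q"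
      by (auto intro!: mult_left_mono power_mono)
    then show "up i ^ (p + q) + um i ^ (p + q) \<le> w ^ q * (up i ^ p + um i ^ p)"
      by (simp add: power_add algebra_simps)
  qed
  have six': "(\<Sum>i\<in>R. up i ^ 6 + um i ^ 6) \<le> (k - card B) * w ^ 6"
    using six Bsum[of 6] split[of "\<lambda>i. up i ^ 6 + um i ^ 6"] by (simp add: algebra_simps)
  show lt: "real (card B) < k"
  proof (cases "B = {}")
    case True
    have "0 < (\<Sum>i<n. up i ^ 6 + um i ^ 6)"
      using n by (intro sum_pos add_pos_pos zero_less_power pos) auto
    then have "0 < k * w ^ 6" using six by simp
    then show ?thesis using True w by (simp add: zero_less_mult_iff)
  next
    case False
    have "(\<Sum>i\<in>B. w ^ 6) < (\<Sum>i\<in>B. up i ^ 6 + um i ^ 6)"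
      using False fin Bpow by (intro sum_strict_mono) auto
    then have "card B * w ^ 6 < k * w ^ 6"
      using six split[of "\<lambda>i. up i ^ 6 + um i ^ 6"] R0[of 6] by simp
    then show ?thesis using w by simp
  qed
  let ?a = "\<Sum>i\<in>R. up i ^ 7 + um i ^ 7"
  show a7: "?a \<le> (k - card B) * w ^ 7"
  proof -
    have "?a \<le> w * (\<Sum>i\<in>R. up i ^ 6 + um i ^ 6)" using step[of 6 1] by simp
    also have "\<dots> \<le> w * ((k - card B) * w ^ 6)" using six' w by (intro mult_left_mono) auto
    finally show ?thesis by (simp add: eval_nat_numeral algebra_simps)
  qed
  have "?a \<le> w\<^sup>2 * (\<Sum>i\<in>R. up i ^ 5 + um i ^ 5)" using step[of 5 2] by simp
  moreover have "w\<^sup>2 * (card B * w ^ 5) \<le> w\<^sup>2 * (\<Sum>i\<in>B. up i ^ 5 + um i ^ 5)"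
    using Bsum[of 5] by (intro mult_left_mono) auto
  ultimately have "?a + card B * w ^ 7 \<le> w\<^sup>2 * (\<Sum>i<n. up i ^ 5 + um i ^ 5)"
    unfolding split by (simp add: eval_nat_numeral distrib_left mult_ac)
  \<comment> \<open>Adding \<open>card B\<close> times the bound \<open>a7\<close> cancels
    \<open>(k - card B) * card B * w ^ 7\<close> on both sides and completes
    \<open>(k - card B) * ?a\<close> to \<open>k * ?a\<close>.\<close>
  then have "(k - card B) * (?a + card B * w ^ 7) \<le> (k - card B) * (w\<^sup>2 * (\<Sum>i<n. up i ^ 5 + um i ^ 5))"
    using lt by (intro mult_left_mono) auto
  moreover have "card B * ?a \<le> card B * ((k - card B) * w ^ 7)"
    using a7 by (intro mult_left_mono) auto
  ultimately show "k * ?a \<le> (k - card B) * w\<^sup>2 * (\<Sum>i<n. up i ^ 5 + um i ^ 5)"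
    by (simp add: algebra_simps)
qed

subsection \<open>The choice of a direction\<close>

definition row :: "nat \<Rightarrow> (nat \<Rightarrow> nat \<Rightarrow> real) \<Rightarrow> (nat \<Rightarrow> real) \<Rightarrow> nat \<Rightarrow> real" where
  "row n a x i = ip n (a i) x"

definition tau :: "nat \<Rightarrow> (nat \<Rightarrow> real) \<Rightarrow> real" where
  "tau n x = real n - ip n x x"

definition cap :: "nat \<Rightarrow> (nat \<Rightarrow> real) \<Rightarrow> real" where
  "cap n x = min (tau n x) (3 / 4 * real n)"

definition pot :: "nat \<Rightarrow> (nat \<Rightarrow> nat \<Rightarrow> real) \<Rightarrow> nat \<Rightarrow> real \<Rightarrow> (nat \<Rightarrow> real) \<Rightarrow> real" where
  "pot n a p \<mu> x = (\<Sum>i<n. 1 / (\<mu> - row n a x i) ^ p + 1 / (\<mu> + row n a x i) ^ p)"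

text \<open>The margin equals the maximum norm of a step, so an alive coordinate cannot leave the
  cube in one step. Two comparisons stand in for an absolute value.\<close>

definition alive :: "nat \<Rightarrow> (nat \<Rightarrow> real) \<Rightarrow> nat \<Rightarrow> real" where
  "alive n x j = (if x j < 1 - 1 / (real n * real n) \<and> - x j < 1 - 1 / (real n * real n) then 1 else 0)"

definition nalive :: "nat \<Rightarrow> (nat \<Rightarrow> real) \<Rightarrow> real" where
  "nalive n x = (\<Sum>j<n. alive n x j)"

text \<open>This is 1 / w^6 for the level \<open>w\<close> of \<open>direction_bounds\<close>, so
  that blocking means a reciprocal slack above \<open>w\<close>. The 1 subtracted is the dimension
  spent on orthogonality to \<open>x\<close>.\<close>

definition thr :: "nat \<Rightarrow> (nat \<Rightarrow> real) \<Rightarrow> real" where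
  "thr n x = 423 * (cap n x * cap n x) * (nalive n x - 1)"

definition blocked :: "nat \<Rightarrow> (nat \<Rightarrow> nat \<Rightarrow> real) \<Rightarrow> real \<Rightarrow> (nat \<Rightarrow> real) \<Rightarrow> nat \<Rightarrow> real" where
  "blocked n a \<mu> x i =
     (if (\<mu> - row n a x i) ^ 6 < thr n x \<or> (\<mu> + row n a x i) ^ 6 < thr n x then 1 else 0)"

text \<open>
  The first \<open>n + 1\<close> generators span the directions to avoid, the others are the coordinate vectors. Hence
  the nonzero residuals with index above \<open>n\<close> form an orthogonal basis of the admissible directions.
\<close>

definition generators ::
  "nat \<Rightarrow> (nat \<Rightarrow> nat \<Rightarrow> real) \<Rightarrow> (nat \<Rightarrow> real) \<Rightarrow> (nat \<Rightarrow> real) \<Rightarrow> (nat \<Rightarrow> real) \<Rightarrow> nat \<Rightarrow> nat \<Rightarrow> real" where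
  "generators n a x al bl m j =
     (if m < n then bl m * (al j * a m j) else if m = n then al j * x j
      else if m = n + 1 + j then al j else 0)"

definition quad :: "nat \<Rightarrow> (nat \<Rightarrow> nat \<Rightarrow> real) \<Rightarrow> (nat \<Rightarrow> real) \<Rightarrow> (nat \<Rightarrow> real) \<Rightarrow> real" where
  "quad n a z v = (\<Sum>i<n. z i * (ip n (a i) v * ip n (a i) v))"

text \<open>Up to the factor 30, the second derivative of
  \<open>1 / (\<mu> - u) ^ 5 + 1 / (\<mu> + u) ^ 5\<close> at the current value of the row.\<close>

definition weight :: "nat \<Rightarrow> (nat \<Rightarrow> nat \<Rightarrow> real) \<Rightarrow> real \<Rightarrow> (nat \<Rightarrow> real) \<Rightarrow> nat \<Rightarrow> real" where
  "weight n a \<mu> x i = 1 / (\<mu> - row n a x i) ^ 7 + 1 / (\<mu> + row n a x i) ^ 7"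

lemma red_support:
  assumes "j < n" "v j = 0" "\<And>t. t < r \<Longrightarrow> W t j = 0"
  shows "red n W v r j = 0"
  using assms by (induction r) auto

locale direction_search =
  fixes n :: nat and a :: "nat \<Rightarrow> nat \<Rightarrow> real" and x al bl z :: "nat \<Rightarrow> real" and W :: "nat \<Rightarrow> nat \<Rightarrow> real"
  assumes a: "\<And>i j. i < n \<Longrightarrow> j < n \<Longrightarrow> \<bar>a i j\<bar> \<le> 1"
    and al: "\<And>j. al j = 0 \<or> al j = 1" and bl: "\<And>i. bl i = 0 \<or> bl i = 1"
    and z: "\<And>i. i < n \<Longrightarrow> 0 \<le> z i"
    and gs: "gram_schmidt n (2 * n + 1) (generators n a x al bl) W"
begin

abbreviation "S m \<equiv> ip n (W m) (W m)"

text \<open>All generators vanish off the alive coordinates and the subtractions preserve this, so a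
  step never moves a frozen coordinate.\<close>

lemma support: "m < 2 * n + 1 \<Longrightarrow> j < n \<Longrightarrow> al j = 0 \<Longrightarrow> W m j = 0"
proof (induction m rule: less_induct)
  case (less m)
  have "red n W (generators n a x al bl m) m j = 0"
    using less by (intro red_support) (auto simp: generators_def)
  then show ?case using gram_schmidt_eq[OF gs less.prems(1,2)] by simp
qed

lemma al_mult: "m < 2 * n + 1 \<Longrightarrow> j < n \<Longrightarrow> al j * W m j = W m j"
  using al[of j] support[of m j] by auto

lemma ip_masked:
  assumes "m < 2 * n + 1"
  shows "ip n (\<lambda>j. al j * v j) (W m) = ip n v (W m)"
  unfolding ip_def
proof (rule sum.cong)
  fix j assume "j \<in> {..<n}"
  then have "al j * W m j = W m j" using al_mult assms by simp
  then show "al j * v j * W m j = v j * W m j" by (metis mult.assoc mult.commute)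
qed simp

lemma blocked_orthogonal:
  assumes "l < n" "i < n" "bl i = 1"
  shows "ip n (a i) (W (n + 1 + l)) = 0"
proof -
  have "ip n (generators n a x al bl i) (W (n + 1 + l)) = 0"
    using assms by (intro generator_orthogonal[OF gs]) auto
  moreover have "generators n a x al bl i = (\<lambda>j. al j * a i j)"
    using assms by (auto simp: generators_def)
  ultimately show ?thesis using assms by (simp add: ip_masked)
qed

lemma position_orthogonal:
  assumes "l < n"
  shows "ip n x (W (n + 1 + l)) = 0"
proof -
  have "ip n (generators n a x al bl n) (W (n + 1 + l)) = 0"
    using assms by (intro generator_orthogonal[OF gs]) auto
  moreover have "generators n a x al bl n = (\<lambda>j. al j * x j)"
    by (auto simp: generators_def)
  ultimately show ?thesis using assms by (simp add: ip_masked)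
qed

text \<open>\<open>S m / S m\<close> is 1 for a nonzero residual and 0 otherwise, so the left side
  counts the nonzero residuals. The identity computes the trace of the projection onto their span:
  Parseval for each coordinate vector, then summation over the coordinates.\<close>

lemma dimension: "(\<Sum>m<2 * n + 1. S m / S m) = (\<Sum>j<n. al j)"
proof -
  have unit: "ip n (generators n a x al bl (n + 1 + l)) v = al l * v l" if "l < n" for l v
  proof -
    have "ip n (generators n a x al bl (n + 1 + l)) v = (\<Sum>j<n. if j = l then al l * v l else 0)"
      unfolding ip_def by (rule sum.cong) (auto simp: generators_def)
    then show ?thesis using that by (simp add: sum.delta)
  qed
  have "al l = (\<Sum>m<2 * n + 1. W m l * W m l / S m)" if l: "l < n" for l
  proof -
    have "(\<Sum>m<2 * n + 1. (ip n (generators n a x al bl (n + 1 + l)) (W m))\<^sup>2 / S m) =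
        ip n (generators n a x al bl (n + 1 + l)) (generators n a x al bl (n + 1 + l))"
      using l by (intro parseval[OF gs]) auto
    also have "\<dots> = al l"
      unfolding unit[OF l] using al[of l] by (auto simp: generators_def)
    finally show ?thesis using l unfolding unit[OF l] by (simp add: al_mult power2_eq_square)
  qed
  then have "(\<Sum>l<n. al l) = (\<Sum>l<n. \<Sum>m<2 * n + 1. W m l * W m l / S m)" by simp
  also have "\<dots> = (\<Sum>m<2 * n + 1. S m / S m)"
    by (subst sum.swap) (simp only: ip_def sum_divide_distrib)
  finally show ?thesis by simp
qed

lemma split_index: "(\<Sum>m<2 * n + 1. f m) = (\<Sum>m<n. f m) + f n + (\<Sum>l<n. f (n + 1 + l))" for f :: "nat \<Rightarrow> real"
proof -
  have "(\<Sum>m<(n + 1) + k. f m) = (\<Sum>m<n + 1. f m) + (\<Sum>l<k. f (n + 1 + l))" for k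
    by (induction k) auto
  from this[of n] show ?thesis by (simp add: mult_2 add_ac)
qed

text \<open>Of the nonzero residuals counted by \<open>dimension\<close>, each blocked row and the
  position use up at most one; an unblocked row has the zero generator and uses up none.\<close>

lemma candidates: "(\<Sum>j<n. al j) - (\<Sum>i<n. bl i) - 1 \<le> (\<Sum>l<n. S (n + 1 + l) / S (n + 1 + l))"
proof -
  have "S i / S i \<le> bl i" if i: "i < n" for i
  proof (cases "bl i = 0")
    case True
    then have "red n W (generators n a x al bl i) i j = 0" if "j < n" for j
      using i that by (intro red_zero[where n = n]) (auto simp: generators_def)
    then have "W i j = 0" if "j < n" for j
      using gram_schmidt_eq[OF gs, of i j] i that by simp
    then have "S i = 0" by (rule ip_zero_left)
    then show ?thesis using True by simp
  next
    case False
    then show ?thesis using bl[of i] by (simp add: divide_self_if)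
  qed
  then have "(\<Sum>i<n. S i / S i) \<le> (\<Sum>i<n. bl i)" by (intro sum_mono) auto
  moreover have "S n / S n \<le> 1" by (simp add: divide_self_if)
  ultimately show ?thesis using dimension unfolding split_index by linarith
qed

text \<open>Blocked rows contribute nothing by orthogonality. For any other row, Bessel bounds the
  sum over the candidates by the squared norm of its alive part, which is at most the number of
  alive coordinates as the entries are at most 1 in absolute value.\<close>

lemma quad_total:
  "(\<Sum>l<n. quad n a z (W (n + 1 + l)) / S (n + 1 + l)) \<le>
     (\<Sum>j<n. al j) * (\<Sum>i | i < n \<and> bl i = 0. z i)"
proof -
  define R where "R = {i. i < n \<and> bl i = 0}"
  have finR: "finite R" by (simp add: R_def)
  have q: "quad n a z (W (n + 1 + l)) = (\<Sum>i\<in>R. z i * (ip n (a i) (W (n + 1 + l)))\<^sup>2)" if l: "l < n" for l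
    unfolding quad_def
  proof (rule sum.mono_neutral_cong_right)
    show "\<forall>i\<in>{..<n} - R. z i * (ip n (a i) (W (n + 1 + l)) * ip n (a i) (W (n + 1 + l))) = 0"
      using blocked_orthogonal[OF l] bl by (force simp: R_def)
  qed (auto simp: R_def power2_eq_square)
  have b: "(\<Sum>l<n. (ip n (a i) (W (n + 1 + l)))\<^sup>2 / S (n + 1 + l)) \<le> (\<Sum>j<n. al j)" if i: "i < n" for i
  proof -
    have "(\<Sum>l<n. (ip n (a i) (W (n + 1 + l)))\<^sup>2 / S (n + 1 + l)) \<le>
        (\<Sum>m<2 * n + 1. (ip n (a i) (W m))\<^sup>2 / S m)"
      unfolding split_index using ip_self_nonneg[of n]
      by (simp add: sum_nonneg add_nonneg_nonneg)
    also have "\<dots> = (\<Sum>m<2 * n + 1. (ip n (\<lambda>j. al j * a i j) (W m))\<^sup>2 / S m)"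
      by (simp add: ip_masked)
    also have "\<dots> \<le> ip n (\<lambda>j. al j * a i j) (\<lambda>j. al j * a i j)"
      by (rule bessel[OF gs])
    also have "\<dots> \<le> (\<Sum>j<n. al j)"
      unfolding ip_def
    proof (rule sum_mono)
      fix j assume "j \<in> {..<n}"
      then have "\<bar>a i j\<bar> * \<bar>a i j\<bar> \<le> 1 * 1" using a i by (intro mult_mono) auto
      then have "a i j * a i j \<le> 1" by simp
      then show "al j * a i j * (al j * a i j) \<le> al j" using al[of j] by auto
    qed
    finally show ?thesis .
  qed
  have "(\<Sum>l<n. quad n a z (W (n + 1 + l)) / S (n + 1 + l)) =
      (\<Sum>l<n. \<Sum>i\<in>R. z i * ((ip n (a i) (W (n + 1 + l)))\<^sup>2 / S (n + 1 + l)))"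
    by (rule sum.cong) (simp_all only: q lessThan_iff sum_divide_distrib times_divide_eq_right)
  also have "\<dots> = (\<Sum>i\<in>R. z i * (\<Sum>l<n. (ip n (a i) (W (n + 1 + l)))\<^sup>2 / S (n + 1 + l)))"
    by (subst sum.swap) (simp add: sum_distrib_left)
  also have "\<dots> \<le> (\<Sum>i\<in>R. z i * (\<Sum>j<n. al j))"
    by (rule sum_mono, rule mult_left_mono[OF b z]) (auto simp: R_def)
  finally show ?thesis by (simp add: R_def sum_distrib_left mult.commute)
qed

text \<open>An averaging argument: a value below all quotients, summed over the candidates, is at
  most \<open>quad_total\<close>, while \<open>candidates\<close> bounds the number of summands from
  below.\<close>

lemma best_candidate:
  assumes pos: "0 < (\<Sum>j<n. al j) - (\<Sum>i<n. bl i) - 1"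
  shows "\<exists>l<n. 0 < S (n + 1 + l)"
    and "(\<And>l. l < n \<Longrightarrow> 0 < S (n + 1 + l) \<Longrightarrow> q \<le> quad n a z (W (n + 1 + l)) / S (n + 1 + l)) \<Longrightarrow> 0 \<le> q \<Longrightarrow>
      q * ((\<Sum>j<n. al j) - (\<Sum>i<n. bl i) - 1) \<le> (\<Sum>j<n. al j) * (\<Sum>i | i < n \<and> bl i = 0. z i)"
proof -
  show "\<exists>l<n. 0 < S (n + 1 + l)"
  proof (rule ccontr)
    assume "\<not> (\<exists>l<n. 0 < S (n + 1 + l))"
    then have "S (n + 1 + l) = 0" if "l < n" for l
      using that ip_self_nonneg[of n "W (n + 1 + l)"] by force
    then have "(\<Sum>l<n. S (n + 1 + l) / S (n + 1 + l)) = 0" by simp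
    then show False using candidates pos by linarith
  qed
  assume q: "\<And>l. l < n \<Longrightarrow> 0 < S (n + 1 + l) \<Longrightarrow> q \<le> quad n a z (W (n + 1 + l)) / S (n + 1 + l)" and "0 \<le> q"
  have "q * ((\<Sum>j<n. al j) - (\<Sum>i<n. bl i) - 1) \<le> q * (\<Sum>l<n. S (n + 1 + l) / S (n + 1 + l))"
    using candidates \<open>0 \<le> q\<close> by (intro mult_left_mono) auto
  also have "\<dots> = (\<Sum>l<n. q * (S (n + 1 + l) / S (n + 1 + l)))" by (rule sum_distrib_left)
  also have "\<dots> \<le> (\<Sum>l<n. quad n a z (W (n + 1 + l)) / S (n + 1 + l))"
  proof (rule sum_mono)
    fix l assume l: "l \<in> {..<n}"
    \<comment> \<open>For a zero residual both sides are 0, again because x / 0 = 0.\<close>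
    show "q * (S (n + 1 + l) / S (n + 1 + l)) \<le> quad n a z (W (n + 1 + l)) / S (n + 1 + l)"
      using q[of l] l ip_self_nonneg[of n "W (n + 1 + l)"]
      by (cases "S (n + 1 + l) = 0") (auto simp: divide_self_if)
  qed
  also note quad_total
  finally show "q * ((\<Sum>j<n. al j) - (\<Sum>i<n. bl i) - 1) \<le> (\<Sum>j<n. al j) * (\<Sum>i | i < n \<and> bl i = 0. z i)" .
qed

end

subsection \<open>The potential along a step\<close>

text \<open>
  The constant 423 lies slightly above \<open>(15/2)^3\<close>, which is the least value for which the decay of the factor
  \<open>(cap n x)^2\<close> pays for the second-order growth once \<open>tau n x \<le> 3/4 * n\<close>. Before that the cap is constant, and
  \<open>growth\<close> is the budget for the increase of the potential; its term \<open>1 / n^3\<close> covers the step that crosses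
  the threshold. The factor \<open>1001/1000\<close> absorbs the discretisation of the barrier.
\<close>

definition psi :: "nat \<Rightarrow> (nat \<Rightarrow> nat \<Rightarrow> real) \<Rightarrow> real \<Rightarrow> (nat \<Rightarrow> real) \<Rightarrow> real" where
  "psi n a \<mu> x = \<mu> + 423/5 * (1001/1000) * (cap n x)\<^sup>2 * pot n a 5 \<mu> x"

definition growth :: "nat \<Rightarrow> real \<Rightarrow> real" where
  "growth n t = 127/100 / sqrt n * max (t - 3/4 * n + 1 / n^3) 0"

text \<open>36741/10000 is 3 times 12247/10000, a rational just below sqrt (3/2); the summand 2
  takes the lower-order terms that arise in \<open>inv_settled\<close>.\<close>

definition bound :: "nat \<Rightarrow> real" where
  "bound n = 36741/10000 * sqrt n + 2"

text \<open>The second alternative is needed before the barrier has left its initial value.\<close>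

definition barrier_inv :: "nat \<Rightarrow> (nat \<Rightarrow> nat \<Rightarrow> real) \<Rightarrow> (nat \<Rightarrow> real) \<Rightarrow> real \<Rightarrow> bool" where
  "barrier_inv n a x \<mu> \<longleftrightarrow> (\<forall>j<n. \<bar>x j\<bar> \<le> 1) \<and> (\<forall>i<n. 1 \<le> \<mu> - \<bar>row n a x i\<bar>) \<and>
     (psi n a \<mu> x + growth n (tau n x) \<le> bound n \<or>
      (\<forall>j<n. x j = 0) \<and> \<mu> \<le> 27943/10000 * sqrt n + 1)"

lemma tau_le: "tau n x \<le> n"
  using ip_self_nonneg[of n x] by (simp add: tau_def)

lemma cap_bounds:
  assumes "10000 \<le> tau n x"
  shows "7500 \<le> cap n x" "cap n x \<le> 3/4 * n" "cap n x \<le> tau n x" "10000 \<le> real n"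
  using assms tau_le[of n x] by (auto simp: cap_def)

lemma pot_nonneg:
  assumes "\<forall>i<n. 1 \<le> \<mu> - \<bar>row n a x i\<bar>"
  shows "0 \<le> pot n a p \<mu> x"
  unfolding pot_def
proof (rule sum_nonneg)
  fix i assume "i \<in> {..<n}"
  then have "0 \<le> \<mu> - row n a x i" "0 \<le> \<mu> + row n a x i" using assms by force+
  then show "0 \<le> 1 / (\<mu> - row n a x i) ^ p + 1 / (\<mu> + row n a x i) ^ p" by simp
qed

lemma row_zero: "\<forall>j<n. x j = 0 \<Longrightarrow> row n a x i = 0"
  by (simp add: row_def ip_def)

lemma pot_zero: "\<forall>j<n. x j = 0 \<Longrightarrow> pot n a p \<mu> x = 2 * real n / \<mu> ^ p"
  by (simp add: pot_def row_zero)

lemma tau_zero: "\<forall>j<n. x j = 0 \<Longrightarrow> tau n x = n"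
  by (simp add: tau_def ip_def)

lemma cap_zero: "\<forall>j<n. x j = 0 \<Longrightarrow> cap n x = 3/4 * n"
  by (simp add: cap_def tau_zero)

lemma inverse_sixth_shift:
  fixes s h :: real
  assumes "1 \<le> s" "0 \<le> h" "h \<le> 1/10000"
  shows "1 / s^6 \<le> 1001/1000 * (1 / (s + h)^6)"
proof -
  have "s + h \<le> 10001/10000 * s" using assms by simp
  then have "(s + h)^6 \<le> (10001/10000 * s)^6" using assms by (intro power_mono) auto
  also have "\<dots> = (10001/10000)^6 * s^6" by (rule power_mult_distrib)
  also have "\<dots> \<le> 1001/1000 * s^6"
    using assms by (intro mult_right_mono) (auto simp: eval_nat_numeral)
  finally show ?thesis using assms by (simp add: field_simps)
qed

text \<open>By the tangent inequality a raise by \<open>h\<close> adds \<open>h\<close> to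
  \<open>psi\<close> and removes \<open>h\<close> times 1001/1000 * 423 T^2 times the sixth-power
  sum at the raised barrier. The factor 1001/1000 makes this at least \<open>h\<close> although
  \<open>big\<close> speaks of the old barrier.\<close>

lemma inv_increase:
  assumes barrier_inv: "barrier_inv n a x \<mu>" and tau: "10000 \<le> tau n x"
    and big: "1 < 423 * (cap n x * cap n x) * pot n a 6 \<mu> x"
  shows "barrier_inv n a x (\<mu> + 1 / n)"
proof -
  define h where "h = 1 / real n"
  note cap = cap_bounds[OF tau]
  have h: "0 < h" "h \<le> 1/10000" using cap by (auto simp: h_def field_simps)
  have s: "\<forall>i<n. 1 \<le> \<mu> - \<bar>row n a x i\<bar>" using barrier_inv by (simp add: barrier_inv_def)
  then have s': "1 \<le> \<mu> - row n a x i" "1 \<le> \<mu> + row n a x i" if "i < n" for i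
    using that by force+
  have "psi n a (\<mu> + h) x \<le> psi n a \<mu> x"
  proof -
    let ?c = "423 * (cap n x)\<^sup>2"
    have p5: "pot n a 5 (\<mu> + h) x + 5 * h * pot n a 6 (\<mu> + h) x \<le> pot n a 5 \<mu> x"
      unfolding pot_def sum_distrib_left sum.distrib[symmetric]
    proof (rule sum_mono)
      fix i assume "i \<in> {..<n}"
      then show "1 / (\<mu> + h - row n a x i) ^ 5 + 1 / (\<mu> + h + row n a x i) ^ 5 +
          5 * h * (1 / (\<mu> + h - row n a x i) ^ 6 + 1 / (\<mu> + h + row n a x i) ^ 6)
          \<le> 1 / (\<mu> - row n a x i) ^ 5 + 1 / (\<mu> + row n a x i) ^ 5"
        using convex_inverse_fifth[of "\<mu> - row n a x i" h] convex_inverse_fifth[of "\<mu> + row n a x i" h]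
          s'[of i] h by (simp add: algebra_simps)
    qed
    have p6: "pot n a 6 \<mu> x \<le> 1001/1000 * pot n a 6 (\<mu> + h) x"
      unfolding pot_def sum_distrib_left
    proof (rule sum_mono)
      fix i assume "i \<in> {..<n}"
      then show "1 / (\<mu> - row n a x i) ^ 6 + 1 / (\<mu> + row n a x i) ^ 6 \<le>
          1001/1000 * (1 / (\<mu> + h - row n a x i) ^ 6 + 1 / (\<mu> + h + row n a x i) ^ 6)"
        using inverse_sixth_shift[of "\<mu> - row n a x i" h] inverse_sixth_shift[of "\<mu> + row n a x i" h]
          s'[of i] h by (simp add: algebra_simps)
    qed
    have "?c * pot n a 6 \<mu> x \<le> ?c * (1001/1000 * pot n a 6 (\<mu> + h) x)"
      using p6 by (intro mult_left_mono) auto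
    then have one: "1 \<le> 1001/1000 * (?c * pot n a 6 (\<mu> + h) x)"
      using big by (simp add: power2_eq_square)
    have "?c * (pot n a 5 (\<mu> + h) x + 5 * h * pot n a 6 (\<mu> + h) x) \<le> ?c * pot n a 5 \<mu> x"
      using p5 by (intro mult_left_mono) auto
    moreover have "h * 1 \<le> h * (1001/1000 * (?c * pot n a 6 (\<mu> + h) x))"
      using one h by (intro mult_left_mono) auto
    ultimately show ?thesis by (simp add: psi_def algebra_simps)
  qed
  moreover have "\<mu> + h \<le> 27943/10000 * sqrt n + 1" if z: "\<forall>j<n. x j = 0"
  proof -
    have n: "0 < n" using cap by simp
    have m: "0 < \<mu>" using s'[OF n] by (simp add: row_zero[OF z])
    \<comment> \<open>At the origin all 2n slacks equal \<mu>, so \<open>big\<close> bounds \<mu>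
      itself. The number 27943/10000 lies slightly above the sixth root of 423 * 9/16 * 2.\<close>
    have "\<mu>^6 < 423 * (9/16 * real n^2) * (2 * n)"
      using big m by (simp add: cap_zero[OF z] pot_zero[OF z] field_simps power2_eq_square)
    also have "\<dots> \<le> (27943/10000)^6 * real n ^ 3"
      by (simp add: eval_nat_numeral)
    also have "real n ^ 3 = sqrt n ^ 6"
      using real_sqrt_pow2[of "real n"] power_mult[of "sqrt (real n)" 2 3] by simp
    also have "(27943/10000)^6 * sqrt n ^ 6 = (27943/10000 * sqrt n)^6"
      by (rule power_mult_distrib[symmetric])
    finally have "\<mu> < 27943/10000 * sqrt n"
      by (rule power_less_imp_less_base) simp
    then show ?thesis using h by simp
  qed
  ultimately show ?thesis using barrier_inv h s unfolding h_def[symmetric] barrier_inv_def by force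
qed

text \<open>At the origin the fifth-power sum is \<mu> times the sixth-power sum, so once the
  barrier rests the potential exceeds \<mu> by at most 1001/5000 of it. The remaining budget pays
  for \<open>growth\<close>, which there amounts to 127/400 sqrt n up to a constant.\<close>

lemma inv_settled:
  assumes barrier_inv: "barrier_inv n a x \<mu>" and tau: "10000 \<le> tau n x"
    and small: "423 * (cap n x * cap n x) * pot n a 6 \<mu> x \<le> 1"
  shows "psi n a \<mu> x + growth n (tau n x) \<le> bound n"
proof (cases "psi n a \<mu> x + growth n (tau n x) \<le> bound n")
  case False
  then have z: "\<forall>j<n. x j = 0" and m: "\<mu> \<le> 27943/10000 * sqrt n + 1" using barrier_inv by (auto simp: barrier_inv_def)
  note cap = cap_bounds[OF tau]
  have n: "0 < n" using cap by simp
  have m0: "1 \<le> \<mu>" using barrier_inv n by (auto simp: barrier_inv_def row_zero[OF z])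
  have "pot n a 5 \<mu> x = \<mu> * pot n a 6 \<mu> x"
    using m0 by (simp add: pot_zero[OF z] eval_nat_numeral)
  then have "psi n a \<mu> x = \<mu> + 1001/5000 * (423 * (cap n x * cap n x) * pot n a 6 \<mu> x) * \<mu>"
    by (simp add: psi_def power2_eq_square)
  also have "\<dots> \<le> \<mu> + 1001/5000 * 1 * \<mu>"
    using small m0 by (intro add_left_mono mult_right_mono mult_left_mono) auto
  also have "\<dots> \<le> 12002/10000 * (27943/10000 * sqrt n + 1)" using m by simp
  finally have 1: "psi n a \<mu> x \<le> 12002/10000 * (27943/10000 * sqrt n + 1)" .
  have "0 \<le> real n / 4 + 1 / real n^3" by simp
  then have "max (real n - 3/4 * real n + 1 / real n^3) 0 = real n / 4 + 1 / real n^3" by (simp add: max_absorb1)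
  then have "growth n (tau n x) = 127/100 * (real n / 4 / sqrt n) + 127/100 * (1 / real n^3 / sqrt n)"
    unfolding growth_def tau_zero[OF z] by (simp only:) (simp add: add_divide_distrib distrib_left)
  also have "real n / 4 / sqrt n = sqrt n / 4"
    using real_div_sqrt[of "real n"] by simp
  also have "1 / real n^3 / sqrt n \<le> 1 / 10"
  proof -
    have "1 \<le> real n^3" "10 \<le> sqrt n" using cap by (auto intro: real_le_rsqrt)
    then have "1 * 10 \<le> real n^3 * sqrt n" by (intro mult_mono) auto
    then show ?thesis using n by (simp add: field_simps)
  qed
  finally have "growth n (tau n x) \<le> 127/100 * (sqrt n / 4) + 127/100 * (1/10)" by simp
  moreover have "0 \<le> sqrt n" by simp
  ultimately have "psi n a \<mu> x + growth n (tau n x) \<le> (127/400 + 12002/10000 * (27943/10000)) * sqrt n + 2"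
    using 1 by (simp add: algebra_simps)
  \<comment> \<open>The coefficient on the left is about 3.6712.\<close>
  also have "\<dots> \<le> 36741/10000 * sqrt n + 2"
    by (intro add_mono mult_right_mono) auto
  finally show ?thesis unfolding bound_def .
qed

text \<open>Guarded by the existence of a nonzero candidate, so that the search satisfies it in
  every state; \<open>best_candidate\<close> later discharges the guard. Costs are taken per squared
  length because \<open>tau\<close> drops by the squared length.\<close>

definition best_direction ::
  "nat \<Rightarrow> (nat \<Rightarrow> nat \<Rightarrow> real) \<Rightarrow> (nat \<Rightarrow> real) \<Rightarrow> (nat \<Rightarrow> nat \<Rightarrow> real) \<Rightarrow> nat \<Rightarrow> bool" where
  "best_direction n a z W m \<longleftrightarrow>
     ((\<exists>l<n. 0 < ip n (W (n + 1 + l)) (W (n + 1 + l))) \<longrightarrow>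
      (\<exists>l<n. m = n + 1 + l) \<and> 0 < ip n (W m) (W m) \<and>
      (\<forall>l<n. 0 < ip n (W (n + 1 + l)) (W (n + 1 + l)) \<longrightarrow>
         quad n a z (W m) / ip n (W m) (W m) \<le>
         quad n a z (W (n + 1 + l)) / ip n (W (n + 1 + l)) (W (n + 1 + l))))"

definition sup_norm :: "nat \<Rightarrow> (nat \<Rightarrow> real) \<Rightarrow> real \<Rightarrow> bool" where
  "sup_norm n v M \<longleftrightarrow> 0 \<le> M \<and> (\<forall>j<n. \<bar>v j\<bar> \<le> M) \<and> (M = 0 \<or> (\<exists>j<n. \<bar>v j\<bar> = M))"

definition move :: "nat \<Rightarrow> (nat \<Rightarrow> nat \<Rightarrow> real) \<Rightarrow> real \<Rightarrow> (nat \<Rightarrow> real) \<Rightarrow> (nat \<Rightarrow> real) \<Rightarrow> (nat \<Rightarrow> real) \<Rightarrow> bool" where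
  "move n a \<mu> x d x' \<longleftrightarrow>
     (if pot n a 5 \<mu> (\<lambda>j. x j + d j) < pot n a 5 \<mu> (\<lambda>j. x j - d j)
      then \<forall>j<n. x' j = x j + d j else \<forall>j<n. x' j = x j - d j)"

definition step_spec :: "nat \<Rightarrow> (nat \<Rightarrow> nat \<Rightarrow> real) \<Rightarrow> real \<Rightarrow> (nat \<Rightarrow> real) \<Rightarrow> (nat \<Rightarrow> real) \<Rightarrow> bool" where
  "step_spec n a \<mu> x x' \<longleftrightarrow> (\<exists>W m M.
     gram_schmidt n (2 * n + 1) (generators n a x (alive n x) (blocked n a \<mu> x)) W \<and>
     best_direction n a (weight n a \<mu> x) W m \<and> sup_norm n (W m) M \<and>
     move n a \<mu> x (\<lambda>j. W m j / (M * (real n * real n))) x')"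

text \<open>The better sign is at most the mean of both, and in the mean all odd-order terms cancel.
  Comparing two values of the potential thus replaces the computation of a derivative.\<close>

lemma move_cases:
  assumes "move n a \<mu> x d x'"
  obtains s where "s = 1 \<or> s = -1" "\<forall>j<n. x' j = x j + s * d j"
    "2 * pot n a 5 \<mu> x' \<le> pot n a 5 \<mu> (\<lambda>j. x j + d j) + pot n a 5 \<mu> (\<lambda>j. x j - d j)"
proof -
  have cong: "pot n a 5 \<mu> x' = pot n a 5 \<mu> y" if "\<forall>j<n. x' j = y j" for y
    unfolding pot_def row_def using that by (auto intro!: sum.cong simp: ip_def)
  show ?thesis
  proof (cases "pot n a 5 \<mu> (\<lambda>j. x j + d j) < pot n a 5 \<mu> (\<lambda>j. x j - d j)")
    case True
    then have x': "\<forall>j<n. x' j = x j + d j" using assms by (simp add: move_def)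
    show ?thesis using True cong[OF x'] x' by (intro that[of 1]) auto
  next
    case False
    then have x': "\<forall>j<n. x' j = x j - d j" using assms by (simp add: move_def)
    show ?thesis using False cong[OF x'] x' by (intro that[of "-1"]) auto
  qed
qed

text \<open>A frozen coordinate contributes
  \<open>(1 - \<bar>x j\<bar>) * (1 + \<bar>x j\<bar>)\<close>, at most 2 / n^2, and an alive one at
  most 1.\<close>

lemma tau_le_nalive:
  assumes "\<forall>j<n. \<bar>x j\<bar> \<le> 1" "0 < n"
  shows "tau n x \<le> nalive n x + 2 / n"
proof -
  have "1 - x j * x j \<le> alive n x j + 2 / (real n * real n)" if j: "j < n" for j
  proof (cases "\<bar>x j\<bar> < 1 - 1 / (real n * real n)")
    case True
    then have "alive n x j = 1" by (simp add: alive_def abs_less_iff)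
    moreover have "0 \<le> x j * x j" "0 \<le> 2 / (real n * real n)" by simp_all
    ultimately show ?thesis by linarith
  next
    case False
    have "\<bar>x j\<bar> \<le> 1" using assms j by simp
    then have "(1 - \<bar>x j\<bar>) * (1 + \<bar>x j\<bar>) \<le> 1 / (real n * real n) * 2"
      using False by (intro mult_mono) auto
    moreover have "(1 - \<bar>x j\<bar>) * (1 + \<bar>x j\<bar>) = 1 - x j * x j" by (simp add: algebra_simps)
    moreover have "0 \<le> alive n x j" by (simp add: alive_def)
    ultimately show ?thesis by simp
  qed
  then have "(\<Sum>j<n. 1 - x j * x j) \<le> (\<Sum>j<n. alive n x j + 2 / (real n * real n))"
    by (intro sum_mono) auto
  also have "\<dots> = nalive n x + 2 / n" using assms(2) by (simp add: sum.distrib nalive_def)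
  finally show ?thesis by (simp add: tau_def ip_def sum_subtractf)
qed

section \<open>One step of the walk when the barrier is at rest\<close>

locale bounded_rows =
  fixes n :: nat and a :: "nat \<Rightarrow> nat \<Rightarrow> real"
  assumes a: "\<And>i j. i < n \<Longrightarrow> j < n \<Longrightarrow> \<bar>a i j\<bar> \<le> 1"

locale active_state = bounded_rows +
  fixes x :: "nat \<Rightarrow> real" and \<mu> :: real
  assumes barrier_inv: "barrier_inv n a x \<mu>" and tau: "10000 \<le> tau n x"
    and small: "423 * (cap n x * cap n x) * pot n a 6 \<mu> x \<le> 1"
begin

abbreviation "T \<equiv> cap n x"
abbreviation "k \<equiv> nalive n x"
abbreviation "y \<equiv> row n a x"

lemmas capb = cap_bounds[OF tau]

text \<open>A single term of the sixth-power sum is at most 1 / (423 T^2). The value 2 is a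
  convenient consequence: after a step, which moves a row by at most 1 / n, the slack is still at
  least 1.\<close>

lemma slack: "i < n \<Longrightarrow> 2 \<le> \<mu> - \<bar>y i\<bar>"
proof -
  assume i: "i < n"
  define s where "s = \<mu> - \<bar>y i\<bar>"
  have all: "\<forall>i<n. 1 \<le> \<mu> - \<bar>y i\<bar>" using barrier_inv by (simp add: barrier_inv_def)
  have s: "1 \<le> s" using all i by (simp add: s_def)
  have nonneg: "0 \<le> 1 / (\<mu> - y j)^6 + 1 / (\<mu> + y j)^6" for j by simp
  have "1 / s^6 \<le> 1 / (\<mu> - y i)^6 + 1 / (\<mu> + y i)^6"
    by (cases "0 \<le> y i") (simp_all add: s_def)
  also have "\<dots> \<le> pot n a 6 \<mu> x"
    unfolding pot_def using i nonneg by (intro member_le_sum) auto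
  finally have "423 * (T * T) * (1 / s^6) \<le> 1"
    using small by (smt (verit) mult_left_mono zero_le_square)
  then have "423 * (T * T) \<le> s^6" using s by (simp add: field_simps)
  moreover have "1 * 1 \<le> T * T" using capb by (intro mult_mono) auto
  ultimately have "2^6 \<le> s^6" by simp
  moreover have "s^6 < 2^6" if "s < 2" using that s by (intro power_strict_mono) auto
  ultimately show ?thesis unfolding s_def[symmetric] by linarith
qed

lemma slack_pos: "i < n \<Longrightarrow> 0 < \<mu> - y i" "i < n \<Longrightarrow> 0 < \<mu> + y i"
  using slack[of i] by linarith+

lemma alive_large:
    "9998 \<le> k - 1" "tau n x \<le> (k - 1) * (1 + 2/10000)"
    "k \<le> (k - 1) * (1 + 2/10000)" "3/4 * real n \<le> tau n x \<Longrightarrow> 7498/10000 * real n \<le> k - 1"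
proof -
  have "tau n x \<le> k + 2 / n" using barrier_inv capb by (intro tau_le_nalive) (auto simp: barrier_inv_def)
  moreover have "2 / real n \<le> 2 / 10000" using capb by (intro divide_left_mono) auto
  ultimately have *: "tau n x \<le> k + 2 / 10000" by simp
  show 1: "9998 \<le> k - 1" using * tau by simp
  show "tau n x \<le> (k - 1) * (1 + 2/10000)" "k \<le> (k - 1) * (1 + 2/10000)"
    using * 1 by (auto simp: algebra_simps)
  show "3/4 * real n \<le> tau n x \<Longrightarrow> 7498/10000 * real n \<le> k - 1" using * capb by simp
qed


text \<open>Averaging over the candidates bounds the cost by \<open>k\<close> times the seventh
  powers of the unblocked rows over the remaining dimension, and \<open>level_bounds\<close> cancels
  that dimension. The bound by \<open>w ^ 7\<close> serves while \<open>T\<close> is constant, the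
  one relative to the potential once \<open>T\<close> decreases.\<close>

lemma direction_bounds:
  assumes gs: "gram_schmidt n (2 * n + 1) (generators n a x (alive n x) (blocked n a \<mu> x)) W"
    and best: "best_direction n a (weight n a \<mu> x) W m"
  obtains w where "0 < w" "w ^ 6 * (423 * (T * T) * (k - 1)) = 1"
    "0 < ip n (W m) (W m)"
    "quad n a (weight n a \<mu> x) (W m) \<le> ip n (W m) (W m) * (k * w ^ 7)"
    "(k - 1) * quad n a (weight n a \<mu> x) (W m) \<le> ip n (W m) (W m) * (k * w\<^sup>2 * pot n a 5 \<mu> x)"
    "ip n x (W m) = 0" "\<And>j. j < n \<Longrightarrow> alive n x j = 0 \<Longrightarrow> W m j = 0"
proof -
  let ?z = "weight n a \<mu> x" and ?b = "\<Sum>i<n. blocked n a \<mu> x i"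
  define k' where "k' = k - 1"
  define c where "c = 423 * (T * T) * k'"
  have k': "9998 \<le> k'" using alive_large by (simp add: k'_def)
  have TT: "0 < 423 * (T * T)" using capb by simp
  have c: "0 < c" using k' TT by (simp add: c_def)
  define w where "w = root 6 (1 / c)"
  have w: "0 < w" "w ^ 6 = 1 / c" using c by (simp_all add: w_def)
  define up um where "up i = 1 / (\<mu> - y i)" and "um i = 1 / (\<mu> + y i)" for i
  interpret direction_search n a x "alive n x" "blocked n a \<mu> x" ?z W
  proof
    fix i assume "i < n"
    then show "0 \<le> ?z i" using slack_pos[of i] by (simp add: weight_def)
  qed (use a gs in \<open>auto simp: alive_def blocked_def\<close>)
  \<comment> \<open>The root \<open>w\<close> exists only in the analysis; the program compares
    sixth powers.\<close>
  have lvl: "w < 1 / s \<longleftrightarrow> s ^ 6 < c" if "0 < s" for s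
  proof -
    have "w < 1 / s \<longleftrightarrow> w ^ 6 < (1 / s) ^ 6"
      using w that by (intro power_mono_iff[symmetric, THEN arg_cong[of _ _ Not], simplified not_le]) auto
    also have "\<dots> \<longleftrightarrow> s ^ 6 < c" using c that by (simp add: w power_divide field_simps)
    finally show ?thesis .
  qed
  have bl: "blocked n a \<mu> x i = (if w < up i \<or> w < um i then 1 else 0)" if "i < n" for i
    using lvl[of "\<mu> - y i"] lvl[of "\<mu> + y i"] slack_pos[OF that]
    by (simp add: blocked_def up_def um_def thr_def c_def k'_def)
  define B where "B = {i. i < n \<and> (w < up i \<or> w < um i)}"
  define R where "R = {i. i < n \<and> \<not> (w < up i \<or> w < um i)}"
  have b: "?b = card B"
  proof -
    have "?b = (\<Sum>i<n. if i \<in> B then 1 else 0)" by (rule sum.cong) (auto simp: bl B_def)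
    also have "\<dots> = (\<Sum>i\<in>{..<n} \<inter> B. 1)" by (rule sum.inter_restrict[symmetric]) simp
    also have "{..<n} \<inter> B = B" by (auto simp: B_def)
    finally show ?thesis by simp
  qed
  have R: "{i. i < n \<and> blocked n a \<mu> x i = 0} = R" by (auto simp: R_def bl)
  have z: "?z i = up i ^ 7 + um i ^ 7" for i by (simp add: weight_def up_def um_def power_divide)
  have pot: "pot n a p \<mu> x = (\<Sum>i<n. up i ^ p + um i ^ p)" for p
    by (simp add: pot_def up_def um_def power_divide)
  \<comment> \<open>As \<open>k' * w ^ 6\<close> is 1 / (423 T^2), this is exactly the condition
    that the barrier is at rest.\<close>
  have six: "(\<Sum>i<n. up i ^ 6 + um i ^ 6) \<le> k' * w ^ 6"
    unfolding pot[symmetric] using small TT k' by (simp add: w c_def field_simps)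
  note lb = level_bounds[of n up um w k', OF _ _ w(1) _ six, folded B_def R_def]
  have pos: "0 < up i" "0 < um i" if "i < n" for i using slack_pos[OF that] by (auto simp: up_def um_def)
  have n: "0 < n" using capb by simp
  define q where "q = quad n a ?z (W m) / S m"
  define a7 where "a7 = (\<Sum>i\<in>R. up i ^ 7 + um i ^ 7)"
  have gap: "0 < k' - card B" using lb(1) pos n by simp
  have gap': "0 < (\<Sum>j<n. alive n x j) - ?b - 1" using gap by (simp add: b k'_def nalive_def)
  from best_candidate(1)[OF gap'] best
  have m: "\<exists>l<n. m = n + 1 + l" "0 < S m"
    "\<And>l. l < n \<Longrightarrow> 0 < S (n + 1 + l) \<Longrightarrow> q \<le> quad n a ?z (W (n + 1 + l)) / S (n + 1 + l)"
    by (auto simp: best_direction_def q_def)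
  have q0: "0 \<le> q"
  proof -
    have "0 \<le> ?z i" if "i < n" for i using slack_pos[OF that] by (simp add: weight_def)
    then show ?thesis unfolding q_def quad_def
      by (intro divide_nonneg_nonneg sum_nonneg mult_nonneg_nonneg[OF _ zero_le_square]) (auto simp: ip_self_nonneg)
  qed
  have q: "q * (k' - card B) \<le> k * a7"
    using best_candidate(2)[OF gap' m(3) q0] unfolding b R z a7_def[symmetric]
    by (simp add: k'_def nalive_def algebra_simps)
  have k0: "0 \<le> k" using k' by (simp add: k'_def)
  have "q * (k' - card B) \<le> (k * w ^ 7) * (k' - card B)"
  proof -
    have "k * a7 \<le> k * ((k' - card B) * w ^ 7)"
      using lb(2) pos n k0 by (intro mult_left_mono) (auto simp: a7_def)
    then show ?thesis using q by (simp add: algebra_simps)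
  qed
  then have q1: "q \<le> k * w ^ 7" using gap by simp
  have "(k' * q) * (k' - card B) \<le> (k * w\<^sup>2 * pot n a 5 \<mu> x) * (k' - card B)"
  proof -
    have "k' * (q * (k' - card B)) \<le> k' * (k * a7)" using q k' by (intro mult_left_mono) auto
    moreover have "k * (k' * a7) \<le> k * ((k' - card B) * w\<^sup>2 * pot n a 5 \<mu> x)"
      using lb(3) pos n k0 by (intro mult_left_mono) (auto simp: a7_def pot)
    ultimately show ?thesis by (simp add: algebra_simps)
  qed
  then have q2: "k' * q \<le> k * w\<^sup>2 * pot n a 5 \<mu> x" using gap by simp
  have quad: "quad n a ?z (W m) = S m * q" using m(2) by (simp add: q_def)
  show ?thesis
  proof (rule that[of w])
    show "w ^ 6 * (423 * (T * T) * (k - 1)) = 1" using c by (simp add: w c_def[symmetric] k'_def[symmetric])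
    show "quad n a ?z (W m) \<le> S m * (k * w ^ 7)"
      unfolding quad using q1 m(2) by (intro mult_left_mono) auto
    have "S m * (k' * q) \<le> S m * (k * w\<^sup>2 * pot n a 5 \<mu> x)"
      using q2 m(2) by (intro mult_left_mono) auto
    then show "(k - 1) * quad n a ?z (W m) \<le> S m * (k * w\<^sup>2 * pot n a 5 \<mu> x)"
      by (simp add: quad k'_def mult_ac)
    show "ip n x (W m) = 0" using m(1) position_orthogonal by auto
    show "W m j = 0" if "j < n" "alive n x j = 0" for j
      using m(1) that by (auto intro!: support)
  qed (use w m in auto)
qed

end

lemma ip_scale_right: "ip n w (\<lambda>j. c * u j) = c * ip n w u"
  by (simp add: ip_def sum_distrib_left mult_ac)

lemma row_shift: "(\<And>j. j < n \<Longrightarrow> x' j = x j + s * d j) \<Longrightarrow> row n a x' i = row n a x i + s * row n a d i"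
  by (simp add: row_def ip_def sum.distrib sum_distrib_left algebra_simps)

context active_state
begin

text \<open>Comparing cubes removes the root: the equation for \<open>w ^ 6\<close> leaves T k^3 /
  (423 (k - 1)), and \<open>T\<close> is \<open>tau n x\<close>, at most about \<open>k - 1\<close>.
  What has to hold is 7.5008^3 * 1.0002^4 < 423.\<close>

lemma level_late:
  assumes w: "0 < w" "w ^ 6 * (423 * (T * T) * (k - 1)) = 1" and late: "tau n x \<le> 3/4 * n"
  shows "75008/10000 * (T * k * w\<^sup>2) \<le> k - 1"
proof -
  have T: "T = tau n x" using late by (simp add: cap_def)
  define k' where "k' = k - 1"
  have k': "9998 \<le> k'" "T \<le> k' * (1 + 2/10000)" "k \<le> k' * (1 + 2/10000)" "0 \<le> k" "0 \<le> T"
    using alive_large capb by (auto simp: k'_def T)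
  have "(75008/10000 * (T * k * w\<^sup>2))^3 = (75008/10000)^3 * (T * k^3 * ((T * T) * w^6))"
    by (simp add: power_mult_distrib eval_nat_numeral)
  also have "(T * T) * w^6 = 1 / (423 * k')"
    using w k' by (simp add: k'_def[symmetric] field_simps)
  also have "(75008/10000)^3 * (T * k^3 * (1 / (423 * k'))) \<le>
      (75008/10000)^3 * ((k' * (1 + 2/10000)) * (k' * (1 + 2/10000))^3 * (1 / (423 * k')))"
    using k' by (intro mult_left_mono mult_right_mono mult_mono power_mono) auto
  also have "\<dots> = (75008/10000)^3 * (1 + 2/10000)^4 / 423 * k'^3"
    using k' by (simp add: eval_nat_numeral)
  also have "\<dots> \<le> 1 * k'^3"
    using k' by (intro mult_right_mono) (auto simp: eval_nat_numeral)
  finally have "(75008/10000 * (T * k * w\<^sup>2))^3 \<le> k'^3" by simp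
  moreover have "k'^3 < (75008/10000 * (T * k * w\<^sup>2))^3" if "k' < 75008/10000 * (T * k * w\<^sup>2)"
    using that k' by (intro power_strict_mono) auto
  ultimately show ?thesis unfolding k'_def[symmetric] by linarith
qed

text \<open>With T = 3n/4 and \<open>k - 1\<close> at least 0.7498 n, the equation for
  \<open>w ^ 6\<close> makes \<open>w * sqrt n\<close> at most the sixth root of 1 / (423 * 9/16 *
  0.7498).\<close>

lemma level_early:
  assumes w: "0 < w" "w ^ 6 * (423 * (T * T) * (k - 1)) = 1" and early: "3/4 * n \<le> tau n x"
  shows "w * sqrt n \<le> 4218/10000"
proof -
  have T: "T = 3/4 * n" using early by (simp add: cap_def)
  have k': "7498/10000 * n \<le> k - 1" using alive_large(4)[OF early] .
  have n: "0 < real n" using capb by simp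
  have r: "sqrt n ^ 6 = real n^3"
    using real_sqrt_pow2[of "real n"] power_mult[of "sqrt (real n)" 2 3] by simp
  have "w^6 * (423 * (T * T) * (7498/10000 * n)) \<le> w^6 * (423 * (T * T) * (k - 1))"
    using k' w by (intro mult_left_mono) auto
  moreover have "(w * sqrt n)^6 * (423 * (9/16) * (7498/10000)) = w^6 * (423 * (T * T) * (7498/10000 * n))"
    unfolding power_mult_distrib r T by (simp add: eval_nat_numeral)
  ultimately have "(w * sqrt n)^6 * (423 * (9/16) * (7498/10000)) \<le> 1" using w(2) by linarith
  also have "1 \<le> (4218/10000)^6 * (423 * (9/16) * (7498/10000) :: real)"
    by (simp add: eval_nat_numeral)
  finally have "(w * sqrt n)^6 \<le> (4218/10000)^6" by simp
  moreover have "(4218/10000)^6 < (w * sqrt n)^6" if "4218/10000 < w * sqrt n"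
    using that by (intro power_strict_mono) auto
  ultimately show ?thesis by linarith
qed

text \<open>Orthogonality to \<open>x\<close> makes \<open>tau\<close> drop by exactly \<epsilon>,
  the squared step length, and the second-order cost \<open>Q\<close> is also proportional to
  \<epsilon>. Late, \<open>Q2\<close> is set against the loss of T^2; early, \<open>Q1\<close> is
  set against the loss of \<open>growth\<close>.\<close>

theorem step_inv:
  assumes step: "step_spec n a \<mu> x x'"
  shows "barrier_inv n a x' \<mu>" and "tau n x' \<le> tau n x - 1 / real n ^ 4"
proof -
  have n: "10000 \<le> real n" using capb by simp
  from step obtain W m M where gs: "gram_schmidt n (2 * n + 1) (generators n a x (alive n x) (blocked n a \<mu> x)) W"
    and best: "best_direction n a (weight n a \<mu> x) W m" and M: "sup_norm n (W m) M"
    and mv: "move n a \<mu> x (\<lambda>j. W m j / (M * (real n * real n))) x'"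
    by (auto simp: step_spec_def)
  define c where "c = 1 / (M * (real n * real n))"
  define d where "d j = c * W m j" for j
  have "(\<lambda>j. W m j / (M * (real n * real n))) = d" by (auto simp: d_def c_def)
  with mv have "move n a \<mu> x d x'" by simp
  then obtain s where s: "s = 1 \<or> s = -1" and x': "\<forall>j<n. x' j = x j + s * d j"
    and half: "2 * pot n a 5 \<mu> x' \<le> pot n a 5 \<mu> (\<lambda>j. x j + d j) + pot n a 5 \<mu> (\<lambda>j. x j - d j)"
    by (rule move_cases)
  have s2: "s * s = 1" using s by auto
  obtain w where w: "0 < w" "w ^ 6 * (423 * (T * T) * (k - 1)) = 1" and S: "0 < ip n (W m) (W m)"
    and q1: "quad n a (weight n a \<mu> x) (W m) \<le> ip n (W m) (W m) * (k * w ^ 7)"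
    and q2: "(k - 1) * quad n a (weight n a \<mu> x) (W m) \<le> ip n (W m) (W m) * (k * w\<^sup>2 * pot n a 5 \<mu> x)"
    and orth: "ip n x (W m) = 0" and supp: "\<And>j. j < n \<Longrightarrow> alive n x j = 0 \<Longrightarrow> W m j = 0"
    using direction_bounds[OF gs best] by metis
  have "\<exists>j<n. W m j \<noteq> 0"
    using S ip_zero_left[of n "W m" "W m"] by force
  then have "M \<noteq> 0" using M by (auto simp: sup_norm_def)
  then have M0: "0 < M" and Mle: "\<And>j. j < n \<Longrightarrow> \<bar>W m j\<bar> \<le> M" and "\<exists>j<n. \<bar>W m j\<bar> = M"
    using M by (auto simp: sup_norm_def)
  then obtain j0 where j0: "j0 < n" "\<bar>W m j0\<bar> = M" by auto
  have c0: "0 < c" using M0 n by (simp add: c_def)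
  have dle: "\<bar>d j\<bar> \<le> 1 / (real n * real n)" if "j < n" for j
  proof -
    have "\<bar>d j\<bar> = c * \<bar>W m j\<bar>" using c0 by (simp add: d_def abs_mult)
    also have "\<dots> \<le> c * M" using Mle[OF that] c0 by (intro mult_left_mono) auto
    also have "\<dots> = 1 / (real n * real n)" using M0 by (simp add: c_def)
    finally show ?thesis .
  qed
  define \<epsilon> where "\<epsilon> = ip n d d"
  have \<epsilon>: "\<epsilon> = c * c * ip n (W m) (W m)"
    unfolding \<epsilon>_def d_def by (simp add: ip_scale_left ip_scale_right)
  \<comment> \<open>The coordinate attaining the maximum norm alone contributes this much.\<close>
  have \<epsilon>_ge: "1 / real n ^ 4 \<le> \<epsilon>"
  proof -
    have "\<bar>d j0\<bar> = c * M" using c0 j0 by (simp add: d_def abs_mult)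
    then have "\<bar>d j0\<bar> = 1 / (real n * real n)" using M0 by (simp add: c_def)
    then have "\<bar>d j0\<bar> * \<bar>d j0\<bar> = 1 / real n ^ 4" by (simp add: eval_nat_numeral)
    then have "d j0 * d j0 = 1 / real n ^ 4" by simp
    moreover have "d j0 * d j0 \<le> \<epsilon>"
      unfolding \<epsilon>_def ip_def using j0 by (intro member_le_sum) auto
    ultimately show ?thesis by simp
  qed
  have \<epsilon>_pos: "0 < \<epsilon>" using \<epsilon>_ge n by (intro less_le_trans[OF _ \<epsilon>_ge]) simp
  \<comment> \<open>This is the 1 / n^3 in \<open>growth\<close>: a step passes the threshold 3n/4
    by at most that amount.\<close>
  have \<epsilon>_le: "\<epsilon> \<le> 1 / real n ^ 3"
  proof -
    have "\<epsilon> \<le> (\<Sum>j<n. 1 / (real n * real n) * (1 / (real n * real n)))"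
      unfolding \<epsilon>_def ip_def
    proof (rule sum_mono)
      fix j assume "j \<in> {..<n}"
      then have "\<bar>d j\<bar> * \<bar>d j\<bar> \<le> 1 / (real n * real n) * (1 / (real n * real n))"
        using dle by (intro mult_mono) auto
      then show "d j * d j \<le> 1 / (real n * real n) * (1 / (real n * real n))" by simp
    qed
    also have "\<dots> = 1 / real n ^ 3" using n by (simp add: power3_eq_cube)
    finally show ?thesis .
  qed
  have xd: "ip n x d = 0" using ip_scale_right[of n x c "W m"] orth by (simp add: d_def[abs_def])
  have tau': "tau n x' = tau n x - \<epsilon>"
  proof -
    have "ip n x' x' = (\<Sum>j<n. x j * x j + 2 * s * (x j * d j) + s * s * (d j * d j))"
      unfolding ip_def by (rule sum.cong) (use x' in \<open>auto simp: algebra_simps\<close>)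
    also have "\<dots> = ip n x x + 2 * s * ip n x d + s * s * ip n d d"
      by (simp add: ip_def sum.distrib sum_distrib_left)
    finally show ?thesis by (simp add: tau_def xd s2 \<epsilon>_def)
  qed
  show "tau n x' \<le> tau n x - 1 / real n ^ 4" using tau' \<epsilon>_ge by simp
  have x1: "\<bar>x' j\<bar> \<le> 1" if j: "j < n" for j
  proof (cases "alive n x j = 0")
    case True
    then have "d j = 0" using supp j by (simp add: d_def)
    then show ?thesis using x' j barrier_inv by (simp add: barrier_inv_def)
  next
    case False
    then have "\<bar>x j\<bar> < 1 - 1 / (real n * real n)" by (auto simp: alive_def split: if_splits)
    moreover have "\<bar>x' j\<bar> \<le> \<bar>x j\<bar> + \<bar>d j\<bar>" using x' j s by auto
    ultimately show ?thesis using dle[OF j] by linarith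
  qed
  define D where "D = row n a d"
  have D: "\<bar>D i\<bar> \<le> 1 / real n" if i: "i < n" for i
  proof -
    have "\<bar>D i\<bar> \<le> (\<Sum>j<n. \<bar>a i j * d j\<bar>)" unfolding D_def row_def ip_def by (rule sum_abs)
    also have "\<dots> \<le> (\<Sum>j<n. 1 * (1 / (real n * real n)))"
      unfolding abs_mult using a[OF i] dle by (intro sum_mono mult_mono) auto
    also have "\<dots> = 1 / real n" using n by simp
    finally show ?thesis .
  qed
  have n1: "1 / real n \<le> 1 / 10000" using n by (intro divide_left_mono) auto
  have row': "row n a x' i = y i + s * D i" for i
    using x' by (simp add: D_def row_shift)
  have slack': "1 \<le> \<mu> - \<bar>row n a x' i\<bar>" if i: "i < n" for i
    using slack[OF i] D[OF i] n1 s unfolding row' by (auto simp: abs_if split: if_splits)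
  have quadD: "(\<Sum>i<n. weight n a \<mu> x i * (D i)\<^sup>2) = c * c * quad n a (weight n a \<mu> x) (W m)"
    unfolding quad_def sum_distrib_left D_def row_def d_def ip_scale_right
    by (rule sum.cong) (auto simp: power2_eq_square)
  define Q where "Q = c * c * quad n a (weight n a \<mu> x) (W m)"
  have Q1: "Q \<le> \<epsilon> * (k * w ^ 7)"
    unfolding Q_def \<epsilon> mult.assoc using q1 c0 by (intro mult_left_mono) auto
  have Q2: "(k - 1) * Q \<le> \<epsilon> * (k * w\<^sup>2 * pot n a 5 \<mu> x)"
  proof -
    have "c * c * ((k - 1) * quad n a (weight n a \<mu> x) (W m)) \<le> c * c * (ip n (W m) (W m) * (k * w\<^sup>2 * pot n a 5 \<mu> x))"
      using q2 c0 by (intro mult_left_mono) auto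
    then show ?thesis by (simp add: Q_def \<epsilon> mult_ac)
  qed
  have pair: "pot n a 5 \<mu> (\<lambda>j. x j + d j) + pot n a 5 \<mu> (\<lambda>j. x j - d j) \<le>
      2 * pot n a 5 \<mu> x + 30 * (10001/10000) * Q"
  proof -
    have r1: "row n a (\<lambda>j. x j + d j) i = y i + D i" for i
      using row_shift[of n "\<lambda>j. x j + d j" x 1 d] by (simp add: D_def)
    have r2: "row n a (\<lambda>j. x j - d j) i = y i - D i" for i
      using row_shift[of n "\<lambda>j. x j - d j" x "-1" d] by (simp add: D_def)
    have "1 / (\<mu> - (y i + D i))^5 + 1 / (\<mu> + (y i + D i))^5 + (1 / (\<mu> - (y i - D i))^5 + 1 / (\<mu> + (y i - D i))^5)
       \<le> 2 * (1 / (\<mu> - y i)^5 + 1 / (\<mu> + y i)^5) + 30 * (10001/10000) * (weight n a \<mu> x i * (D i)\<^sup>2)"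
      if i: "i < n" for i
    proof -
      have b: "\<bar>D i\<bar> \<le> (\<mu> - y i) / 1000" "\<bar>D i\<bar> \<le> (\<mu> + y i) / 1000"
      proof -
        have "2 \<le> \<mu> - y i" "2 \<le> \<mu> + y i" using slack[OF i] by (simp_all add: abs_le_iff)
        moreover have "\<bar>D i\<bar> \<le> 1 / 10000" using D[OF i] n1 by (rule order_trans)
        ultimately show "\<bar>D i\<bar> \<le> (\<mu> - y i) / 1000" "\<bar>D i\<bar> \<le> (\<mu> + y i) / 1000" by simp_all
      qed
      have e: "\<mu> - (y i + D i) = (\<mu> - y i) - D i" "\<mu> + (y i + D i) = (\<mu> + y i) + D i"
         "\<mu> - (y i - D i) = (\<mu> - y i) + D i" "\<mu> + (y i - D i) = (\<mu> + y i) - D i" by auto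
      have wt: "weight n a \<mu> x i * (D i)\<^sup>2 = (D i)\<^sup>2 / (\<mu> - y i)^7 + (D i)\<^sup>2 / (\<mu> + y i)^7"
        by (simp add: weight_def distrib_right)
      show ?thesis unfolding e wt
        using even_part_inverse_fifth[OF slack_pos(1)[OF i] b(1)] even_part_inverse_fifth[OF slack_pos(2)[OF i] b(2)]
        unfolding distrib_left by linarith
    qed
    then show ?thesis
      unfolding pot_def r1 r2 Q_def quadD[symmetric] sum.distrib[symmetric] sum_distrib_left
      by (intro sum_mono) auto
  qed
  define p where "p = pot n a 5 \<mu> x"
  define p' where "p' = pot n a 5 \<mu> x'"
  have pp: "p' \<le> p + 15 * (10001/10000) * Q" using half pair by (simp add: p_def p'_def)
  have p0: "0 \<le> p" unfolding p_def using barrier_inv by (intro pot_nonneg) (auto simp: barrier_inv_def)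
  have p0': "0 \<le> p'" unfolding p'_def using slack' by (intro pot_nonneg) auto
  define T' where "T' = cap n x'"
  have "1 / real n ^ 3 \<le> 1" using n by (simp add: field_simps one_le_power)
  then have "\<epsilon> \<le> 1" using \<epsilon>_le by linarith
  then have T': "0 \<le> T'" "T' \<le> T" unfolding T'_def cap_def tau' using \<epsilon>_pos tau n by linarith+
  have old: "psi n a \<mu> x + growth n (tau n x) \<le> bound n" using barrier_inv tau small by (rule inv_settled)
  have "psi n a \<mu> x' + growth n (tau n x') \<le> psi n a \<mu> x + growth n (tau n x)"
  proof (cases "tau n x \<le> 3/4 * n")
    case True
    then have TT': "T = tau n x" "T' = T - \<epsilon>" using tau' \<epsilon>_pos by (auto simp: T'_def cap_def)
    define k' where "k' = k - 1"
    have k': "0 < k'" using alive_large by (simp add: k'_def)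
    \<comment> \<open>75008/10000 exceeds 15 * (10001/10000) / 2. The cost of the step is therefore
      at most 2 T' \<epsilon> p, and T^2 - (T')^2 is at least 2 T' \<epsilon>.\<close>
    have lw: "75008/10000 * (T * k * w\<^sup>2) \<le> k'" using level_late[OF w True] by (simp add: k'_def)
    have "k' * (T'\<^sup>2 * (15 * (10001/10000) * Q)) = (15 * (10001/10000) * T'\<^sup>2) * (k' * Q)" by simp
    also have "\<dots> \<le> (15 * (10001/10000) * T'\<^sup>2) * (\<epsilon> * (k * w\<^sup>2 * p))"
      using Q2 by (intro mult_left_mono) (auto simp: k'_def p_def)
    also have "\<dots> = 2 * T' * \<epsilon> * p * (150015/20000 * (T' * k * w\<^sup>2))"
      by (simp add: power2_eq_square)
    also have "\<dots> \<le> 2 * T' * \<epsilon> * p * k'"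
    proof (rule mult_left_mono)
      have "0 \<le> k" using k' by (simp add: k'_def)
      then have "T' * k * w\<^sup>2 \<le> T * k * w\<^sup>2" using T' by (intro mult_right_mono) auto
      moreover have "0 \<le> T' * k * w\<^sup>2" using T' \<open>0 \<le> k\<close> by simp
      ultimately show "150015/20000 * (T' * k * w\<^sup>2) \<le> k'" using lw by linarith
    qed (use T' \<epsilon>_pos p0 in auto)
    finally have "T'\<^sup>2 * (15 * (10001/10000) * Q) \<le> 2 * T' * \<epsilon> * p"
      using k' by (simp add: mult.commute[of _ k'])
    moreover have "2 * T' * \<epsilon> * p \<le> (T\<^sup>2 - T'\<^sup>2) * p"
      using p0 \<epsilon>_pos by (intro mult_right_mono) (auto simp: TT'(2) power2_eq_square algebra_simps)
    moreover have "T'\<^sup>2 * p' \<le> T'\<^sup>2 * (p + 15 * (10001/10000) * Q)"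
      using pp by (intro mult_left_mono) auto
    ultimately have "T'\<^sup>2 * p' \<le> T\<^sup>2 * p" by (simp add: algebra_simps)
    moreover have "growth n (tau n x') \<le> growth n (tau n x)"
      unfolding growth_def using tau' \<epsilon>_pos by (intro mult_left_mono) auto
    ultimately show ?thesis by (simp add: psi_def p_def p'_def T'_def)
  next
    case False
    then have early: "3/4 * n \<le> tau n x" by simp
    \<comment> \<open>By the equation for \<open>w ^ 6\<close> the growth 423/5 * 15 T^2 k w^7
      \<epsilon> collapses to about 3 w \<epsilon>; 3 * 0.4218 with all error factors stays below
      1.27.\<close>
    have w1: "w \<le> 4218/10000 / sqrt n" using level_early[OF w early] n by (simp add: field_simps)
    have "T'\<^sup>2 * p' \<le> T\<^sup>2 * p'" using T' p0' by (intro mult_right_mono power_mono) auto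
    also have "\<dots> \<le> T\<^sup>2 * (p + 15 * (10001/10000) * Q)" using pp by (intro mult_left_mono) auto
    also have "\<dots> \<le> T\<^sup>2 * (p + 15 * (10001/10000) * (\<epsilon> * (k * w ^ 7)))"
      using Q1 by (intro mult_left_mono add_left_mono) auto
    finally have A: "423/5 * (1001/1000) * (T'\<^sup>2 * p') \<le>
        423/5 * (1001/1000) * (T\<^sup>2 * (p + 15 * (10001/10000) * (\<epsilon> * (k * w ^ 7))))"
      by (rule mult_left_mono) simp
    have "423 * T\<^sup>2 * (k * w ^ 7) \<le> (1 + 2/10000) * w"
    proof -
      have "423 * T\<^sup>2 * (k * w ^ 7) = (423 * (T * T) * w ^ 6 * w) * k"
        by (simp add: power2_eq_square eval_nat_numeral)
      also have "\<dots> \<le> (423 * (T * T) * w ^ 6 * w) * ((k - 1) * (1 + 2/10000))"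
        using alive_large(3) w by (intro mult_left_mono) auto
      also have "\<dots> = (w ^ 6 * (423 * (T * T) * (k - 1))) * ((1 + 2/10000) * w)"
        by (simp only: mult_ac)
      finally show ?thesis by (simp only: w(2) mult_1)
    qed
    moreover have "(1 + 2/10000) * w \<le> (1 + 2/10000) * (4218/10000 / sqrt n)"
      using w1 by (rule mult_left_mono) simp
    ultimately have B: "423 * T\<^sup>2 * (k * w ^ 7) \<le> (1 + 2/10000) * (4218/10000 / sqrt n)"
      by (rule order_trans)
    have "3 * (1001/1000) * (10001/10000) * \<epsilon> * (423 * T\<^sup>2 * (k * w ^ 7)) \<le>
        3 * (1001/1000) * (10001/10000) * \<epsilon> * ((1 + 2/10000) * (4218/10000 / sqrt n))"
      using B by (rule mult_left_mono) (use \<epsilon>_pos in simp)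
    moreover have "3 * (1001/1000) * (10001/10000) * \<epsilon> * ((1 + 2/10000) * (4218/10000 / sqrt n)) \<le>
        127/100 / sqrt n * \<epsilon>"
    proof -
      have "(3 * (1001/1000) * (10001/10000) * (1 + 2/10000) * (4218/10000)) * (\<epsilon> / sqrt n) \<le> 127/100 * (\<epsilon> / sqrt n)"
        using \<epsilon>_pos by (intro mult_right_mono) auto
      then show ?thesis by simp
    qed
    \<comment> \<open>Even if this step crosses the threshold, the summand 1 / n^3 keeps the linear
      term of the maximum nonnegative, so the budget drops linearly.\<close>
    moreover have "growth n (tau n x) - growth n (tau n x') = 127/100 / sqrt n * \<epsilon>"
    proof -
      have "growth n (tau n x) = 127/100 / sqrt n * (tau n x - 3/4 * n + 1 / real n^3)"
        "growth n (tau n x') = 127/100 / sqrt n * (tau n x' - 3/4 * n + 1 / real n^3)"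
        using early tau' \<epsilon>_le \<epsilon>_pos by (auto simp: growth_def max_absorb1)
      then show ?thesis unfolding tau' by (simp only:) argo
    qed
    ultimately show ?thesis using A unfolding psi_def p_def[symmetric] p'_def[symmetric] T'_def[symmetric]
      by (simp add: algebra_simps)
  qed
  then show "barrier_inv n a x' \<mu>" using old x1 slack' by (auto simp: barrier_inv_def)
qed

end

subsection \<open>Time-bounded total correctness\<close>

text \<open>The time is only an upper bound, so branches and iterations of different length can
  share one.\<close>

definition wp :: "prog \<Rightarrow> nat \<Rightarrow> state \<Rightarrow> (state \<Rightarrow> bool) \<Rightarrow> bool" where
  "wp P T s Q \<longleftrightarrow> (\<exists>t s'. t \<le> T \<and> exec P s t s' \<and> Q s')"

lemma wp_mono: "wp P T s Q \<Longrightarrow> T \<le> T' \<Longrightarrow> (\<And>s'. Q s' \<Longrightarrow> Q' s') \<Longrightarrow> wp P T' s Q'"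
  unfolding wp_def by (meson le_trans)

lemma wp_post: "wp P T s Q \<Longrightarrow> (\<And>s'. Q s' \<Longrightarrow> Q' s') \<Longrightarrow> wp P T s Q'"
  by (rule wp_mono[OF _ order_refl])

lemma wp_skip: "Q s \<Longrightarrow> wp Skip 1 s Q"
  unfolding wp_def by (meson exec.Skip order_refl)

lemma wp_iassign: "Q (set_ivar v (ival a s) s) \<Longrightarrow> wp (IAssign v a) 1 s Q"
  unfolding wp_def by (meson exec.IAssign order_refl)

lemma wp_rassign: "Q (set_cell m (ival a s) (ival b s) (rval e s) s) \<Longrightarrow> wp (RAssign m a b e) 1 s Q"
  unfolding wp_def by (meson exec.RAssign order_refl)

lemma wp_seq: "wp P T s R \<Longrightarrow> (\<And>s'. R s' \<Longrightarrow> wp P' U s' Q) \<Longrightarrow> wp (Seq P P') (T + U) s Q"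
  unfolding wp_def by (meson add_mono exec.Seq)

lemma wp_cond:
  "(holds b s \<Longrightarrow> wp P T s Q) \<Longrightarrow> (\<not> holds b s \<Longrightarrow> wp P' T s Q) \<Longrightarrow> wp (Cond b P P') (Suc T) s Q"
  unfolding wp_def by (cases "holds b s") (meson exec.CondTrue exec.CondFalse Suc_le_mono)+

text \<open>Each round costs the test and the body and lowers the variant by at least 1; the final
  failing test is the extra unit.\<close>

lemma wp_loop:
  assumes step: "\<And>s. I s \<Longrightarrow> holds b s \<Longrightarrow> wp P T s (\<lambda>s'. I s' \<and> f s' < f s)"
    and "I s"
  shows "wp (Loop b P) ((T + 1) * f s + 1) s (\<lambda>s'. I s' \<and> \<not> holds b s')"
  using assms(2)
proof (induction "f s" arbitrary: s rule: less_induct)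
  case less
  show ?case
  proof (cases "holds b s")
    case False
    then show ?thesis using less.prems exec.LoopFalse[OF False] unfolding wp_def
      by (meson le_add2)
  next
    case True
    from step[OF less.prems True] obtain t s' where t: "t \<le> T" "exec P s t s'" "I s'" "f s' < f s"
      by (auto simp: wp_def)
    from less.hyps[OF t(4,3)] obtain u s'' where u: "u \<le> (T + 1) * f s' + 1"
      "exec (Loop b P) s' u s''" "I s''" "\<not> holds b s''" by (auto simp: wp_def)
    have "Suc (t + u) \<le> (T + 1) * Suc (f s') + 1" using t u by simp
    also have "\<dots> \<le> (T + 1) * f s + 1" using t(4) by (intro add_mono mult_le_mono) auto
    finally have "Suc (t + u) \<le> (T + 1) * f s + 1" .
    moreover have "exec (Loop b P) s (Suc (t + u)) s''" using True t u by (intro exec.LoopTrue)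
    ultimately show ?thesis using u unfolding wp_def by blast
  qed
qed

abbreviation For :: "nat \<Rightarrow> iexp \<Rightarrow> prog \<Rightarrow> prog" where
  "For v e P \<equiv> Seq (IAssign v (IConst 0))
     (Loop (ILess (IVar v) e) (Seq P (IAssign v (IAdd (IVar v) (IConst 1)))))"

lemma ivar_set_ivar [simp]: "ivar (set_ivar v k s) = (ivar s)(v := k)"
  and cell_set_ivar [simp]: "cell (set_ivar v k s) = cell s"
  and ivar_set_cell [simp]: "ivar (set_cell m i j r s) = ivar s"
  by (simp_all add: set_ivar_def set_cell_def)

lemma cell_set_cell_same [simp]:
  "cell (set_cell m i j r s) m i' j' = (if i' = i \<and> j' = j then r else cell s m i' j')"
  by (simp add: set_cell_def)

lemma cell_set_cell_other [simp]: "m' \<noteq> m \<Longrightarrow> cell (set_cell m i j r s) m' = cell s m'"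
  by (simp add: set_cell_def)

text \<open>The limit \<open>e\<close> is evaluated again before every round, hence the premise that
  the invariant fixes its value. Per round, 2 units go to the test and the increment.\<close>

lemma wp_for:
  assumes init: "I 0 (set_ivar v 0 s)"
    and bound: "\<And>i s. I i s \<Longrightarrow> ivar s v = i \<Longrightarrow> ival e s = N"
    and body: "\<And>i s. i < N \<Longrightarrow> I i s \<Longrightarrow> ivar s v = i \<Longrightarrow>
      wp P T s (\<lambda>s'. ivar s' v = i \<and> I (Suc i) (set_ivar v (Suc i) s'))"
  shows "wp (For v e P) (N * (T + 2) + 2) s (\<lambda>s'. I N s' \<and> ivar s' v = N)"
proof -
  define J where "J s \<longleftrightarrow> I (ivar s v) s \<and> ivar s v \<le> N" for s
  have "wp (IAssign v (IConst 0)) 1 s (\<lambda>s'. J s' \<and> ivar s' v = 0)"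
    by (rule wp_iassign) (use init in \<open>simp add: J_def\<close>)
  moreover have "wp (Loop (ILess (IVar v) e) (Seq P (IAssign v (IAdd (IVar v) (IConst 1)))))
      ((T + 1 + 1) * N + 1) s' (\<lambda>s'. I N s' \<and> ivar s' v = N)" if "J s' \<and> ivar s' v = 0" for s'
  proof -
    have "wp (Loop (ILess (IVar v) e) (Seq P (IAssign v (IAdd (IVar v) (IConst 1)))))
        ((T + 1 + 1) * (N - ivar s' v) + 1) s' (\<lambda>s'. J s' \<and> \<not> holds (ILess (IVar v) e) s')"
    proof (rule wp_loop[where f = "\<lambda>s. N - ivar s v"])
      fix s assume J: "J s" and h: "holds (ILess (IVar v) e) s"
      then have lt: "ivar s v < N" using bound[of "ivar s v" s] by (simp add: J_def)
      have "wp P T s (\<lambda>s'. ivar s' v = ivar s v \<and> I (Suc (ivar s v)) (set_ivar v (Suc (ivar s v)) s'))"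
        using J lt by (intro body) (auto simp: J_def)
      then show "wp (Seq P (IAssign v (IAdd (IVar v) (IConst 1)))) (T + 1) s
          (\<lambda>s'. J s' \<and> N - ivar s' v < N - ivar s v)"
        by (rule wp_seq) (rule wp_iassign, use lt in \<open>auto simp: J_def\<close>)
    qed (use that in simp)
    then show ?thesis
      by (rule wp_mono) (use that bound in \<open>force simp: J_def\<close>)+
  qed
  ultimately have "wp (For v e P) (1 + ((T + 1 + 1) * N + 1)) s (\<lambda>s'. I N s' \<and> ivar s' v = N)"
    by (rule wp_seq)
  then show ?thesis by (rule wp_mono) (auto simp: algebra_simps)
qed

definition frame :: "nat set \<Rightarrow> nat set \<Rightarrow> state \<Rightarrow> state \<Rightarrow> bool" where
  "frame Vs Ms s s' \<longleftrightarrow> (\<forall>v. v \<notin> Vs \<longrightarrow> ivar s' v = ivar s v) \<and> (\<forall>m. m \<notin> Ms \<longrightarrow> cell s' m = cell s m)"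

lemma frame_refl [simp]: "frame Vs Ms s s"
  by (simp add: frame_def)

lemma frame_ivar: "frame Vs Ms s s' \<Longrightarrow> v \<notin> Vs \<Longrightarrow> ivar s' v = ivar s v"
  by (simp add: frame_def)

lemma frame_cell: "frame Vs Ms s s' \<Longrightarrow> m \<notin> Ms \<Longrightarrow> cell s' m = cell s m"
  by (simp add: frame_def)

lemma frame_trans: "frame Vs Ms s s' \<Longrightarrow> frame Vs' Ms' s' s'' \<Longrightarrow> Vs \<union> Vs' \<subseteq> Us \<Longrightarrow> Ms \<union> Ms' \<subseteq> Ns \<Longrightarrow>
    frame Us Ns s s''"
  unfolding frame_def by (metis UnI1 UnI2 subsetD)

lemma frame_mono: "frame Vs Ms s s' \<Longrightarrow> Vs \<subseteq> Us \<Longrightarrow> Ms \<subseteq> Ns \<Longrightarrow> frame Us Ns s s'"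
  by (auto simp: frame_def)

lemma frame_set_ivar: "frame Vs Ms s s' \<Longrightarrow> v \<in> Vs \<Longrightarrow> frame Vs Ms s (set_ivar v k s')"
  by (auto simp: frame_def)

lemma frame_set_cell: "frame Vs Ms s s' \<Longrightarrow> m \<in> Ms \<Longrightarrow> frame Vs Ms s (set_cell m i j r s')"
  unfolding frame_def by (metis ivar_set_cell cell_set_cell_other)

abbreviation scal :: "nat \<Rightarrow> rexp" where
  "scal m \<equiv> Cell m (IConst 0) (IConst 0)"

abbreviation let_scal :: "nat \<Rightarrow> rexp \<Rightarrow> prog" where
  "let_scal m e \<equiv> RAssign m (IConst 0) (IConst 0) e"

text \<open>In \<open>Sum\<close> and \<open>Fill\<close> the program \<open>P\<close> prepares the evaluation of the expression \<open>r\<close>.\<close>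

abbreviation Sum :: "nat \<Rightarrow> iexp \<Rightarrow> nat \<Rightarrow> prog \<Rightarrow> rexp \<Rightarrow> prog" where
  "Sum v e acc P r \<equiv> Seq (let_scal acc (RConst 0)) (For v e (Seq P (let_scal acc (RAdd (scal acc) r))))"

lemma wp_sum:
  assumes new: "v \<notin> Vs" "acc \<notin> Ms"
    and bound: "\<And>s'. frame (insert v Vs) (insert acc Ms) s s' \<Longrightarrow> ival e s' = N"
    and body: "\<And>i s'. i < N \<Longrightarrow> frame (insert v Vs) (insert acc Ms) s s' \<Longrightarrow> ivar s' v = i \<Longrightarrow>
      wp P T s' (\<lambda>s''. frame Vs Ms s' s'' \<and> rval r s'' = f i)"
  shows "wp (Sum v e acc P r) (N * (T + 3) + 3) s
    (\<lambda>s'. frame (insert v Vs) (insert acc Ms) s s' \<and> cell s' acc 0 0 = (\<Sum>i<N. f i))"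
proof -
  let ?F = "frame (insert v Vs) (insert acc Ms) s"
  let ?I = "\<lambda>i s'. ?F s' \<and> cell s' acc 0 0 = (\<Sum>i<i. f i)"
  have "wp (let_scal acc (RConst 0)) 1 s (\<lambda>s'. ?F s' \<and> cell s' acc 0 0 = 0)"
    by (rule wp_rassign) (auto intro!: frame_set_cell)
  moreover have "wp (For v e (Seq P (let_scal acc (RAdd (scal acc) r)))) (N * (T + 1 + 2) + 2) s1
      (\<lambda>s'. ?I N s' \<and> ivar s' v = N)" if s1: "?F s1 \<and> cell s1 acc 0 0 = 0" for s1
  proof (rule wp_for)
    show "?I 0 (set_ivar v 0 s1)" using s1 by (auto intro: frame_set_ivar)
    show "ival e s' = N" if "?I i s'" for i s' using that bound by simp
    fix i s2 assume i: "i < N" and I: "?I i s2" and v: "ivar s2 v = i"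
    have "wp P T s2 (\<lambda>s''. frame Vs Ms s2 s'' \<and> rval r s'' = f i)"
      using body[OF i _ v] I by simp
    then show "wp (Seq P (let_scal acc (RAdd (scal acc) r))) (T + 1) s2
        (\<lambda>s'. ivar s' v = i \<and> ?I (Suc i) (set_ivar v (Suc i) s'))"
    proof (rule wp_seq)
      fix s3 assume s3: "frame Vs Ms s2 s3 \<and> rval r s3 = f i"
      then have "?F s3" using I by (auto elim!: frame_trans)
      moreover have "cell s3 acc 0 0 = (\<Sum>i<i. f i)" "ivar s3 v = i"
        using s3 I v new frame_cell[of Vs Ms s2 s3 acc] frame_ivar[of Vs Ms s2 s3 v] by auto
      ultimately show "wp (let_scal acc (RAdd (scal acc) r)) 1 s3
          (\<lambda>s'. ivar s' v = i \<and> ?I (Suc i) (set_ivar v (Suc i) s'))"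
        using s3 by (intro wp_rassign) (auto intro!: frame_set_ivar frame_set_cell)
    qed
  qed
  ultimately have "wp (Sum v e acc P r) (1 + (N * (T + 1 + 2) + 2)) s (\<lambda>s'. ?I N s' \<and> ivar s' v = N)"
    by (rule wp_seq)
  then show ?thesis by (rule wp_mono) (auto simp: algebra_simps)
qed

abbreviation Fill :: "nat \<Rightarrow> iexp \<Rightarrow> nat \<Rightarrow> iexp \<Rightarrow> prog \<Rightarrow> rexp \<Rightarrow> prog" where
  "Fill v e m a P r \<equiv> For v e (Seq P (RAssign m a (IVar v) r))"

text \<open>The body may assume that the entries from \<open>i\<close> on are still the old ones.
  This permits updates in place, where the new entry is computed from the one it overwrites, as in
  Gram--Schmidt.\<close>

lemma wp_fill:
  assumes new: "v \<notin> Vs" "m \<notin> Ms"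
    and bound: "\<And>s'. frame (insert v Vs) (insert m Ms) s s' \<Longrightarrow> ival e s' = N"
    and body: "\<And>i s'. i < N \<Longrightarrow> frame (insert v Vs) (insert m Ms) s s' \<Longrightarrow> ivar s' v = i \<Longrightarrow>
      (\<And>k j. k \<noteq> kr \<or> i \<le> j \<Longrightarrow> cell s' m k j = cell s m k j) \<Longrightarrow>
      wp P T s' (\<lambda>s''. frame Vs Ms s' s'' \<and> rval r s'' = f i \<and> ival a s'' = kr)"
  shows "wp (Fill v e m a P r) (N * (T + 3) + 2) s
    (\<lambda>s'. frame (insert v Vs) (insert m Ms) s s' \<and>
       (\<forall>k j. cell s' m k j = (if k = kr \<and> j < N then f j else cell s m k j)))"
proof -
  let ?F = "frame (insert v Vs) (insert m Ms) s"
  let ?I = "\<lambda>i s'. ?F s' \<and> (\<forall>k j. cell s' m k j = (if k = kr \<and> j < i then f j else cell s m k j))"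
  have "wp (Fill v e m a P r) (N * (T + 1 + 2) + 2) s (\<lambda>s'. ?I N s' \<and> ivar s' v = N)"
  proof (rule wp_for)
    show "?I 0 (set_ivar v 0 s)" by (auto intro: frame_set_ivar)
    show "ival e s' = N" if "?I i s'" for i s' using that bound by simp
    fix i s2 assume i: "i < N" and I: "?I i s2" and v: "ivar s2 v = i"
    have "wp P T s2 (\<lambda>s''. frame Vs Ms s2 s'' \<and> rval r s'' = f i \<and> ival a s'' = kr)"
      using I by (intro body[OF i _ v]) auto
    then show "wp (Seq P (RAssign m a (IVar v) r)) (T + 1) s2
        (\<lambda>s'. ivar s' v = i \<and> ?I (Suc i) (set_ivar v (Suc i) s'))"
    proof (rule wp_seq)
      fix s3 assume s3: "frame Vs Ms s2 s3 \<and> rval r s3 = f i \<and> ival a s3 = kr"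
      then have F: "?F s3" using I by (auto elim!: frame_trans)
      have c: "cell s3 m = cell s2 m" and v3: "ivar s3 v = i"
        using s3 I v new frame_cell[of Vs Ms s2 s3 m] frame_ivar[of Vs Ms s2 s3 v] by auto
      show "wp (RAssign m a (IVar v) r) 1 s3
          (\<lambda>s'. ivar s' v = i \<and> ?I (Suc i) (set_ivar v (Suc i) s'))"
        using s3 F I v3
        by (intro wp_rassign) (auto intro!: frame_set_ivar frame_set_cell simp: c less_Suc_eq)
    qed
  qed
  then show ?thesis by (rule wp_mono) (auto simp: algebra_simps)
qed

text \<open>A literal product; for the exponents 5, 6 and 7 in use its size is a constant of the
  program.\<close>

primrec rpow :: "rexp \<Rightarrow> nat \<Rightarrow> rexp" where
  "rpow e 0 = RConst 1"
| "rpow e (Suc k) = RMul e (rpow e k)"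

lemma rval_rpow [simp]: "rval (rpow e k) s = rval e s ^ k"
  by (induction k) auto

subsection \<open>The program\<close>

text \<open>
  Arrays: 0 the matrix, 1 the output, 2 the generators and their residuals, 3 the position \<open>x\<close>, 4 the rows of
  \<open>A x\<close>, 5 \<open>alive\<close>, 6 \<open>blocked\<close>, 7 the squared norms of the residuals, 8 the direction, 9 the rows of \<open>A d\<close>,
  26 \<open>weight\<close>. Scalars are kept at position (0, 0): 10 \<open>n\<close>, 11 \<open>tau\<close>, 12 \<open>cap\<close>, 13 \<open>nalive\<close>, 14 the barrier \<open>\<mu>\<close>,
  16, 19, 20 potentials, 17 the best quotient so far, 18 the maximum norm, 21 the number of iterations,
  22 \<open>thr\<close>, and 15, 23, 24, 25 temporaries. Variable 5 holds the index of the best residual and is 0 if there is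
  none yet; vectors are stored in row 0 of their arrays.
\<close>

definition env :: "nat \<Rightarrow> (nat \<Rightarrow> nat \<Rightarrow> real) \<Rightarrow> state \<Rightarrow> bool" where
  "env n a s \<longleftrightarrow> ivar s 0 = n \<and> (\<forall>i<n. \<forall>j<n. cell s 0 i j = a i j) \<and> cell s 10 0 0 = real n"

lemma env_frame: "frame Vs Ms s s' \<Longrightarrow> env n a s \<Longrightarrow> 0 \<notin> Vs \<Longrightarrow> 0 \<notin> Ms \<Longrightarrow> 10 \<notin> Ms \<Longrightarrow> env n a s'"
  by (simp add: frame_def env_def)

definition vec_at :: "state \<Rightarrow> nat \<Rightarrow> nat \<Rightarrow> (nat \<Rightarrow> real) \<Rightarrow> bool" where
  "vec_at s m n f \<longleftrightarrow> (\<forall>j<n. cell s m 0 j = f j)"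

lemma vec_at_frame: "frame Vs Ms s s' \<Longrightarrow> vec_at s m n f \<Longrightarrow> m \<notin> Ms \<Longrightarrow> vec_at s' m n f"
  by (simp add: frame_def vec_at_def)

abbreviation entry :: "nat \<Rightarrow> nat \<Rightarrow> rexp" where
  "entry m v \<equiv> Cell m (IConst 0) (IVar v)"

abbreviation (input) "FillVec v m P r \<equiv> Fill v (IVar 0) m (IConst 0) P r"

lemma wp_fill_vec:
  assumes "v \<notin> Vs" "m \<notin> Ms" "v \<noteq> 0" "0 \<notin> Vs" "ivar s 0 = n"
    and body: "\<And>i s'. i < n \<Longrightarrow> frame (insert v Vs) (insert m Ms) s s' \<Longrightarrow> ivar s' v = i \<Longrightarrow>
      cell s' m 0 i = cell s m 0 i \<Longrightarrow> wp P T s' (\<lambda>s''. frame Vs Ms s' s'' \<and> rval r s'' = f i)"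
  shows "wp (FillVec v m P r) (n * (T + 3) + 2) s
    (\<lambda>s'. frame (insert v Vs) (insert m Ms) s s' \<and> vec_at s' m n f)"
  by (rule wp_post[OF wp_fill[where Vs = Vs and Ms = Ms and N = n and T = T and kr = 0 and f = f]])
    (use assms in \<open>auto simp: vec_at_def frame_ivar\<close>)

definition tau_prog :: prog where
  "tau_prog = Seq (Sum 2 (IVar 0) 15 Skip (RMul (entry 3 2) (entry 3 2))) (let_scal 11 (RSub (scal 10) (scal 15)))"

lemma wp_tau:
  assumes env: "env n a s" and x: "vec_at s 3 n x"
  shows "wp tau_prog (n * 4 + 4) s (\<lambda>s'. frame {2} {11, 15} s s' \<and> cell s' 11 0 0 = tau n x)"
proof -
  have "wp (Sum 2 (IVar 0) 15 Skip (RMul (entry 3 2) (entry 3 2))) (n * (1 + 3) + 3) s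
    (\<lambda>s'. frame {2} {15} s s' \<and> cell s' 15 0 0 = (\<Sum>j<n. x j * x j))"
    by (rule wp_sum) (use env x in \<open>auto simp: frame_def env_def vec_at_def intro!: wp_skip[unfolded One_nat_def]\<close>)
  then have "wp tau_prog ((n * (1 + 3) + 3) + 1) s (\<lambda>s'. frame {2} {11, 15} s s' \<and> cell s' 11 0 0 = tau n x)"
    unfolding tau_prog_def
    by (rule wp_seq) (rule wp_rassign, use env in \<open>auto simp: frame_def env_def tau_def ip_def set_cell_def\<close>)
  then show ?thesis by (rule wp_mono) auto
qed

definition cap_prog :: prog where
  "cap_prog = Cond (RLess (scal 11) (RMul (RConst (3/4)) (scal 10)))
     (let_scal 12 (scal 11)) (let_scal 12 (RMul (RConst (3/4)) (scal 10)))"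

lemma wp_cap:
  assumes env: "env n a s" and "cell s 11 0 0 = tau n x"
  shows "wp cap_prog 2 s (\<lambda>s'. frame {} {12} s s' \<and> cell s' 12 0 0 = cap n x)"
proof -
  have "wp cap_prog (Suc 1) s (\<lambda>s'. frame {} {12} s s' \<and> cell s' 12 0 0 = cap n x)"
    unfolding cap_prog_def
    by (rule wp_cond; rule wp_rassign)
      (use assms in \<open>auto simp: frame_def env_def cap_def set_cell_def of_rat_divide\<close>)
  then show ?thesis by (simp add: numeral_2_eq_2)
qed

definition rows_prog :: "nat \<Rightarrow> nat \<Rightarrow> prog" where
  "rows_prog dst src = FillVec 1 dst
     (Sum 2 (IVar 0) 15 Skip (RMul (Cell 0 (IVar 1) (IVar 2)) (entry src 2))) (scal 15)"

lemma wp_rows: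
  assumes env: "env n a s" and x: "vec_at s src n x"
    and "dst \<noteq> 0" "dst \<noteq> 15" "dst \<noteq> src" "src \<noteq> 15"
  shows "wp (rows_prog dst src) (n * (n * 4 + 6) + 2) s
    (\<lambda>s'. frame {1, 2} {15, dst} s s' \<and> vec_at s' dst n (row n a x))"
proof -
  have "wp (rows_prog dst src) (n * ((n * (1 + 3) + 3) + 3) + 2) s
    (\<lambda>s'. frame {1, 2} {dst, 15} s s' \<and> vec_at s' dst n (row n a x))"
    unfolding rows_prog_def
  proof (rule wp_fill_vec)
    fix i s' assume i: "i < n" and F: "frame {1, 2} {dst, 15} s s'" and v: "ivar s' 1 = i"
    have "wp (Sum 2 (IVar 0) 15 Skip (RMul (Cell 0 (IVar 1) (IVar 2)) (entry src 2))) (n * (1 + 3) + 3) s'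
      (\<lambda>s''. frame {2} {15} s' s'' \<and> cell s'' 15 0 0 = (\<Sum>j<n. a i j * x j))"
      by (rule wp_sum; (rule wp_skip)?) (use env x i F v assms(3-) in \<open>auto simp: frame_def env_def vec_at_def\<close>)
    then show "wp (Sum 2 (IVar 0) 15 Skip (RMul (Cell 0 (IVar 1) (IVar 2)) (entry src 2))) (n * (1 + 3) + 3) s'
      (\<lambda>s''. frame {2} {15} s' s'' \<and> rval (scal 15) s'' = row n a x i)"
      by (rule wp_post) (auto simp: row_def ip_def)
  qed (use assms in \<open>auto simp: env_def\<close>)
  then show ?thesis by (rule wp_mono) (auto simp: insert_commute algebra_simps)
qed

definition pot_prog :: "nat \<Rightarrow> rexp \<Rightarrow> nat \<Rightarrow> prog" where
  "pot_prog acc y p = Sum 1 (IVar 0) acc Skip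
     (RAdd (RDiv (RConst 1) (rpow (RSub (scal 14) y) p)) (RDiv (RConst 1) (rpow (RAdd (scal 14) y) p)))"

lemma wp_pot:
  assumes env: "env n a s" and "cell s 14 0 0 = \<mu>" "acc \<noteq> 14"
    and y: "\<And>i s'. i < n \<Longrightarrow> frame {1} {acc} s s' \<Longrightarrow> ivar s' 1 = i \<Longrightarrow> rval y s' = row n a x i"
  shows "wp (pot_prog acc y p) (n * 4 + 3) s
    (\<lambda>s'. frame {1} {acc} s s' \<and> cell s' acc 0 0 = pot n a p \<mu> x)"
proof -
  have "wp (pot_prog acc y p) (n * (1 + 3) + 3) s
    (\<lambda>s'. frame {1} {acc} s s' \<and> cell s' acc 0 0 =
       (\<Sum>i<n. 1 / (\<mu> - row n a x i) ^ p + 1 / (\<mu> + row n a x i) ^ p))"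
    unfolding pot_prog_def
    by (rule wp_sum; (rule wp_skip)?) (use assms in \<open>auto simp: frame_cell env_def frame_ivar\<close>)
  then show ?thesis by (rule wp_mono) (auto simp: pot_def)
qed

definition barrier_prog :: prog where
  "barrier_prog = Seq (pot_prog 16 (entry 4 1) 6)
     (Loop (RLess (RConst 1) (RMul (RMul (RConst 423) (RMul (scal 12) (scal 12))) (scal 16)))
       (Seq (let_scal 14 (RAdd (scal 14) (RDiv (RConst 1) (scal 10)))) (pot_prog 16 (entry 4 1) 6)))"

lemma row_le:
  assumes "bounded_rows n a" "\<forall>j<n. \<bar>x j\<bar> \<le> 1" "i < n"
  shows "\<bar>row n a x i\<bar> \<le> n"
proof -
  have "\<bar>row n a x i\<bar> \<le> (\<Sum>j<n. \<bar>a i j * x j\<bar>)" unfolding row_def ip_def by (rule sum_abs)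
  also have "\<dots> \<le> (\<Sum>j<n. 1 * 1)"
    unfolding abs_mult using assms by (intro sum_mono mult_mono) (auto simp: bounded_rows_def)
  finally show ?thesis by simp
qed

text \<open>Above 11n all slacks are at least 10n, as rows are at most n in absolute value, and the
  sixth-power sum is far too small for \<open>big\<close>. The estimate is crude, but any polynomial
  bound makes the barrier loop terminate in time.\<close>

lemma barrier_bound:
  assumes a: "bounded_rows n a" and barrier_inv: "barrier_inv n a x \<mu>" and tau: "10000 \<le> tau n x"
    and big: "1 < 423 * (cap n x * cap n x) * pot n a 6 \<mu> x"
  shows "\<mu> < 11 * real n"
proof (rule ccontr)
  assume m: "\<not> \<mu> < 11 * real n"
  note capb = cap_bounds[OF tau]
  have x: "\<forall>j<n. \<bar>x j\<bar> \<le> 1" using barrier_inv by (simp add: barrier_inv_def)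
  have n: "1 \<le> real n" using capb by simp
  have "pot n a 6 \<mu> x \<le> (\<Sum>i<n. 1 / (10 * real n)^6 + 1 / (10 * real n)^6)"
    unfolding pot_def
  proof (rule sum_mono)
    fix i assume "i \<in> {..<n}"
    then have "\<bar>row n a x i\<bar> \<le> n" using row_le[OF a x] by simp
    then have "10 * real n \<le> \<mu> - row n a x i" "10 * real n \<le> \<mu> + row n a x i" using m by auto
    then show "1 / (\<mu> - row n a x i) ^ 6 + 1 / (\<mu> + row n a x i) ^ 6 \<le> 1 / (10 * real n)^6 + 1 / (10 * real n)^6"
      using n by (intro add_mono divide_left_mono power_mono mult_pos_pos zero_less_power) auto
  qed
  also have "\<dots> = 2 * real n / (10 * real n)^6" by simp
  finally have p: "pot n a 6 \<mu> x \<le> 2 * real n / (10 * real n)^6" .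
  have "423 * (cap n x * cap n x) * pot n a 6 \<mu> x \<le> 423 * (real n * real n) * (2 * real n / (10 * real n)^6)"
  proof (intro mult_mono p)
    show "0 \<le> pot n a 6 \<mu> x" using barrier_inv by (intro pot_nonneg) (auto simp: barrier_inv_def)
  qed (use capb in auto)
  also have "\<dots> = 846 / 1000000 * (1 / real n ^ 3)"
    using n by (simp add: power_mult_distrib eval_nat_numeral)
  also have "\<dots> \<le> 846 / 1000000 * 1"
    using n by (intro mult_left_mono) (auto simp: field_simps one_le_power)
  finally show False using big by simp
qed

lemma wp_barrier:
  assumes env: "env n a s" and y: "vec_at s 4 n (row n a x)" and T: "cell s 12 0 0 = cap n x"
    and mu: "barrier_inv n a x (cell s 14 0 0)" and a: "bounded_rows n a" and tau: "10000 \<le> tau n x"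
  shows "wp barrier_prog ((n * 4 + 3) + ((n * 4 + 5) * (11 * n * n + n) + 1)) s
    (\<lambda>s'. frame {1} {14, 16} s s' \<and> barrier_inv n a x (cell s' 14 0 0) \<and>
       423 * (cap n x * cap n x) * pot n a 6 (cell s' 14 0 0) x \<le> 1)"
proof -
  let ?b = "RLess (RConst 1) (RMul (RMul (RConst 423) (RMul (scal 12) (scal 12))) (scal 16))"
  let ?I = "\<lambda>s'. frame {1} {14, 16} s s' \<and> barrier_inv n a x (cell s' 14 0 0) \<and>
     cell s' 16 0 0 = pot n a 6 (cell s' 14 0 0) x"
  \<comment> \<open>A raise by 1 / n lowers the scaled distance by exactly 1.\<close>
  let ?f = "\<lambda>s'. nat \<lceil>(11 * real n + 1 - cell s' 14 0 0) * real n\<rceil>"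
  have pot: "wp (pot_prog 16 (entry 4 1) 6) (n * 4 + 3) s1 ?I"
    if "frame {1} {14, 16} s s1" "barrier_inv n a x (cell s1 14 0 0)" for s1
  proof (rule wp_post[OF wp_pot])
    show "env n a s1" using that env by (auto intro: env_frame)
    show "rval (entry 4 1) s' = row n a x i" if "i < n" "frame {1} {16} s1 s'" "ivar s' 1 = i" for i s'
      using y \<open>frame {1} {14, 16} s s1\<close> that by (simp add: frame_def vec_at_def)
    fix s' assume "frame {1} {16} s1 s' \<and> cell s' 16 0 0 = pot n a 6 (cell s1 14 0 0) x"
    then show "?I s'" using that by (auto simp: frame_cell elim!: frame_trans)
  qed auto
  have n: "10000 \<le> real n" using cap_bounds[OF tau] by simp
  have "wp (pot_prog 16 (entry 4 1) 6) (n * 4 + 3) s ?I" using mu by (intro pot) auto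
  then have "wp barrier_prog ((n * 4 + 3) + (((1 + (n * 4 + 3)) + 1) * (11 * n * n + n) + 1)) s
     (\<lambda>s'. ?I s' \<and> \<not> holds ?b s')"
    unfolding barrier_prog_def
  proof (rule wp_seq)
    fix s1 assume s1: "?I s1"
    have m0: "0 \<le> cell s1 14 0 0"
    proof -
      have "1 \<le> cell s1 14 0 0 - \<bar>row n a x 0\<bar>" using s1 n by (simp add: barrier_inv_def)
      then show ?thesis by simp
    qed
    have "(11 * real n + 1 - cell s1 14 0 0) * real n \<le> (11 * real n + 1) * real n"
      using m0 by (intro mult_right_mono) auto
    also have "\<dots> = real (11 * n * n + n)" by (simp add: algebra_simps)
    finally have f: "?f s1 \<le> 11 * n * n + n" by (simp add: ceiling_le_iff nat_le_iff del: of_nat_add of_nat_mult)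
    have "wp (Loop ?b (Seq (let_scal 14 (RAdd (scal 14) (RDiv (RConst 1) (scal 10)))) (pot_prog 16 (entry 4 1) 6)))
      (((1 + (n * 4 + 3)) + 1) * ?f s1 + 1) s1 (\<lambda>s'. ?I s' \<and> \<not> holds ?b s')"
    proof (rule wp_loop[where f = ?f])
      fix s2 assume I: "?I s2" and h: "holds ?b s2"
      have c: "cell s2 12 0 0 = cap n x" "cell s2 10 0 0 = real n"
        using I T env by (auto simp: frame_cell env_def)
      have big: "1 < 423 * (cap n x * cap n x) * pot n a 6 (cell s2 14 0 0) x"
        using h I c by simp
      have less: "cell s2 14 0 0 < 11 * real n" using I big by (intro barrier_bound[OF a _ tau]) auto
      let ?m = "cell s2 14 0 0 + 1 / real n"
      have "wp (let_scal 14 (RAdd (scal 14) (RDiv (RConst 1) (scal 10)))) 1 s2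
        (\<lambda>s'. frame {1} {14, 16} s s' \<and> cell s' 14 0 0 = ?m)"
        by (rule wp_rassign) (use I c in \<open>auto intro!: frame_set_cell\<close>)
      then show "wp (Seq (let_scal 14 (RAdd (scal 14) (RDiv (RConst 1) (scal 10)))) (pot_prog 16 (entry 4 1) 6))
        (1 + (n * 4 + 3)) s2 (\<lambda>s'. ?I s' \<and> ?f s' < ?f s2)"
      proof (rule wp_seq)
        fix s3 assume s3: "frame {1} {14, 16} s s3 \<and> cell s3 14 0 0 = ?m"
        have inv3: "barrier_inv n a x (cell s3 14 0 0)" using s3 I big tau by (auto intro: inv_increase)
        have "wp (pot_prog 16 (entry 4 1) 6) (n * 4 + 3) s3 (\<lambda>s'. frame {1} {16} s3 s' \<and> cell s' 16 0 0 = pot n a 6 ?m x)"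
        proof (rule wp_pot)
          show "env n a s3" using s3 env by (auto intro: env_frame)
          show "rval (entry 4 1) s' = row n a x i" if "i < n" "frame {1} {16} s3 s'" "ivar s' 1 = i" for i s'
            using y s3 that by (simp add: frame_def vec_at_def)
        qed (use s3 in auto)
        then show "wp (pot_prog 16 (entry 4 1) 6) (n * 4 + 3) s3 (\<lambda>s'. ?I s' \<and> ?f s' < ?f s2)"
        proof (rule wp_post)
          fix s4 assume s4: "frame {1} {16} s3 s4 \<and> cell s4 16 0 0 = pot n a 6 ?m x"
          then have m4: "cell s4 14 0 0 = ?m" using s3 by (auto simp: frame_def)
          have "(11 * real n + 1 - ?m) * real n = (11 * real n + 1 - cell s2 14 0 0) * real n - 1"
            using n by (simp add: field_simps)
          moreover have "0 < (11 * real n + 1 - cell s2 14 0 0) * real n" using less n by simp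
          ultimately have "?f s4 < ?f s2" unfolding m4 by (simp add: ceiling_diff_one)
          moreover have "frame {1} {14, 16} s s4" using s3 s4 by (auto elim!: frame_trans)
          ultimately show "?I s4 \<and> ?f s4 < ?f s2" using s4 inv3 s3 by (simp add: m4)
        qed
      qed
    qed (use s1 in auto)
    then show "wp (Loop ?b (Seq (let_scal 14 (RAdd (scal 14) (RDiv (RConst 1) (scal 10)))) (pot_prog 16 (entry 4 1) 6)))
      (((1 + (n * 4 + 3)) + 1) * (11 * n * n + n) + 1) s1 (\<lambda>s'. ?I s' \<and> \<not> holds ?b s')"
      by (rule wp_mono) (use f in \<open>auto intro!: mult_le_mono\<close>)
  qed
  then show ?thesis
    by (rule wp_mono) (use T in \<open>auto simp: frame_cell not_less\<close>)
qed

abbreviation (input) "Indicator b \<equiv> Cond b (let_scal 25 (RConst 1)) (let_scal 25 (RConst 0))"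

lemma wp_indicator:
  "(holds b s \<longleftrightarrow> p) \<Longrightarrow> wp (Indicator b) 2 s (\<lambda>s'. frame {} {25} s s' \<and> rval (scal 25) s' = (if p then 1 else 0))"
  unfolding numeral_2_eq_2
  by (rule wp_cond; rule wp_rassign[unfolded One_nat_def]) (auto intro!: frame_set_cell)

definition alive_prog :: prog where
  "alive_prog = FillVec 2 5
     (Indicator (Conj (RLess (entry 3 2) (RSub (RConst 1) (RDiv (RConst 1) (RMul (scal 10) (scal 10)))))
       (RLess (RSub (RConst 0) (entry 3 2)) (RSub (RConst 1) (RDiv (RConst 1) (RMul (scal 10) (scal 10)))))))
     (scal 25)"

lemma wp_alive:
  assumes env: "env n a s" and x: "vec_at s 3 n x"
  shows "wp alive_prog (n * 5 + 2) s (\<lambda>s'. frame {2} {5, 25} s s' \<and> vec_at s' 5 n (alive n x))"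
proof -
  have "wp alive_prog (n * (2 + 3) + 2) s (\<lambda>s'. frame {2} {5, 25} s s' \<and> vec_at s' 5 n (alive n x))"
    unfolding alive_prog_def alive_def
    by (rule wp_fill_vec; (rule wp_indicator)?)
      (use assms in \<open>auto simp: frame_def env_def vec_at_def\<close>)
  then show ?thesis by simp
qed

definition threshold_prog :: prog where
  "threshold_prog = Seq (Sum 2 (IVar 0) 13 Skip (entry 5 2))
     (let_scal 22 (RMul (RMul (RConst 423) (RMul (scal 12) (scal 12))) (RSub (scal 13) (RConst 1))))"

lemma wp_threshold:
  assumes env: "env n a s" and al: "vec_at s 5 n (alive n x)" and T: "cell s 12 0 0 = cap n x"
  shows "wp threshold_prog (n * 4 + 4) s (\<lambda>s'. frame {2} {13, 22} s s' \<and> cell s' 22 0 0 = thr n x)"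
proof -
  have "wp (Sum 2 (IVar 0) 13 Skip (entry 5 2)) (n * (1 + 3) + 3) s
    (\<lambda>s'. frame {2} {13} s s' \<and> cell s' 13 0 0 = (\<Sum>j<n. alive n x j))"
    by (rule wp_sum; (rule wp_skip)?) (use env al in \<open>auto simp: frame_def env_def vec_at_def\<close>)
  then have "wp threshold_prog ((n * (1 + 3) + 3) + 1) s
      (\<lambda>s'. frame {2} {13, 22} s s' \<and> cell s' 22 0 0 = thr n x)"
    unfolding threshold_prog_def
    by (rule wp_seq) (rule wp_rassign, use T in \<open>auto simp: frame_def thr_def nalive_def set_cell_def\<close>)
  then show ?thesis by (rule wp_mono) auto
qed

text \<open>The disjunction is written by De Morgan, since tests offer only negation and
  conjunction.\<close>

definition blocked_prog :: prog where
  "blocked_prog = FillVec 1 6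
     (Indicator (Neg (Conj (Neg (RLess (rpow (RSub (scal 14) (entry 4 1)) 6) (scal 22)))
        (Neg (RLess (rpow (RAdd (scal 14) (entry 4 1)) 6) (scal 22))))))
     (scal 25)"

lemma wp_blocked:
  assumes env: "env n a s" and y: "vec_at s 4 n (row n a x)" and "cell s 22 0 0 = thr n x" "cell s 14 0 0 = \<mu>"
  shows "wp blocked_prog (n * 5 + 2) s (\<lambda>s'. frame {1} {6, 25} s s' \<and> vec_at s' 6 n (blocked n a \<mu> x))"
proof -
  have "wp blocked_prog (n * (2 + 3) + 2) s (\<lambda>s'. frame {1} {6, 25} s s' \<and> vec_at s' 6 n (blocked n a \<mu> x))"
    unfolding blocked_prog_def blocked_def
    by (rule wp_fill_vec; (rule wp_indicator)?)
      (use assms in \<open>auto simp: frame_def env_def vec_at_def\<close>)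
  then show ?thesis by simp
qed

definition weights_prog :: prog where
  "weights_prog = FillVec 1 26 Skip
     (RAdd (RDiv (RConst 1) (rpow (RSub (scal 14) (entry 4 1)) 7)) (RDiv (RConst 1) (rpow (RAdd (scal 14) (entry 4 1)) 7)))"

lemma wp_weights:
  assumes env: "env n a s" and y: "vec_at s 4 n (row n a x)" and "cell s 14 0 0 = \<mu>"
  shows "wp weights_prog (n * 4 + 2) s (\<lambda>s'. frame {1} {26} s s' \<and> vec_at s' 26 n (weight n a \<mu> x))"
proof -
  have "wp weights_prog (n * (1 + 3) + 2) s (\<lambda>s'. frame {1} {26} s s' \<and> vec_at s' 26 n (weight n a \<mu> x))"
    unfolding weights_prog_def
    by (rule wp_fill_vec; (rule wp_skip)?)
      (use assms in \<open>auto simp: frame_def env_def vec_at_def weight_def\<close>)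
  then show ?thesis by simp
qed

definition generators_prog :: prog where
  "generators_prog =
     Seq (For 1 (IVar 0) (Fill 2 (IVar 0) 2 (IVar 1) Skip
            (RMul (entry 6 1) (RMul (entry 5 2) (Cell 0 (IVar 1) (IVar 2))))))
    (Seq (Fill 2 (IVar 0) 2 (IVar 0) Skip (RMul (entry 5 2) (entry 3 2)))
         (For 1 (IVar 0) (Seq
            (Fill 2 (IVar 0) 2 (IAdd (IAdd (IVar 0) (IConst 1)) (IVar 1)) Skip (RConst 0))
            (RAssign 2 (IAdd (IAdd (IVar 0) (IConst 1)) (IVar 1)) (IVar 1) (entry 5 1)))))"

lemma wp_generators:
  assumes env: "env n a s" and x: "vec_at s 3 n x" and al: "vec_at s 5 n al" and bl: "vec_at s 6 n bl"
  shows "wp generators_prog ((n * (n * 4 + 4) + 2) + ((n * 4 + 2) + (n * (n * 4 + 5) + 2))) s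
    (\<lambda>s'. frame {1, 2} {2} s s' \<and> (\<forall>m<2 * n + 1. \<forall>j<n. cell s' 2 m j = generators n a x al bl m j))"
proof -
  let ?V = "generators n a x al bl"
  let ?I1 = "\<lambda>i s'. frame {1, 2} {2} s s' \<and> (\<forall>m<i. \<forall>j<n. cell s' 2 m j = ?V m j)"
  let ?I2 = "\<lambda>i s'. frame {1, 2} {2} s s' \<and> (\<forall>m<n + 1 + i. \<forall>j<n. cell s' 2 m j = ?V m j)"
  have fill: "wp (Fill 2 (IVar 0) 2 e Skip r) (n * (1 + 3) + 2) s1
      (\<lambda>s'. frame {2} {2} s1 s' \<and> (\<forall>m j. cell s' 2 m j = (if m = i \<and> j < n then f j else cell s1 2 m j)))"
    if "frame {1, 2} {2} s s1"
       "\<And>j s'. j < n \<Longrightarrow> frame {2} {2} s1 s' \<Longrightarrow> ivar s' 2 = j \<Longrightarrow> rval r s' = f j \<and> ival e s' = i"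
    for e r f i s1
    by (rule wp_fill; (rule wp_skip)?) (use env that in \<open>auto simp: env_def frame_ivar\<close>)
  have "wp (For 1 (IVar 0) (Fill 2 (IVar 0) 2 (IVar 1) Skip
            (RMul (entry 6 1) (RMul (entry 5 2) (Cell 0 (IVar 1) (IVar 2))))))
       (n * ((n * (1 + 3) + 2) + 2) + 2) s (\<lambda>s'. ?I1 n s' \<and> ivar s' 1 = n)"
  proof (rule wp_for[where I = ?I1])
    show "?I1 0 (set_ivar 1 0 s)" by (auto intro: frame_set_ivar)
    show "ival (IVar 0) s' = n" if "?I1 i s'" for i s' using that env by (auto simp: frame_ivar env_def)
    fix i s1 assume i: "i < n" and I: "?I1 i s1" and v: "ivar s1 1 = i"
    show "wp (Fill 2 (IVar 0) 2 (IVar 1) Skip (RMul (entry 6 1) (RMul (entry 5 2) (Cell 0 (IVar 1) (IVar 2)))))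
      (n * (1 + 3) + 2) s1 (\<lambda>s'. ivar s' 1 = i \<and> ?I1 (Suc i) (set_ivar 1 (Suc i) s'))"
    proof (rule wp_post[OF fill[where f = "?V i" and i = i]])
      fix s2 assume "frame {2} {2} s1 s2 \<and> (\<forall>m j. cell s2 2 m j = (if m = i \<and> j < n then ?V i j else cell s1 2 m j))"
      then show "ivar s2 1 = i \<and> ?I1 (Suc i) (set_ivar 1 (Suc i) s2)"
        using I v by (auto simp: frame_ivar less_Suc_eq intro!: frame_set_ivar elim!: frame_trans)
    qed (use I v i env al bl in \<open>auto simp: frame_def env_def vec_at_def generators_def\<close>)
  qed
  moreover have "wp (Seq (Fill 2 (IVar 0) 2 (IVar 0) Skip (RMul (entry 5 2) (entry 3 2)))
         (For 1 (IVar 0) (Seq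
            (Fill 2 (IVar 0) 2 (IAdd (IAdd (IVar 0) (IConst 1)) (IVar 1)) Skip (RConst 0))
            (RAssign 2 (IAdd (IAdd (IVar 0) (IConst 1)) (IVar 1)) (IVar 1) (entry 5 1)))))
       ((n * (1 + 3) + 2) + (n * (((n * (1 + 3) + 2) + 1) + 2) + 2)) s1 (\<lambda>s'. ?I2 n s' \<and> ivar s' 1 = n)"
    if s1: "?I1 n s1 \<and> ivar s1 1 = n" for s1
  proof (rule wp_seq)
    show "wp (Fill 2 (IVar 0) 2 (IVar 0) Skip (RMul (entry 5 2) (entry 3 2))) (n * (1 + 3) + 2) s1 (?I2 0)"
    proof (rule wp_post[OF fill[where f = "?V n" and i = n]])
      fix s2 assume "frame {2} {2} s1 s2 \<and> (\<forall>m j. cell s2 2 m j = (if m = n \<and> j < n then ?V n j else cell s1 2 m j))"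
      then show "?I2 0 s2" using s1 by (auto simp: less_Suc_eq elim!: frame_trans)
    qed (use s1 env al x in \<open>auto simp: frame_def env_def vec_at_def generators_def\<close>)
    fix s2 assume s2: "?I2 0 s2"
    let ?e = "IAdd (IAdd (IVar 0) (IConst 1)) (IVar 1)"
    show "wp (For 1 (IVar 0) (Seq (Fill 2 (IVar 0) 2 ?e Skip (RConst 0)) (RAssign 2 ?e (IVar 1) (entry 5 1))))
       (n * (((n * (1 + 3) + 2) + 1) + 2) + 2) s2 (\<lambda>s'. ?I2 n s' \<and> ivar s' 1 = n)"
    proof (rule wp_for[where I = ?I2])
      show "?I2 0 (set_ivar 1 0 s2)" using s2 by (auto intro: frame_set_ivar)
      show "ival (IVar 0) s' = n" if "?I2 i s'" for i s' using that env by (auto simp: frame_ivar env_def)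
      fix i s3 assume i: "i < n" and I: "?I2 i s3" and v: "ivar s3 1 = i"
      have "wp (Fill 2 (IVar 0) 2 ?e Skip (RConst 0)) (n * (1 + 3) + 2) s3
        (\<lambda>s'. frame {2} {2} s3 s' \<and> (\<forall>m j. cell s' 2 m j = (if m = n + 1 + i \<and> j < n then 0 else cell s3 2 m j)))"
        by (rule fill) (use I v i env in \<open>auto simp: frame_def env_def\<close>)
      then show "wp (Seq (Fill 2 (IVar 0) 2 ?e Skip (RConst 0)) (RAssign 2 ?e (IVar 1) (entry 5 1)))
        ((n * (1 + 3) + 2) + 1) s3 (\<lambda>s'. ivar s' 1 = i \<and> ?I2 (Suc i) (set_ivar 1 (Suc i) s'))"
      proof (rule wp_seq)
        fix s4 assume s4: "frame {2} {2} s3 s4 \<and> (\<forall>m j. cell s4 2 m j = (if m = n + 1 + i \<and> j < n then 0 else cell s3 2 m j))"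
        then have F: "frame {1, 2} {2} s s4" using I by (auto elim!: frame_trans)
        have v4: "ivar s4 1 = i" "ivar s4 0 = n" and al4: "cell s4 5 0 i = al i"
          using s4 v F env al i by (auto simp: frame_def env_def vec_at_def)
        have V: "?V (n + 1 + i) j = (if j = i then al i else 0)" for j
          by (auto simp: generators_def)
        show "wp (RAssign 2 ?e (IVar 1) (entry 5 1)) 1 s4 (\<lambda>s'. ivar s' 1 = i \<and> ?I2 (Suc i) (set_ivar 1 (Suc i) s'))"
        proof (rule wp_rassign, intro conjI allI impI)
          fix m j assume m: "m < n + 1 + Suc i" "j < n"
          show "cell (set_ivar 1 (Suc i) (set_cell 2 (ival ?e s4) (ival (IVar 1) s4) (rval (entry 5 1) s4) s4)) 2 m j = ?V m j"
          proof (cases "m = n + 1 + i")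
            case True
            show ?thesis unfolding True V using s4 m v4 al4 by simp
          next
            case False
            then show ?thesis using s4 m I v4 by simp
          qed
        qed (use v4 F in \<open>auto intro!: frame_set_ivar frame_set_cell\<close>)
      qed
    qed
  qed
  ultimately have "wp generators_prog ((n * ((n * (1 + 3) + 2) + 2) + 2) +
      ((n * (1 + 3) + 2) + (n * (((n * (1 + 3) + 2) + 1) + 2) + 2))) s (\<lambda>s'. ?I2 n s' \<and> ivar s' 1 = n)"
    unfolding generators_prog_def by (rule wp_seq)
  then show ?thesis by (rule wp_mono) (auto simp: algebra_simps)
qed

definition gram_schmidt_prog :: prog where
  "gram_schmidt_prog = For 3 (IAdd (IAdd (IVar 0) (IVar 0)) (IConst 1))
     (Seq (For 4 (IVar 3)
        (Seq (Sum 2 (IVar 0) 15 Skip (RMul (Cell 2 (IVar 3) (IVar 2)) (Cell 2 (IVar 4) (IVar 2))))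
        (Seq (let_scal 23 (RDiv (scal 15) (entry 7 4)))
             (Fill 2 (IVar 0) 2 (IVar 3) Skip
                (RSub (Cell 2 (IVar 3) (IVar 2)) (RMul (scal 23) (Cell 2 (IVar 4) (IVar 2))))))))
     (Seq (Sum 2 (IVar 0) 15 Skip (RMul (Cell 2 (IVar 3) (IVar 2)) (Cell 2 (IVar 3) (IVar 2))))
          (RAssign 7 (IConst 0) (IVar 3) (scal 15))))"

lemma wp_ip:
  assumes "\<And>s'. frame {2} {15} s s' \<Longrightarrow> ivar s' 0 = n"
    "\<And>j s'. j < n \<Longrightarrow> frame {2} {15} s s' \<Longrightarrow> ivar s' 2 = j \<Longrightarrow> rval e s' = u j * v j"
  shows "wp (Sum 2 (IVar 0) 15 Skip e) (n * 4 + 3) s (\<lambda>s'. frame {2} {15} s s' \<and> cell s' 15 0 0 = ip n u v)"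
proof -
  have "wp (Sum 2 (IVar 0) 15 Skip e) (n * (1 + 3) + 3) s
      (\<lambda>s'. frame {2} {15} s s' \<and> cell s' 15 0 0 = (\<Sum>j<n. u j * v j))"
    by (rule wp_sum; (rule wp_skip)?) (use assms in auto)
  then show ?thesis by (simp add: ip_def)
qed

text \<open>The residuals replace the generators in place, so a finished row must satisfy an
  equation about the array itself. It persists because it reads only rows up to its own, which are
  not written again.\<close>

lemma wp_gram_schmidt:
  assumes n: "ivar s 0 = n" and V: "\<forall>m<2 * n + 1. \<forall>j<n. cell s 2 m j = V m j"
  shows "wp gram_schmidt_prog ((2 * n + 1) * ((2 * n + 1) * (n * 8 + 8) + n * 4 + 8) + 2) s
    (\<lambda>s'. frame {2, 3, 4} {2, 7, 15, 23} s s' \<and> gram_schmidt n (2 * n + 1) V (cell s' 2) \<and>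
       (\<forall>m<2 * n + 1. cell s' 7 0 m = ip n (cell s' 2 m) (cell s' 2 m)))"
proof -
  let ?F = "frame {2, 3, 4} {2, 7, 15, 23} s"
  let ?I = "\<lambda>m s'. ?F s' \<and> (\<forall>t<m. \<forall>j<n. cell s' 2 t j = red n (cell s' 2) (V t) t j) \<and>
     (\<forall>t<m. cell s' 7 0 t = ip n (cell s' 2 t) (cell s' 2 t)) \<and>
     (\<forall>t. m \<le> t \<longrightarrow> t < 2 * n + 1 \<longrightarrow> (\<forall>j<n. cell s' 2 t j = V t j))"
  let ?inner = "Seq (Sum 2 (IVar 0) 15 Skip (RMul (Cell 2 (IVar 3) (IVar 2)) (Cell 2 (IVar 4) (IVar 2))))
        (Seq (let_scal 23 (RDiv (scal 15) (entry 7 4)))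
             (Fill 2 (IVar 0) 2 (IVar 3) Skip
                (RSub (Cell 2 (IVar 3) (IVar 2)) (RMul (scal 23) (Cell 2 (IVar 4) (IVar 2))))))"
  have "wp gram_schmidt_prog ((2 * n + 1) * (((2 * n + 1) * (((n * 4 + 3) + (1 + (n * (1 + 3) + 2))) + 2) + 2 +
      ((n * 4 + 3) + 1)) + 2) + 2) s (\<lambda>s'. ?I (2 * n + 1) s' \<and> ivar s' 3 = 2 * n + 1)"
    unfolding gram_schmidt_prog_def
  proof (rule wp_for[where I = ?I])
    show "?I 0 (set_ivar 3 0 s)" using V by (auto intro: frame_set_ivar)
    show "ival (IAdd (IAdd (IVar 0) (IVar 0)) (IConst 1)) s' = 2 * n + 1" if "?I m s'" for m s'
      using that n by (simp add: frame_def)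
    fix m s1 assume m: "m < 2 * n + 1" and I: "?I m s1" and v: "ivar s1 3 = m"
    define W where "W = cell s1 2"
    have n1: "ivar s1 0 = n" using I n by (simp add: frame_def)
    \<comment> \<open>\<open>W\<close> is the array before row \<open>m\<close> is processed; only
      that row changes, while the earlier rows it is reduced against stay fixed.\<close>
    let ?K = "\<lambda>r s'. frame {2, 4} {2, 15, 23} s1 s' \<and> (\<forall>t j. t \<noteq> m \<longrightarrow> cell s' 2 t j = W t j) \<and>
       (\<forall>j<n. cell s' 2 m j = red n W (V m) r j)"
    have inner: "wp (For 4 (IVar 3) ?inner) (m * (((n * 4 + 3) + (1 + (n * (1 + 3) + 2))) + 2) + 2) s1
        (\<lambda>s'. ?K m s' \<and> ivar s' 4 = m)"
    proof (rule wp_for[where I = ?K])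
      show "?K 0 (set_ivar 4 0 s1)" using I m by (auto simp: W_def intro: frame_set_ivar)
      show "ival (IVar 3) s' = m" if "?K r s'" for r s' using that v by (simp add: frame_def)
      fix r s2 assume r: "r < m" and K: "?K r s2" and v4: "ivar s2 4 = r"
      have v3: "ivar s2 3 = m" and n2: "ivar s2 0 = n" using K v n1 by (simp_all add: frame_def)
      have "wp (Sum 2 (IVar 0) 15 Skip (RMul (Cell 2 (IVar 3) (IVar 2)) (Cell 2 (IVar 4) (IVar 2)))) (n * 4 + 3) s2
         (\<lambda>s'. frame {2} {15} s2 s' \<and> cell s' 15 0 0 = ip n (red n W (V m) r) (W r))"
        by (rule wp_ip) (use K v3 v4 n2 r in \<open>auto simp: frame_def\<close>)
      then show "wp ?inner ((n * 4 + 3) + (1 + (n * (1 + 3) + 2))) s2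
         (\<lambda>s'. ivar s' 4 = r \<and> ?K (Suc r) (set_ivar 4 (Suc r) s'))"
      proof (rule wp_seq)
        fix s3 assume s3: "frame {2} {15} s2 s3 \<and> cell s3 15 0 0 = ip n (red n W (V m) r) (W r)"
        let ?c = "ip n (red n W (V m) r) (W r) / ip n (W r) (W r)"
        have S: "cell s3 7 0 r = ip n (W r) (W r)"
          using I K r s3 by (simp add: frame_def W_def)
        have "wp (let_scal 23 (RDiv (scal 15) (entry 7 4))) 1 s3
          (\<lambda>s'. frame {2} {15, 23} s2 s' \<and> cell s' 23 0 0 = ?c)"
          by (rule wp_rassign) (use s3 S v4 in \<open>auto simp: frame_ivar intro!: frame_set_cell elim: frame_mono\<close>)
        then show "wp (Seq (let_scal 23 (RDiv (scal 15) (entry 7 4))) (Fill 2 (IVar 0) 2 (IVar 3) Skip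
                (RSub (Cell 2 (IVar 3) (IVar 2)) (RMul (scal 23) (Cell 2 (IVar 4) (IVar 2))))))
            (1 + (n * (1 + 3) + 2)) s3 (\<lambda>s'. ivar s' 4 = r \<and> ?K (Suc r) (set_ivar 4 (Suc r) s'))"
        proof (rule wp_seq)
          fix s4 assume s4: "frame {2} {15, 23} s2 s4 \<and> cell s4 23 0 0 = ?c"
          have F4: "frame {2, 4} {2, 15, 23} s1 s4" using s4 K by (auto simp: frame_def)
          have v': "ivar s4 4 = r" "ivar s4 3 = m" "ivar s4 0 = n" using s4 v3 v4 n2 by (simp_all add: frame_def)
          have c4: "cell s4 2 = cell s2 2" using s4 by (simp add: frame_def)
          have "wp (Fill 2 (IVar 0) 2 (IVar 3) Skip
                (RSub (Cell 2 (IVar 3) (IVar 2)) (RMul (scal 23) (Cell 2 (IVar 4) (IVar 2)))))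
            (n * (1 + 3) + 2) s4 (\<lambda>s'. frame {2} {2} s4 s' \<and>
               (\<forall>k j. cell s' 2 k j = (if k = m \<and> j < n then red n W (V m) (Suc r) j else cell s4 2 k j)))"
          proof (rule wp_fill; (rule wp_skip)?)
            fix j s' assume j: "j < n" and F: "frame {2} {2} s4 s'" and vj: "ivar s' 2 = j"
              and c: "\<And>k j'. k \<noteq> m \<or> j \<le> j' \<Longrightarrow> cell s' 2 k j' = cell s4 2 k j'"
            have "cell s' 2 m j = red n W (V m) r j" using c[of m j] c4 K j by simp
            moreover have "cell s' 2 r j = W r j" using c[of r j] c4 K r by simp
            ultimately show "frame {} {} s' s' \<and>
               rval (RSub (Cell 2 (IVar 3) (IVar 2)) (RMul (scal 23) (Cell 2 (IVar 4) (IVar 2)))) s' =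
                 red n W (V m) (Suc r) j \<and> ival (IVar 3) s' = m"
              using F vj v' s4 by (simp add: frame_def)
          qed (use v' in \<open>auto simp: frame_def\<close>)
          then show "wp (Fill 2 (IVar 0) 2 (IVar 3) Skip
                (RSub (Cell 2 (IVar 3) (IVar 2)) (RMul (scal 23) (Cell 2 (IVar 4) (IVar 2)))))
            (n * (1 + 3) + 2) s4 (\<lambda>s'. ivar s' 4 = r \<and> ?K (Suc r) (set_ivar 4 (Suc r) s'))"
          proof (rule wp_post)
            fix s5 assume s5: "frame {2} {2} s4 s5 \<and>
               (\<forall>k j. cell s5 2 k j = (if k = m \<and> j < n then red n W (V m) (Suc r) j else cell s4 2 k j))"
            then have "frame {2, 4} {2, 15, 23} s1 s5" using F4 by (auto simp: frame_def)
            moreover have "ivar s5 4 = r" using s5 v' by (simp add: frame_def)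
            ultimately show "ivar s5 4 = r \<and> ?K (Suc r) (set_ivar 4 (Suc r) s5)"
              using s5 c4 K by (auto intro!: frame_set_ivar simp del: red.simps)
          qed
        qed
      qed
    qed
    \<comment> \<open>The inner loop runs \<open>m\<close> times; the outer rule needs one bound for
      all \<open>m\<close>.\<close>
    have mono: "m * c + 2 \<le> (2 * n + 1) * c + 2" for c
      using m by (intro add_mono mult_le_mono1) auto
    have "wp (For 4 (IVar 3) ?inner) ((2 * n + 1) * (((n * 4 + 3) + (1 + (n * (1 + 3) + 2))) + 2) + 2) s1
        (\<lambda>s'. ?K m s')"
      by (rule wp_mono[OF inner mono]) blast
    then show "wp (Seq (For 4 (IVar 3) ?inner)
         (Seq (Sum 2 (IVar 0) 15 Skip (RMul (Cell 2 (IVar 3) (IVar 2)) (Cell 2 (IVar 3) (IVar 2))))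
          (RAssign 7 (IConst 0) (IVar 3) (scal 15))))
        ((2 * n + 1) * (((n * 4 + 3) + (1 + (n * (1 + 3) + 2))) + 2) + 2 + ((n * 4 + 3) + 1)) s1
        (\<lambda>s'. ivar s' 3 = m \<and> ?I (Suc m) (set_ivar 3 (Suc m) s'))"
    proof (rule wp_seq)
      fix s2 assume K: "?K m s2"
      have v3: "ivar s2 3 = m" and n2: "ivar s2 0 = n" using K v n1 by (simp_all add: frame_def)
      have F2: "?F s2" using K I by (auto simp: frame_def)
      have "wp (Sum 2 (IVar 0) 15 Skip (RMul (Cell 2 (IVar 3) (IVar 2)) (Cell 2 (IVar 3) (IVar 2)))) (n * 4 + 3) s2
         (\<lambda>s'. frame {2} {15} s2 s' \<and> cell s' 15 0 0 = ip n (cell s2 2 m) (cell s2 2 m))"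
        by (rule wp_ip) (use v3 n2 in \<open>auto simp: frame_def\<close>)
      then show "wp (Seq (Sum 2 (IVar 0) 15 Skip (RMul (Cell 2 (IVar 3) (IVar 2)) (Cell 2 (IVar 3) (IVar 2))))
          (RAssign 7 (IConst 0) (IVar 3) (scal 15))) ((n * 4 + 3) + 1) s2
         (\<lambda>s'. ivar s' 3 = m \<and> ?I (Suc m) (set_ivar 3 (Suc m) s'))"
      proof (rule wp_seq)
        fix s3 assume s3: "frame {2} {15} s2 s3 \<and> cell s3 15 0 0 = ip n (cell s2 2 m) (cell s2 2 m)"
        have F3: "?F s3" using s3 F2 by (auto simp: frame_def)
        have c3: "cell s3 2 = cell s2 2" "cell s3 7 = cell s1 7" and v3': "ivar s3 3 = m"
          using s3 K v3 by (simp_all add: frame_def)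
        have red: "red n (cell s2 2) (V t) t j = red n W (V t) t j" if "t \<le> m" "j < n" for t j
          using that K by (intro red_cong) auto
        have W2: "cell s2 2 t = W t" if "t \<noteq> m" for t using K that by auto
        have A: "cell s2 2 t j = red n (cell s2 2) (V t) t j" if "t < Suc m" "j < n" for t j
        proof (cases "t = m")
          case True
          then show ?thesis using K that red[of m j] by simp
        next
          case False
          then show ?thesis using I that red[of t j] W2[of t] by (simp add: W_def)
        qed
        have B: "cell s1 7 0 t = ip n (cell s2 2 t) (cell s2 2 t)" if "t < m" for t
          using I that W2[of t] by (simp add: W_def)
        have C: "cell s2 2 t j = V t j" if "Suc m \<le> t" "t < 2 * n + 1" "j < n" for t j
          using I that W2[of t] by (simp add: W_def)
        show "wp (RAssign 7 (IConst 0) (IVar 3) (scal 15)) 1 s3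
           (\<lambda>s'. ivar s' 3 = m \<and> ?I (Suc m) (set_ivar 3 (Suc m) s'))"
          by (rule wp_rassign)
            (use F3 c3 v3' A B C s3 in \<open>auto intro!: frame_set_ivar frame_set_cell simp: less_Suc_eq\<close>)
      qed
    qed
  qed
  then show ?thesis
    by (rule wp_mono) (auto simp: gram_schmidt_def algebra_simps)
qed

definition best_prog :: prog where
  "best_prog = Seq (IAssign 5 (IConst 0)) (For 1 (IVar 0)
     (Seq (IAssign 3 (IAdd (IAdd (IVar 0) (IConst 1)) (IVar 1)))
     (Seq (Sum 4 (IVar 0) 24
             (Sum 2 (IVar 0) 15 Skip (RMul (Cell 0 (IVar 4) (IVar 2)) (Cell 2 (IVar 3) (IVar 2))))
             (RMul (entry 26 4) (RMul (scal 15) (scal 15))))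
     (Seq (let_scal 24 (RDiv (scal 24) (entry 7 3)))
          (Cond (Conj (RLess (RConst 0) (entry 7 3))
                   (Neg (Conj (Neg (ILess (IVar 5) (IConst 1))) (Neg (RLess (scal 24) (scal 17))))))
             (Seq (IAssign 5 (IVar 3)) (let_scal 17 (scal 24)))
             (Seq Skip Skip))))))"

lemma wp_best:
  assumes env: "env n a s" and z: "vec_at s 26 n z"
    and S: "\<forall>m<2 * n + 1. cell s 7 0 m = ip n (cell s 2 m) (cell s 2 m)"
  shows "wp best_prog (n * (n * (n * 4 + 6) + 10) + 3) s
    (\<lambda>s'. frame {1, 2, 3, 4, 5} {15, 17, 24} s s' \<and> best_direction n a z (cell s 2) (ivar s' 5))"
proof -
  define W where "W = cell s 2"
  define N where "N l = ip n (W (n + 1 + l)) (W (n + 1 + l))" for l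
  define q where "q l = quad n a z (W (n + 1 + l)) / N l" for l
  let ?F = "frame {1, 2, 3, 4, 5} {15, 17, 24} s"
  \<comment> \<open>Candidates have index at least \<open>n + 1\<close>, so 0 is a safe mark for an
    empty search. The value in array 17 is meaningful only in the second alternative.\<close>
  let ?G = "\<lambda>i s'. (ivar s' 5 = 0 \<and> (\<forall>l<i. \<not> 0 < N l)) \<or>
      (\<exists>l0<i. ivar s' 5 = n + 1 + l0 \<and> 0 < N l0 \<and> cell s' 17 0 0 = q l0 \<and> (\<forall>l<i. 0 < N l \<longrightarrow> q l0 \<le> q l))"
  let ?I = "\<lambda>i s'. ?F s' \<and> ?G i s'"
  let ?sum = "Sum 4 (IVar 0) 24
             (Sum 2 (IVar 0) 15 Skip (RMul (Cell 0 (IVar 4) (IVar 2)) (Cell 2 (IVar 3) (IVar 2))))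
             (RMul (entry 26 4) (RMul (scal 15) (scal 15)))"
  let ?b = "Conj (RLess (RConst 0) (entry 7 3))
                   (Neg (Conj (Neg (ILess (IVar 5) (IConst 1))) (Neg (RLess (scal 24) (scal 17)))))"
  let ?upd = "Cond ?b (Seq (IAssign 5 (IVar 3)) (let_scal 17 (scal 24))) (Seq Skip Skip)"
  let ?T = "n * ((n * 4 + 3) + 3) + 3"
  have F_step: "?F s'" if "?F s1" "frame {2, 3, 4} {15, 24} s1 s'" for s1 s'
    using that by (auto simp: frame_def)
  have "wp best_prog (1 + (n * ((1 + (?T + (1 + Suc (1 + 1)))) + 2) + 2)) s (\<lambda>s'. ?I n s' \<and> ivar s' 1 = n)"
    unfolding best_prog_def
  proof (rule wp_seq)
    show "wp (IAssign 5 (IConst 0)) 1 s (\<lambda>s'. ?F s' \<and> ivar s' 5 = 0)"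
      by (rule wp_iassign) (auto intro!: frame_set_ivar)
    fix s0 assume s0: "?F s0 \<and> ivar s0 5 = 0"
    show "wp (For 1 (IVar 0) (Seq (IAssign 3 (IAdd (IAdd (IVar 0) (IConst 1)) (IVar 1)))
       (Seq ?sum (Seq (let_scal 24 (RDiv (scal 24) (entry 7 3))) ?upd))))
       (n * ((1 + (?T + (1 + Suc (1 + 1)))) + 2) + 2) s0 (\<lambda>s'. ?I n s' \<and> ivar s' 1 = n)"
    proof (rule wp_for[where I = ?I])
      show "?I 0 (set_ivar 1 0 s0)" using s0 by (auto intro: frame_set_ivar)
      show "ival (IVar 0) s' = n" if "?I i s'" for i s' using that env by (auto simp: frame_ivar env_def)
      fix i s1 assume i: "i < n" and I: "?I i s1" and v: "ivar s1 1 = i"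
      have n1: "ivar s1 0 = n" using I env by (auto simp: frame_def env_def)
      have "wp (IAssign 3 (IAdd (IAdd (IVar 0) (IConst 1)) (IVar 1))) 1 s1
          (\<lambda>s'. frame {3} {} s1 s' \<and> ivar s' 3 = n + 1 + i)"
        by (rule wp_iassign) (use n1 v in \<open>auto intro!: frame_set_ivar\<close>)
      then show "wp (Seq (IAssign 3 (IAdd (IAdd (IVar 0) (IConst 1)) (IVar 1)))
          (Seq ?sum (Seq (let_scal 24 (RDiv (scal 24) (entry 7 3))) ?upd))) (1 + (?T + (1 + Suc (1 + 1)))) s1
          (\<lambda>s'. ivar s' 1 = i \<and> ?I (Suc i) (set_ivar 1 (Suc i) s'))"
      proof (rule wp_seq)
        fix s2 assume s2: "frame {3} {} s1 s2 \<and> ivar s2 3 = n + 1 + i"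
        have F2: "?F s2" using I s2 by (auto simp: frame_def)
        have env2: "env n a s2" using F2 env by (auto intro: env_frame)
        have c2: "cell s2 26 = cell s 26" "cell s2 2 = W" "cell s2 7 = cell s 7"
          using F2 by (simp_all add: frame_def W_def)
        have "wp ?sum (n * ((n * 4 + 3) + 3) + 3) s2
           (\<lambda>s'. frame {2, 4} {15, 24} s2 s' \<and> cell s' 24 0 0 =
              (\<Sum>r<n. z r * (ip n (a r) (W (n + 1 + i)) * ip n (a r) (W (n + 1 + i)))))"
        proof (rule wp_post[OF wp_sum[where Vs = "{2}" and Ms = "{15}"]])
          fix r s3 assume r: "r < n" and F3: "frame {4, 2} {24, 15} s2 s3" and v4: "ivar s3 4 = r"
          have "wp (Sum 2 (IVar 0) 15 Skip (RMul (Cell 0 (IVar 4) (IVar 2)) (Cell 2 (IVar 3) (IVar 2)))) (n * 4 + 3) s3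
            (\<lambda>s'. frame {2} {15} s3 s' \<and> cell s' 15 0 0 = ip n (a r) (W (n + 1 + i)))"
            by (rule wp_ip) (use F3 v4 env2 s2 r c2 in \<open>auto simp: frame_def env_def\<close>)
          then show "wp (Sum 2 (IVar 0) 15 Skip (RMul (Cell 0 (IVar 4) (IVar 2)) (Cell 2 (IVar 3) (IVar 2)))) (n * 4 + 3) s3
            (\<lambda>s'. frame {2} {15} s3 s' \<and> rval (RMul (entry 26 4) (RMul (scal 15) (scal 15))) s' =
               z r * (ip n (a r) (W (n + 1 + i)) * ip n (a r) (W (n + 1 + i))))"
            by (rule wp_post) (use F3 v4 c2 z r in \<open>auto simp: frame_def vec_at_def\<close>)
        qed (use env2 in \<open>auto simp: frame_def env_def insert_commute\<close>)
        then show "wp (Seq ?sum (Seq (let_scal 24 (RDiv (scal 24) (entry 7 3))) ?upd)) (?T + (1 + Suc (1 + 1))) s2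
          (\<lambda>s'. ivar s' 1 = i \<and> ?I (Suc i) (set_ivar 1 (Suc i) s'))"
        proof (rule wp_seq)
          fix s3 assume s3: "frame {2, 4} {15, 24} s2 s3 \<and> cell s3 24 0 0 =
              (\<Sum>r<n. z r * (ip n (a r) (W (n + 1 + i)) * ip n (a r) (W (n + 1 + i))))"
          have F3: "frame {2, 3, 4} {15, 24} s1 s3"
            by (rule frame_trans[of "{3}" "{}" s1 s2 "{2, 4}" "{15, 24}"]) (use s2 s3 in auto)
          have v3: "ivar s3 3 = n + 1 + i" "cell s3 7 = cell s 7" using s2 s3 c2 by (simp_all add: frame_def)
          have S3: "cell s 7 0 (n + 1 + i) = N i" using S i by (simp add: N_def W_def)
          have q3: "cell s3 24 0 0 = quad n a z (W (n + 1 + i))" using s3 by (simp add: quad_def)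
          have "wp (let_scal 24 (RDiv (scal 24) (entry 7 3))) 1 s3
            (\<lambda>s'. frame {2, 3, 4} {15, 24} s1 s' \<and> cell s' 24 0 0 = q i \<and> ivar s' 3 = n + 1 + i \<and> cell s' 7 0 (n + 1 + i) = N i)"
          proof (rule wp_rassign, intro conjI)
            show "frame {2, 3, 4} {15, 24} s1 (set_cell 24 (ival (IConst 0) s3) (ival (IConst 0) s3)
                (rval (RDiv (scal 24) (entry 7 3)) s3) s3)"
              using F3 by (rule frame_set_cell) simp
          qed (use v3 q3 S3 in \<open>simp_all add: q_def\<close>)
          then show "wp (Seq (let_scal 24 (RDiv (scal 24) (entry 7 3))) ?upd) (1 + Suc (1 + 1)) s3
            (\<lambda>s'. ivar s' 1 = i \<and> ?I (Suc i) (set_ivar 1 (Suc i) s'))"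
          proof (rule wp_seq)
            fix s4 assume s4: "frame {2, 3, 4} {15, 24} s1 s4 \<and> cell s4 24 0 0 = q i \<and> ivar s4 3 = n + 1 + i \<and>
               cell s4 7 0 (n + 1 + i) = N i"
            have F4: "?F s4" by (rule F_step[of s1 s4]) (use I s4 in blast)+
            have old: "ivar s4 5 = ivar s1 5" "cell s4 17 = cell s1 17" "ivar s4 1 = i"
              using s4 v by (simp_all add: frame_def)
            have G: "?G i s4" using I unfolding old by blast
            have h: "holds ?b s4 \<longleftrightarrow> 0 < N i \<and> (ivar s4 5 = 0 \<or> q i < cell s4 17 0 0)"
              using s4 by auto
            show "wp ?upd (Suc (1 + 1)) s4 (\<lambda>s'. ivar s' 1 = i \<and> ?I (Suc i) (set_ivar 1 (Suc i) s'))"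
            proof (rule wp_cond)
              assume "holds ?b s4"
              then have b: "0 < N i" "ivar s4 5 = 0 \<or> q i < cell s4 17 0 0" unfolding h by auto
              have min: "\<forall>l<i. 0 < N l \<longrightarrow> q i \<le> q l"
                using G
              proof (elim disjE exE conjE)
                fix l0 assume "ivar s4 5 = n + 1 + l0" "cell s4 17 0 0 = q l0" "\<forall>l<i. 0 < N l \<longrightarrow> q l0 \<le> q l"
                moreover from this have "q i < q l0" using b(2) by simp
                ultimately show ?thesis by (meson less_imp_le order_trans)
              qed simp
              show "wp (Seq (IAssign 5 (IVar 3)) (let_scal 17 (scal 24))) (1 + 1) s4
                (\<lambda>s'. ivar s' 1 = i \<and> ?I (Suc i) (set_ivar 1 (Suc i) s'))"
              proof (rule wp_seq)
                show "wp (IAssign 5 (IVar 3)) 1 s4 (\<lambda>s'. ?F s' \<and> ivar s' 1 = i \<and> ivar s' 5 = n + 1 + i \<and> cell s' 24 0 0 = q i)"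
                  by (rule wp_iassign) (use F4 s4 old in \<open>auto intro!: frame_set_ivar\<close>)
                fix s5 assume s5: "?F s5 \<and> ivar s5 1 = i \<and> ivar s5 5 = n + 1 + i \<and> cell s5 24 0 0 = q i"
                have new: "?G (Suc i) s'" if "ivar s' 5 = n + 1 + i" "cell s' 17 0 0 = q i" for s'
                  using that b(1) min by (intro disjI2 exI[of _ i]) (auto simp: less_Suc_eq)
                show "wp (let_scal 17 (scal 24)) 1 s5 (\<lambda>s'. ivar s' 1 = i \<and> ?I (Suc i) (set_ivar 1 (Suc i) s'))"
                  by (rule wp_rassign, intro conjI new) (use s5 in \<open>auto intro!: frame_set_ivar frame_set_cell\<close>)
              qed
            next
              assume "\<not> holds ?b s4"
              then have b: "\<not> 0 < N i \<or> ivar s4 5 \<noteq> 0 \<and> cell s4 17 0 0 \<le> q i" unfolding h by auto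
              have new: "?G (Suc i) s4"
                using G
              proof (elim disjE exE conjE)
                assume "ivar s4 5 = 0" "\<forall>l<i. \<not> 0 < N l"
                then show ?thesis using b by (auto simp: less_Suc_eq)
              next
                fix l0 assume "l0 < i" "ivar s4 5 = n + 1 + l0" "0 < N l0" "cell s4 17 0 0 = q l0"
                  "\<forall>l<i. 0 < N l \<longrightarrow> q l0 \<le> q l"
                then show ?thesis using b by (intro disjI2 exI[of _ l0]) (auto simp: less_Suc_eq)
              qed
              have post: "ivar s4 1 = i \<and> ?I (Suc i) (set_ivar 1 (Suc i) s4)"
                using new F4 old by (intro conjI) (auto intro!: frame_set_ivar)
              show "wp (Seq Skip Skip) (1 + 1) s4 (\<lambda>s'. ivar s' 1 = i \<and> ?I (Suc i) (set_ivar 1 (Suc i) s'))"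
              proof (rule wp_seq)
                show "wp Skip 1 s4 (\<lambda>s'. s' = s4)" by (rule wp_skip) simp
                show "wp Skip 1 s' (\<lambda>s'. ivar s' 1 = i \<and> ?I (Suc i) (set_ivar 1 (Suc i) s'))" if "s' = s4" for s'
                  unfolding that by (rule wp_skip) (rule post)
              qed
            qed
          qed
        qed
      qed
    qed
  qed
  then show ?thesis
  proof (rule wp_mono)
    fix s' assume I: "?I n s' \<and> ivar s' 1 = n"
    then show "?F s' \<and> best_direction n a z (cell s 2) (ivar s' 5)"
      unfolding best_direction_def W_def[symmetric] N_def[symmetric] q_def[symmetric] by (auto simp: q_def N_def)
  qed (simp add: algebra_simps)
qed

definition sup_norm_prog :: prog where
  "sup_norm_prog = Seq (let_scal 18 (RConst 0)) (For 2 (IVar 0)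
     (Cond (RLess (scal 18) (Cell 2 (IVar 5) (IVar 2))) (let_scal 18 (Cell 2 (IVar 5) (IVar 2)))
       (Cond (RLess (scal 18) (RSub (RConst 0) (Cell 2 (IVar 5) (IVar 2))))
          (let_scal 18 (RSub (RConst 0) (Cell 2 (IVar 5) (IVar 2)))) Skip)))"

lemma wp_sup_norm:
  assumes n: "ivar s 0 = n"
  shows "wp sup_norm_prog (n * 5 + 3) s
    (\<lambda>s'. frame {2} {18} s s' \<and> sup_norm n (cell s 2 (ivar s 5)) (cell s' 18 0 0))"
proof -
  define w where "w = cell s 2 (ivar s 5)"
  let ?I = "\<lambda>i s'. frame {2} {18} s s' \<and> sup_norm i w (cell s' 18 0 0)"
  have "wp sup_norm_prog (1 + (n * (Suc (Suc 1) + 2) + 2)) s (\<lambda>s'. ?I n s' \<and> ivar s' 2 = n)"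
    unfolding sup_norm_prog_def
  proof (rule wp_seq)
    show "wp (let_scal 18 (RConst 0)) 1 s (\<lambda>s'. frame {2} {18} s s' \<and> cell s' 18 0 0 = 0)"
      by (rule wp_rassign) (auto intro!: frame_set_cell)
    fix s0 assume s0: "frame {2} {18} s s0 \<and> cell s0 18 0 0 = 0"
    show "wp (For 2 (IVar 0)
     (Cond (RLess (scal 18) (Cell 2 (IVar 5) (IVar 2))) (let_scal 18 (Cell 2 (IVar 5) (IVar 2)))
       (Cond (RLess (scal 18) (RSub (RConst 0) (Cell 2 (IVar 5) (IVar 2))))
          (let_scal 18 (RSub (RConst 0) (Cell 2 (IVar 5) (IVar 2)))) Skip)))
      (n * (Suc (Suc 1) + 2) + 2) s0 (\<lambda>s'. ?I n s' \<and> ivar s' 2 = n)"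
    proof (rule wp_for[where I = ?I])
      show "?I 0 (set_ivar 2 0 s0)" using s0 by (auto simp: sup_norm_def intro: frame_set_ivar)
      show "ival (IVar 0) s' = n" if "?I i s'" for i s' using that n by (auto simp: frame_ivar)
      fix i s1 assume i: "i < n" and I: "?I i s1" and v: "ivar s1 2 = i"
      have e: "cell s1 2 (ivar s1 5) i = w i" using I by (simp add: frame_def w_def)
      have post: "ivar s' 2 = i \<and> ?I (Suc i) (set_ivar 2 (Suc i) s')"
        if "frame {2} {18} s s'" "ivar s' 2 = i" "sup_norm (Suc i) w (cell s' 18 0 0)" for s'
        using that by (auto intro: frame_set_ivar)
      have old: "0 \<le> cell s1 18 0 0" "\<forall>j<i. \<bar>w j\<bar> \<le> cell s1 18 0 0"
        "cell s1 18 0 0 = 0 \<or> (\<exists>j<i. \<bar>w j\<bar> = cell s1 18 0 0)" using I by (auto simp: sup_norm_def)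
      have new: "sup_norm (Suc i) w M" if "M = \<bar>w i\<bar>" "cell s1 18 0 0 \<le> M" for M
        using that old by (force simp: sup_norm_def less_Suc_eq)
      have keep: "sup_norm (Suc i) w (cell s1 18 0 0)" if "\<bar>w i\<bar> \<le> cell s1 18 0 0"
        using that old by (force simp: sup_norm_def less_Suc_eq)
      show "wp (Cond (RLess (scal 18) (Cell 2 (IVar 5) (IVar 2))) (let_scal 18 (Cell 2 (IVar 5) (IVar 2)))
       (Cond (RLess (scal 18) (RSub (RConst 0) (Cell 2 (IVar 5) (IVar 2))))
          (let_scal 18 (RSub (RConst 0) (Cell 2 (IVar 5) (IVar 2)))) Skip)) (Suc (Suc 1)) s1
        (\<lambda>s'. ivar s' 2 = i \<and> ?I (Suc i) (set_ivar 2 (Suc i) s'))"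
      proof (rule wp_cond)
        assume h: "holds (RLess (scal 18) (Cell 2 (IVar 5) (IVar 2))) s1"
        have a: "sup_norm (Suc i) w (w i)" using h e v old(1) by (intro new) auto
        have "wp (let_scal 18 (Cell 2 (IVar 5) (IVar 2))) 1 s1
          (\<lambda>s'. ivar s' 2 = i \<and> ?I (Suc i) (set_ivar 2 (Suc i) s'))"
          by (rule wp_rassign, rule post) (use I v e a in \<open>auto intro!: frame_set_cell\<close>)
        then show "wp (let_scal 18 (Cell 2 (IVar 5) (IVar 2))) (Suc 1) s1
          (\<lambda>s'. ivar s' 2 = i \<and> ?I (Suc i) (set_ivar 2 (Suc i) s'))"
          by (rule wp_mono) auto
      next
        assume h1: "\<not> holds (RLess (scal 18) (Cell 2 (IVar 5) (IVar 2))) s1"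
        show "wp (Cond (RLess (scal 18) (RSub (RConst 0) (Cell 2 (IVar 5) (IVar 2))))
          (let_scal 18 (RSub (RConst 0) (Cell 2 (IVar 5) (IVar 2)))) Skip) (Suc 1) s1
          (\<lambda>s'. ivar s' 2 = i \<and> ?I (Suc i) (set_ivar 2 (Suc i) s'))"
        proof (rule wp_cond)
          assume h: "holds (RLess (scal 18) (RSub (RConst 0) (Cell 2 (IVar 5) (IVar 2)))) s1"
          have a: "sup_norm (Suc i) w (- w i)" using h e v old(1) by (intro new) auto
          show "wp (let_scal 18 (RSub (RConst 0) (Cell 2 (IVar 5) (IVar 2)))) 1 s1
            (\<lambda>s'. ivar s' 2 = i \<and> ?I (Suc i) (set_ivar 2 (Suc i) s'))"
            by (rule wp_rassign, rule post) (use I v e a in \<open>auto intro!: frame_set_cell\<close>)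
        next
          assume h2: "\<not> holds (RLess (scal 18) (RSub (RConst 0) (Cell 2 (IVar 5) (IVar 2)))) s1"
          have a: "sup_norm (Suc i) w (cell s1 18 0 0)" using h1 h2 e v by (intro keep) auto
          show "wp Skip 1 s1 (\<lambda>s'. ivar s' 2 = i \<and> ?I (Suc i) (set_ivar 2 (Suc i) s'))"
            by (rule wp_skip, rule post) (use I v a in auto)
        qed
      qed
    qed
  qed
  then show ?thesis
    by (rule wp_mono) (auto simp: w_def)
qed

definition direction_prog :: prog where
  "direction_prog = FillVec 2 8 Skip (RDiv (Cell 2 (IVar 5) (IVar 2)) (RMul (scal 18) (RMul (scal 10) (scal 10))))"

lemma wp_direction:
  assumes env: "env n a s" and d: "\<And>j. d j = cell s 2 (ivar s 5) j / (cell s 18 0 0 * (real n * real n))"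
  shows "wp direction_prog (n * 4 + 2) s (\<lambda>s'. frame {2} {8} s s' \<and> vec_at s' 8 n d)"
proof -
  have "wp direction_prog (n * (1 + 3) + 2) s (\<lambda>s'. frame {2} {8} s s' \<and> vec_at s' 8 n d)"
    unfolding direction_prog_def
    by (rule wp_fill_vec; (rule wp_skip)?) (use env in \<open>auto simp: frame_def env_def d\<close>)
  then show ?thesis by simp
qed

lemma row_add: "row n a (\<lambda>j. x j + d j) i = row n a x i + row n a d i"
  by (simp add: row_def ip_def sum.distrib algebra_simps)

lemma row_diff: "row n a (\<lambda>j. x j - d j) i = row n a x i - row n a d i"
  by (simp add: row_def ip_def sum_subtractf algebra_simps)

text \<open>By linearity one product of the matrix with the direction gives the rows of both
  possible new positions.\<close>

definition move_prog :: prog where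
  "move_prog = Seq (rows_prog 9 8)
     (Seq (pot_prog 19 (RAdd (entry 4 1) (entry 9 1)) 5)
     (Seq (pot_prog 20 (RSub (entry 4 1) (entry 9 1)) 5)
     (Seq (Cond (RLess (scal 19) (scal 20)) (let_scal 25 (RConst 1)) (let_scal 25 (RConst (-1))))
          (FillVec 2 3 Skip (RAdd (entry 3 2) (RMul (scal 25) (entry 8 2)))))))"

lemma wp_move:
  assumes env: "env n a s" and x: "vec_at s 3 n x" and y: "vec_at s 4 n (row n a x)"
    and d: "vec_at s 8 n d" and mu: "cell s 14 0 0 = \<mu>"
  shows "wp move_prog ((n * (n * 4 + 6) + 2) + ((n * 4 + 3) + ((n * 4 + 3) + (2 + (n * 4 + 2))))) s
    (\<lambda>s'. frame {1, 2} {3, 9, 15, 19, 20, 25} s s' \<and> (\<exists>x'. vec_at s' 3 n x' \<and> move n a \<mu> x d x'))"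
  unfolding move_prog_def
proof (rule wp_seq[OF wp_rows[OF env d]])
  fix s1 assume s1: "frame {1, 2} {15, 9} s s1 \<and> vec_at s1 9 n (row n a d)"
  have env1: "env n a s1" and y1: "vec_at s1 4 n (row n a x)" and mu1: "cell s1 14 0 0 = \<mu>"
    using s1 env y mu by (auto simp: frame_def env_def vec_at_def)
  let ?p = "pot n a 5 \<mu> (\<lambda>j. x j + d j)" and ?q = "pot n a 5 \<mu> (\<lambda>j. x j - d j)"
  show "wp (Seq (pot_prog 19 (RAdd (entry 4 1) (entry 9 1)) 5)
     (Seq (pot_prog 20 (RSub (entry 4 1) (entry 9 1)) 5)
     (Seq (Cond (RLess (scal 19) (scal 20)) (let_scal 25 (RConst 1)) (let_scal 25 (RConst (-1))))
          (FillVec 2 3 Skip (RAdd (entry 3 2) (RMul (scal 25) (entry 8 2)))))))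
    ((n * 4 + 3) + ((n * 4 + 3) + (2 + (n * 4 + 2)))) s1
    (\<lambda>s'. frame {1, 2} {3, 9, 15, 19, 20, 25} s s' \<and> (\<exists>x'. vec_at s' 3 n x' \<and> move n a \<mu> x d x'))"
  proof (rule wp_seq[OF wp_pot[where x = "\<lambda>j. x j + d j", OF env1 mu1]])
    show "rval (RAdd (entry 4 1) (entry 9 1)) s' = row n a (\<lambda>j. x j + d j) i"
      if "i < n" "frame {1} {19} s1 s'" "ivar s' 1 = i" for i s'
      using that y1 s1 by (auto simp: frame_def vec_at_def row_add)
    fix s2 assume s2: "frame {1} {19} s1 s2 \<and> cell s2 19 0 0 = ?p"
    have env2: "env n a s2" and mu2: "cell s2 14 0 0 = \<mu>"
      using s2 env1 mu1 by (auto simp: frame_def env_def)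
    show "wp (Seq (pot_prog 20 (RSub (entry 4 1) (entry 9 1)) 5)
     (Seq (Cond (RLess (scal 19) (scal 20)) (let_scal 25 (RConst 1)) (let_scal 25 (RConst (-1))))
          (FillVec 2 3 Skip (RAdd (entry 3 2) (RMul (scal 25) (entry 8 2))))))
      ((n * 4 + 3) + (2 + (n * 4 + 2))) s2
      (\<lambda>s'. frame {1, 2} {3, 9, 15, 19, 20, 25} s s' \<and> (\<exists>x'. vec_at s' 3 n x' \<and> move n a \<mu> x d x'))"
    proof (rule wp_seq[OF wp_pot[where x = "\<lambda>j. x j - d j", OF env2 mu2]])
      show "rval (RSub (entry 4 1) (entry 9 1)) s' = row n a (\<lambda>j. x j - d j) i"
        if "i < n" "frame {1} {20} s2 s'" "ivar s' 1 = i" for i s'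
        using that y1 s1 s2 by (auto simp: frame_def vec_at_def row_diff)
      fix s3 assume s3: "frame {1} {20} s2 s3 \<and> cell s3 20 0 0 = ?q"
      let ?s = "if ?p < ?q then 1 else -1 :: real"
      have F3: "frame {1, 2} {9, 15, 19, 20} s s3" using s1 s2 s3 by (auto simp: frame_def)
      have c3: "cell s3 19 0 0 = ?p" "cell s3 20 0 0 = ?q" using s2 s3 by (auto simp: frame_def)
      have "wp (Cond (RLess (scal 19) (scal 20)) (let_scal 25 (RConst 1)) (let_scal 25 (RConst (-1)))) (Suc 1) s3
        (\<lambda>s'. frame {1, 2} {9, 15, 19, 20, 25} s s' \<and> cell s' 25 0 0 = ?s)"
        by (rule wp_cond; rule wp_rassign)
          (use F3 c3 in \<open>auto intro!: frame_set_cell elim: frame_mono\<close>)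
      then have "wp (Cond (RLess (scal 19) (scal 20)) (let_scal 25 (RConst 1)) (let_scal 25 (RConst (-1)))) 2 s3
        (\<lambda>s'. frame {1, 2} {9, 15, 19, 20, 25} s s' \<and> cell s' 25 0 0 = ?s)"
        by (simp add: numeral_2_eq_2)
      then show "wp (Seq (Cond (RLess (scal 19) (scal 20)) (let_scal 25 (RConst 1)) (let_scal 25 (RConst (-1))))
          (FillVec 2 3 Skip (RAdd (entry 3 2) (RMul (scal 25) (entry 8 2))))) (2 + (n * 4 + 2)) s3
        (\<lambda>s'. frame {1, 2} {3, 9, 15, 19, 20, 25} s s' \<and> (\<exists>x'. vec_at s' 3 n x' \<and> move n a \<mu> x d x'))"
      proof (rule wp_seq)
        fix s4 assume s4: "frame {1, 2} {9, 15, 19, 20, 25} s s4 \<and> cell s4 25 0 0 = ?s"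
        have "wp (FillVec 2 3 Skip (RAdd (entry 3 2) (RMul (scal 25) (entry 8 2)))) (n * (1 + 3) + 2) s4
          (\<lambda>s'. frame {2} {3} s4 s' \<and> vec_at s' 3 n (\<lambda>j. x j + ?s * d j))"
        proof (rule wp_fill_vec; (rule wp_skip)?)
          fix i s' assume "i < n" "frame {2} {3} s4 s'" "ivar s' 2 = i" "cell s' 3 0 i = cell s4 3 0 i"
          then show "frame {} {} s' s' \<and> rval (RAdd (entry 3 2) (RMul (scal 25) (entry 8 2))) s' = x i + ?s * d i"
            using s4 x d by (simp add: frame_def vec_at_def)
        qed (use s4 env in \<open>auto simp: frame_def env_def\<close>)
        then show "wp (FillVec 2 3 Skip (RAdd (entry 3 2) (RMul (scal 25) (entry 8 2)))) (n * 4 + 2) s4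
          (\<lambda>s'. frame {1, 2} {3, 9, 15, 19, 20, 25} s s' \<and> (\<exists>x'. vec_at s' 3 n x' \<and> move n a \<mu> x d x'))"
        proof (rule wp_mono)
          fix s5 assume s5: "frame {2} {3} s4 s5 \<and> vec_at s5 3 n (\<lambda>j. x j + ?s * d j)"
          have "move n a \<mu> x d (\<lambda>j. x j + ?s * d j)" by (simp add: move_def)
          moreover have "frame {1, 2} {3, 9, 15, 19, 20, 25} s s5"
            using s4 s5 by (intro frame_trans[of "{1, 2}" "{9, 15, 19, 20, 25}" s s4 "{2}" "{3}" s5]) auto
          ultimately show "frame {1, 2} {3, 9, 15, 19, 20, 25} s s5 \<and> (\<exists>x'. vec_at s5 3 n x' \<and> move n a \<mu> x d x')"
            using s5 by blast
        qed simp
      qed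
    qed simp
  qed simp
qed simp_all

definition step_prog :: prog where
  "step_prog = Seq barrier_prog (Seq alive_prog (Seq threshold_prog (Seq blocked_prog (Seq weights_prog
     (Seq generators_prog (Seq gram_schmidt_prog (Seq best_prog (Seq sup_norm_prog
     (Seq direction_prog move_prog)))))))))"

text \<open>Left in the shape that \<open>wp_seq\<close> produces, so that the specifications chain
  by unification; later only its being a polynomial matters.\<close>

definition step_time :: "nat \<Rightarrow> nat" where
  "step_time n = ((n * 4 + 3) + ((n * 4 + 5) * (11 * n * n + n) + 1)) + ((n * 5 + 2) + ((n * 4 + 4) + ((n * 5 + 2) +
     ((n * 4 + 2) + (((n * (n * 4 + 4) + 2) + ((n * 4 + 2) + (n * (n * 4 + 5) + 2))) +
     (((2 * n + 1) * ((2 * n + 1) * (n * 8 + 8) + n * 4 + 8) + 2) + ((n * (n * (n * 4 + 6) + 10) + 3) +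
     ((n * 5 + 3) + ((n * 4 + 2) + ((n * (n * 4 + 6) + 2) + ((n * 4 + 3) + ((n * 4 + 3) + (2 + (n * 4 + 2))))))))))))))"

abbreviation "work_arrays \<equiv> {2, 3, 5, 6, 7, 8, 9, 13, 14, 15, 16, 17, 18, 19, 20, 22, 23, 24, 25, 26} :: nat set"

lemma wp_step:
  assumes env: "env n a s" and x: "vec_at s 3 n x" and y: "vec_at s 4 n (row n a x)"
    and T: "cell s 12 0 0 = cap n x" and inv: "barrier_inv n a x (cell s 14 0 0)"
    and a: "bounded_rows n a" and tau: "10000 \<le> tau n x"
  shows "wp step_prog (step_time n) s (\<lambda>s'. frame {1, 2, 3, 4, 5} work_arrays s s' \<and>
    (\<exists>x'. vec_at s' 3 n x' \<and> barrier_inv n a x' (cell s' 14 0 0) \<and> tau n x' \<le> tau n x - 1 / real n ^ 4))"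
  unfolding step_prog_def step_time_def
proof (rule wp_seq[OF wp_barrier[OF env y T inv a tau]], goal_cases)
  case (1 s1)
  define \<mu> where "\<mu> = cell s1 14 0 0"
  let ?Q = "\<lambda>s'. frame {1, 2, 3, 4, 5} work_arrays s s' \<and>
    (\<exists>x'. vec_at s' 3 n x' \<and> barrier_inv n a x' (cell s' 14 0 0) \<and> tau n x' \<le> tau n x - 1 / real n ^ 4)"
  note s1 = 1
  have state: "active_state n a x \<mu>"
    using a s1 tau by (simp add: active_state_def active_state_axioms_def \<mu>_def)
  let ?al = "alive n x" and ?bl = "blocked n a \<mu> x" and ?z = "weight n a \<mu> x"
  have F1: "frame {1} {14, 16} s s1" using s1 by blast
  note keep = env_frame vec_at_frame
  have e1: "env n a s1" "vec_at s1 3 n x" "vec_at s1 4 n (row n a x)" "cell s1 12 0 0 = cap n x" "cell s1 14 0 0 = \<mu>"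
    using keep[OF F1] env x y T F1 by (auto simp: frame_def \<mu>_def)
  show ?case
  proof (rule wp_seq[OF wp_alive[OF e1(1,2)]], goal_cases)
    case (1 s2)
    then have F: "frame {2} {5, 25} s1 s2" and al: "vec_at s2 5 n ?al" by blast+
    have F2: "frame {1, 2} {5, 14, 16, 25} s s2" using F1 F by (rule frame_trans) auto
    have e2: "env n a s2" "vec_at s2 3 n x" "vec_at s2 4 n (row n a x)" "cell s2 12 0 0 = cap n x" "cell s2 14 0 0 = \<mu>"
      using keep[OF F] e1 F by (auto simp: frame_cell)
    show ?case
    proof (rule wp_seq[OF wp_threshold[OF e2(1) al e2(4)]], goal_cases)
      case (1 s3)
      then have F: "frame {2} {13, 22} s2 s3" and thr: "cell s3 22 0 0 = thr n x" by blast+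
      have F3: "frame {1, 2} {5, 13, 14, 16, 22, 25} s s3" using F2 F by (rule frame_trans) auto
      have e3: "env n a s3" "vec_at s3 3 n x" "vec_at s3 4 n (row n a x)" "cell s3 14 0 0 = \<mu>" "vec_at s3 5 n ?al"
        using keep[OF F] e2 al F by (auto simp: frame_cell)
      show ?case
      proof (rule wp_seq[OF wp_blocked[OF e3(1,3) thr e3(4)]], goal_cases)
        case (1 s4)
        then have F: "frame {1} {6, 25} s3 s4" and bl: "vec_at s4 6 n ?bl" by blast+
        have F4: "frame {1, 2} {5, 6, 13, 14, 16, 22, 25} s s4" using F3 F by (rule frame_trans) auto
        have e4: "env n a s4" "vec_at s4 3 n x" "vec_at s4 4 n (row n a x)" "cell s4 14 0 0 = \<mu>" "vec_at s4 5 n ?al"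
          using keep[OF F] e3 F by (auto simp: frame_cell)
        show ?case
        proof (rule wp_seq[OF wp_weights[OF e4(1,3,4)]], goal_cases)
          case (1 s5)
          then have F: "frame {1} {26} s4 s5" and z: "vec_at s5 26 n ?z" by blast+
          have F5: "frame {1, 2} {5, 6, 13, 14, 16, 22, 25, 26} s s5" using F4 F by (rule frame_trans) auto
          have e5: "env n a s5" "vec_at s5 3 n x" "vec_at s5 4 n (row n a x)" "cell s5 14 0 0 = \<mu>"
              "vec_at s5 5 n ?al" "vec_at s5 6 n ?bl"
            using keep[OF F] e4 bl F by (auto simp: frame_cell)
          show ?case
          proof (rule wp_seq[OF wp_generators[OF e5(1,2,5,6)]], goal_cases)
            case (1 s6)
            let ?V = "generators n a x ?al ?bl"
            from 1 have F: "frame {1, 2} {2} s5 s6" and V: "\<forall>m<2 * n + 1. \<forall>j<n. cell s6 2 m j = ?V m j" by blast+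
            have F6: "frame {1, 2} {2, 5, 6, 13, 14, 16, 22, 25, 26} s s6" using F5 F by (rule frame_trans) auto
            have e6: "env n a s6" "vec_at s6 3 n x" "vec_at s6 4 n (row n a x)" "cell s6 14 0 0 = \<mu>" "vec_at s6 26 n ?z"
              using keep[OF F] e5 z F by (auto simp: frame_cell)
            have n6: "ivar s6 0 = n" using e6 by (simp add: env_def)
            show ?case
            proof (rule wp_seq[OF wp_gram_schmidt[OF n6 V]], goal_cases)
              case (1 s7)
              then have F: "frame {2, 3, 4} {2, 7, 15, 23} s6 s7" and gs: "gram_schmidt n (2 * n + 1) ?V (cell s7 2)"
                and S: "\<forall>m<2 * n + 1. cell s7 7 0 m = ip n (cell s7 2 m) (cell s7 2 m)" by blast+
              have F7: "frame {1, 2, 3, 4} {2, 5, 6, 7, 13, 14, 15, 16, 22, 23, 25, 26} s s7"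
                using F6 F by (rule frame_trans) auto
              have e7: "env n a s7" "vec_at s7 3 n x" "vec_at s7 4 n (row n a x)" "cell s7 14 0 0 = \<mu>" "vec_at s7 26 n ?z"
                using keep[OF F] e6 F by (auto simp: frame_cell)
              show ?case
              proof (rule wp_seq[OF wp_best[OF e7(1,5) S]], goal_cases)
                case (1 s8)
                then have F: "frame {1, 2, 3, 4, 5} {15, 17, 24} s7 s8"
                  and best: "best_direction n a ?z (cell s7 2) (ivar s8 5)" by blast+
                have F8: "frame {1, 2, 3, 4, 5} {2, 5, 6, 7, 13, 14, 15, 16, 17, 22, 23, 24, 25, 26} s s8"
                  using F7 F by (rule frame_trans) auto
                have W8: "cell s8 2 = cell s7 2" using F by (simp add: frame_def)
                have e8: "env n a s8" "vec_at s8 3 n x" "vec_at s8 4 n (row n a x)" "cell s8 14 0 0 = \<mu>"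
                  using keep[OF F] e7 F by (auto simp: frame_cell)
                have n8: "ivar s8 0 = n" using e8 by (simp add: env_def)
                show ?case
                proof (rule wp_seq[OF wp_sup_norm[OF n8]], goal_cases)
                  case (1 s9)
                  then have F: "frame {2} {18} s8 s9"
                    and M: "sup_norm n (cell s8 2 (ivar s8 5)) (cell s9 18 0 0)" by blast+
                  have F9: "frame {1, 2, 3, 4, 5} {2, 5, 6, 7, 13, 14, 15, 16, 17, 18, 22, 23, 24, 25, 26} s s9"
                    using F8 F by (rule frame_trans) auto
                  have W9: "cell s9 2 = cell s7 2" "ivar s9 5 = ivar s8 5" using F W8 by (simp_all add: frame_def)
                  have e9: "env n a s9" "vec_at s9 3 n x" "vec_at s9 4 n (row n a x)" "cell s9 14 0 0 = \<mu>"
                    using keep[OF F] e8 F by (auto simp: frame_cell)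
                  define d where "d j = cell s9 2 (ivar s9 5) j / (cell s9 18 0 0 * (real n * real n))" for j
                  show ?case
                  proof (rule wp_seq[OF wp_direction[OF e9(1) d_def]], goal_cases)
                    case (1 s10)
                    then have F: "frame {2} {8} s9 s10" and d: "vec_at s10 8 n d" by blast+
                    have F10: "frame {1, 2, 3, 4, 5} {2, 5, 6, 7, 8, 13, 14, 15, 16, 17, 18, 22, 23, 24, 25, 26} s s10"
                      using F9 F by (rule frame_trans) auto
                    have e10: "env n a s10" "vec_at s10 3 n x" "vec_at s10 4 n (row n a x)" "cell s10 14 0 0 = \<mu>"
                      using keep[OF F] e9 F by (auto simp: frame_cell)
                    show ?case
                    proof (rule wp_post[OF wp_move[OF e10(1,2,3) d e10(4)]])
                      fix s11 assume "frame {1, 2} {3, 9, 15, 19, 20, 25} s10 s11 \<and>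
                        (\<exists>x'. vec_at s11 3 n x' \<and> move n a \<mu> x d x')"
                      then obtain x' where F: "frame {1, 2} {3, 9, 15, 19, 20, 25} s10 s11"
                        and x': "vec_at s11 3 n x'" and mv: "move n a \<mu> x d x'" by blast
                      have "step_spec n a \<mu> x x'"
                        unfolding step_spec_def
                      proof (intro exI conjI)
                        show "gram_schmidt n (2 * n + 1) ?V (cell s7 2)" by (rule gs)
                        show "best_direction n a ?z (cell s7 2) (ivar s8 5)" by (rule best)
                        show "sup_norm n (cell s7 2 (ivar s8 5)) (cell s9 18 0 0)" using M by (simp add: W8)
                        have "d = (\<lambda>j. cell s7 2 (ivar s8 5) j / (cell s9 18 0 0 * (real n * real n)))"
                          by (rule ext) (simp add: d_def W9)
                        then show "move n a \<mu> x (\<lambda>j. cell s7 2 (ivar s8 5) j / (cell s9 18 0 0 * (real n * real n))) x'"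
                          using mv by simp
                      qed
                      then have "barrier_inv n a x' \<mu>" "tau n x' \<le> tau n x - 1 / real n ^ 4"
                        using active_state.step_inv[OF state] by blast+
                      moreover have "cell s11 14 0 0 = \<mu>" using F e10 by (simp add: frame_def)
                      moreover have "frame {1, 2, 3, 4, 5} work_arrays s s11"
                        using F10 F by (rule frame_trans) auto
                      ultimately show "?Q s11" using x' by auto
                    qed
                  qed
                qed
              qed
            qed
          qed
        qed
      qed
    qed
  qed
qed

section \<open>The iteration, the rounding and the whole program\<close>

definition iterate_prog :: prog where
  "iterate_prog = Seq tau_prog (Cond (RLess (scal 11) (RConst 10000)) Skip
     (Seq cap_prog (Seq (rows_prog 4 3) step_prog)))"

definition iterate_time :: "nat \<Rightarrow> nat" where
  "iterate_time n = (n * 4 + 4) + Suc (2 + ((n * (n * 4 + 6) + 2) + step_time n))"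

abbreviation "iterate_arrays \<equiv> {4, 11, 12} \<union> work_arrays"

text \<open>Once \<open>tau\<close> is below 10000 an iteration idles instead of leaving the loop,
  so the outer loop is a plain counter with a number of rounds fixed in advance.\<close>

lemma wp_iterate:
  assumes env: "env n a s" and x: "vec_at s 3 n x" and inv: "barrier_inv n a x (cell s 14 0 0)"
    and a: "bounded_rows n a"
  shows "wp iterate_prog (iterate_time n) s (\<lambda>s'. frame {1, 2, 3, 4, 5} iterate_arrays s s' \<and>
    (\<exists>x'. vec_at s' 3 n x' \<and> barrier_inv n a x' (cell s' 14 0 0) \<and>
       (if tau n x < 10000 then tau n x' = tau n x else tau n x' \<le> tau n x - 1 / real n ^ 4)))"
  unfolding iterate_prog_def iterate_time_def
proof (rule wp_seq[OF wp_tau[OF env x]])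
  let ?Q = "\<lambda>s'. frame {1, 2, 3, 4, 5} iterate_arrays s s' \<and>
    (\<exists>x'. vec_at s' 3 n x' \<and> barrier_inv n a x' (cell s' 14 0 0) \<and>
       (if tau n x < 10000 then tau n x' = tau n x else tau n x' \<le> tau n x - 1 / real n ^ 4))"
  fix s1 assume s1: "frame {2} {11, 15} s s1 \<and> cell s1 11 0 0 = tau n x"
  then have F: "frame {2} {11, 15} s s1" and t: "cell s1 11 0 0 = tau n x" by blast+
  have e1: "env n a s1" "vec_at s1 3 n x" "barrier_inv n a x (cell s1 14 0 0)"
    using env_frame[OF F env] vec_at_frame[OF F x] F inv by (auto simp: frame_cell)
  show "wp (Cond (RLess (scal 11) (RConst 10000)) Skip (Seq cap_prog (Seq (rows_prog 4 3) step_prog)))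
      (Suc (2 + ((n * (n * 4 + 6) + 2) + step_time n))) s1 ?Q"
  proof (rule wp_cond)
    assume "holds (RLess (scal 11) (RConst 10000)) s1"
    then have "tau n x < 10000" using t by simp
    moreover have "frame {1, 2, 3, 4, 5} iterate_arrays s s1" using F by (rule frame_mono) auto
    ultimately have "wp Skip 1 s1 ?Q" using e1 by (intro wp_skip) auto
    then show "wp Skip (2 + ((n * (n * 4 + 6) + 2) + step_time n)) s1 ?Q" by (rule wp_mono) auto
  next
    assume "\<not> holds (RLess (scal 11) (RConst 10000)) s1"
    then have tau: "10000 \<le> tau n x" using t by simp
    show "wp (Seq cap_prog (Seq (rows_prog 4 3) step_prog)) (2 + ((n * (n * 4 + 6) + 2) + step_time n)) s1 ?Q"
    proof (rule wp_seq[OF wp_cap[OF e1(1) t]])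
      fix s2 assume "frame {} {12} s1 s2 \<and> cell s2 12 0 0 = cap n x"
      then have F': "frame {} {12} s1 s2" and T: "cell s2 12 0 0 = cap n x" by blast+
      have F2: "frame {2} {11, 12, 15} s s2" using F F' by (rule frame_trans) auto
      have e2: "env n a s2" "vec_at s2 3 n x" "barrier_inv n a x (cell s2 14 0 0)"
        using env_frame[OF F' e1(1)] vec_at_frame[OF F' e1(2)] F' e1 by (auto simp: frame_cell)
      show "wp (Seq (rows_prog 4 3) step_prog) ((n * (n * 4 + 6) + 2) + step_time n) s2 ?Q"
      proof (rule wp_seq[OF wp_rows[OF e2(1,2)]])
        fix s3 assume "frame {1, 2} {15, 4} s2 s3 \<and> vec_at s3 4 n (row n a x)"
        then have F': "frame {1, 2} {15, 4} s2 s3" and y: "vec_at s3 4 n (row n a x)" by blast+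
        have F3: "frame {1, 2} {4, 11, 12, 15} s s3" using F2 F' by (rule frame_trans) auto
        have e3: "env n a s3" "vec_at s3 3 n x" "barrier_inv n a x (cell s3 14 0 0)" "cell s3 12 0 0 = cap n x"
          using env_frame[OF F' e2(1)] vec_at_frame[OF F' e2(2)] F' e2 T by (auto simp: frame_cell)
        show "wp step_prog (step_time n) s3 ?Q"
        proof (rule wp_post[OF wp_step[OF e3(1,2) y e3(4,3) a tau]])
          fix s4 assume s4: "frame {1, 2, 3, 4, 5} work_arrays s3 s4 \<and>
            (\<exists>x'. vec_at s4 3 n x' \<and> barrier_inv n a x' (cell s4 14 0 0) \<and> tau n x' \<le> tau n x - 1 / real n ^ 4)"
          have "frame {1, 2, 3, 4, 5} iterate_arrays s s4"
            by (rule frame_trans[OF F3 conjunct1[OF s4]]) auto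
          then show "?Q s4" using s4 tau by auto
        qed
      qed simp_all
    qed
  qed
qed

definition init_prog :: prog where
  "init_prog = Seq (Sum 1 (IVar 0) 10 Skip (RConst 1)) (let_scal 14 (RConst 1))"

definition round_prog :: prog where
  "round_prog = For 2 (IVar 0) (Cond (RLess (entry 3 2) (RConst 0))
     (RAssign 1 (IVar 2) (IConst 0) (RConst (-1))) (RAssign 1 (IVar 2) (IConst 0) (RConst 1)))"

text \<open>As \<open>tau\<close> starts at most at n and each active round lowers it by at least 1
  / n^4, n^5 rounds suffice. The counter is a real because index expressions cannot
  multiply.\<close>

definition main_prog :: prog where
  "main_prog = Seq init_prog (Seq
     (Loop (RLess (scal 21) (rpow (scal 10) 5)) (Seq iterate_prog (let_scal 21 (RAdd (scal 21) (RConst 1)))))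
     round_prog)"

definition main_time :: "nat \<Rightarrow> nat" where
  "main_time n = (n * 4 + 4) + (((iterate_time n + 2) * n ^ 5 + 1) + (n * 4 + 2))"

definition sgn_vec :: "(nat \<Rightarrow> real) \<Rightarrow> nat \<Rightarrow> real" where
  "sgn_vec x j = (if x j < 0 then -1 else 1)"

lemma wp_round:
  assumes "ivar s 0 = n" and x: "vec_at s 3 n x"
  shows "wp round_prog (n * 4 + 2) s (\<lambda>s'. \<forall>j<n. cell s' 1 j 0 = sgn_vec x j)"
proof -
  let ?I = "\<lambda>i s'. frame {2} {1} s s' \<and> (\<forall>j<i. cell s' 1 j 0 = sgn_vec x j)"
  have "wp round_prog (n * (Suc 1 + 2) + 2) s (\<lambda>s'. ?I n s' \<and> ivar s' 2 = n)"
    unfolding round_prog_def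
  proof (rule wp_for[where I = ?I])
    show "?I 0 (set_ivar 2 0 s)" by (auto intro: frame_set_ivar)
    show "ival (IVar 0) s' = n" if "?I i s'" for i s' using that assms(1) by (auto simp: frame_ivar)
    fix i s1 assume i: "i < n" and I: "?I i s1" and v: "ivar s1 2 = i"
    have xi: "cell s1 3 0 i = x i" using I x i by (auto simp: frame_def vec_at_def)
    show "wp (Cond (RLess (entry 3 2) (RConst 0)) (RAssign 1 (IVar 2) (IConst 0) (RConst (-1)))
        (RAssign 1 (IVar 2) (IConst 0) (RConst 1))) (Suc 1) s1
      (\<lambda>s'. ivar s' 2 = i \<and> ?I (Suc i) (set_ivar 2 (Suc i) s'))"
      by (rule wp_cond; rule wp_rassign)
        (use I v xi in \<open>auto simp: sgn_vec_def less_Suc_eq intro!: frame_set_ivar frame_set_cell\<close>)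
  qed
  then show ?thesis by (rule wp_mono) auto
qed

lemma inv_initial: "barrier_inv n a (\<lambda>_. 0) 1"
  using real_sqrt_ge_zero[of "real n"] by (auto simp: barrier_inv_def row_def ip_def)

lemma wp_main:
  assumes n: "ivar s 0 = n" and A: "\<forall>i<n. \<forall>j<n. cell s 0 i j = a i j"
    and zero: "\<And>m i j. m \<noteq> 0 \<Longrightarrow> cell s m i j = 0" and a: "bounded_rows n a"
  shows "wp main_prog (main_time n) s (\<lambda>s'. \<exists>x \<mu>. barrier_inv n a x \<mu> \<and> tau n x < 10000 \<and>
    (\<forall>j<n. cell s' 1 j 0 = sgn_vec x j))"
proof -
  let ?b = "RLess (scal 21) (rpow (scal 10) 5)"
  \<comment> \<open>\<open>c\<close> counts the completed rounds: either the walk has already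
    finished, or every one of them has lowered \<open>tau\<close>.\<close>
  let ?I = "\<lambda>s'. env n a s' \<and> (\<exists>x c. vec_at s' 3 n x \<and> barrier_inv n a x (cell s' 14 0 0) \<and>
      cell s' 21 0 0 = real c \<and> (tau n x < 10000 \<or> tau n x \<le> real n - real c / real n ^ 4))"
  have "wp init_prog ((n * (1 + 3) + 3) + 1) s ?I"
    unfolding init_prog_def
  proof (rule wp_seq)
    show "wp (Sum 1 (IVar 0) 10 Skip (RConst 1)) (n * (1 + 3) + 3) s
       (\<lambda>s'. frame {1} {10} s s' \<and> cell s' 10 0 0 = (\<Sum>i<n. 1))"
      by (rule wp_sum; (rule wp_skip)?) (use n in \<open>auto simp: frame_def\<close>)
    fix s1 assume s1: "frame {1} {10} s s1 \<and> cell s1 10 0 0 = (\<Sum>i<n. 1)"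
    have e: "env n a s1" using s1 n A by (auto simp: frame_def env_def)
    have z: "cell s1 21 0 0 = 0" "vec_at s1 3 n (\<lambda>_. 0)" using s1 zero by (auto simp: frame_def vec_at_def)
    have "tau n (\<lambda>_. 0) \<le> real n" by (simp add: tau_def ip_def)
    then show "wp (let_scal 14 (RConst 1)) 1 s1 ?I"
      using e z inv_initial[of n a]
      by (intro wp_rassign conjI exI[of _ "\<lambda>_. 0"] exI[of _ 0]) (auto simp: env_def vec_at_def)
  qed
  then have init: "wp init_prog (n * 4 + 4) s ?I" by (rule wp_mono) auto
  let ?f = "\<lambda>s'. n ^ 5 - nat \<lfloor>cell s' 21 0 0\<rfloor>"
  have loop: "wp (Loop ?b (Seq iterate_prog (let_scal 21 (RAdd (scal 21) (RConst 1)))))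
      ((iterate_time n + 2) * n ^ 5 + 1) s1 (\<lambda>s'. ?I s' \<and> \<not> holds ?b s')" if s1: "?I s1" for s1
  proof -
    have "wp (Loop ?b (Seq iterate_prog (let_scal 21 (RAdd (scal 21) (RConst 1)))))
      (((iterate_time n + 1) + 1) * ?f s1 + 1) s1 (\<lambda>s'. ?I s' \<and> \<not> holds ?b s')"
    proof (rule wp_loop[where f = ?f])
      fix s2 assume I: "?I s2" and h: "holds ?b s2"
      then obtain x c where e: "env n a s2" and x: "vec_at s2 3 n x" and inv: "barrier_inv n a x (cell s2 14 0 0)"
        and c: "cell s2 21 0 0 = real c" and t: "tau n x < 10000 \<or> tau n x \<le> real n - real c / real n ^ 4" by blast
      have "real c < real (n ^ 5)" using h e c by (simp add: env_def)
      then have cn: "c < n ^ 5" by (simp only: of_nat_less_iff)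
      show "wp (Seq iterate_prog (let_scal 21 (RAdd (scal 21) (RConst 1)))) (iterate_time n + 1) s2
         (\<lambda>s'. ?I s' \<and> ?f s' < ?f s2)"
      proof (rule wp_seq[OF wp_iterate[OF e x inv a]])
        fix s3 assume "frame {1, 2, 3, 4, 5} iterate_arrays s2 s3 \<and>
          (\<exists>x'. vec_at s3 3 n x' \<and> barrier_inv n a x' (cell s3 14 0 0) \<and>
            (if tau n x < 10000 then tau n x' = tau n x else tau n x' \<le> tau n x - 1 / real n ^ 4))"
        then obtain x' where F: "frame {1, 2, 3, 4, 5} iterate_arrays s2 s3" and x': "vec_at s3 3 n x'"
          and inv': "barrier_inv n a x' (cell s3 14 0 0)"
          and t': "if tau n x < 10000 then tau n x' = tau n x else tau n x' \<le> tau n x - 1 / real n ^ 4" by blast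
        have e3: "env n a s3" using F e by (rule env_frame) auto
        have c3: "cell s3 21 0 0 = real c" using F c by (simp add: frame_def)
        have "tau n x' < 10000 \<or> tau n x' \<le> real n - real (Suc c) / real n ^ 4"
          using t t' by (auto simp: add_divide_distrib split: if_splits)
        then have "?I (set_cell 21 0 0 (real (Suc c)) s3)"
          using e3 x' inv' by (intro conjI exI[of _ x'] exI[of _ "Suc c"]) (auto simp: env_def vec_at_def)
        moreover have "n ^ 5 - Suc c < n ^ 5 - c" using cn by simp
        moreover have "rval (RAdd (scal 21) (RConst 1)) s3 = real (Suc c)" using c3 by simp
        ultimately show "wp (let_scal 21 (RAdd (scal 21) (RConst 1))) 1 s3 (\<lambda>s'. ?I s' \<and> ?f s' < ?f s2)"
          using c by (intro wp_rassign) (simp del: of_nat_Suc)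
      qed
    qed (rule s1)
    moreover have "((iterate_time n + 1) + 1) * ?f s1 + 1 \<le> (iterate_time n + 2) * n ^ 5 + 1"
      using mult_le_mono2[OF diff_le_self, of "iterate_time n + 2" "n ^ 5" "nat \<lfloor>cell s1 21 0 0\<rfloor>"] by simp
    ultimately show ?thesis by (rule wp_mono)
  qed
  have round: "wp round_prog (n * 4 + 2) s2 (\<lambda>s'. \<exists>x \<mu>. barrier_inv n a x \<mu> \<and> tau n x < 10000 \<and>
    (\<forall>j<n. cell s' 1 j 0 = sgn_vec x j))" if s2: "?I s2 \<and> \<not> holds ?b s2" for s2
  proof -
    from s2 obtain x c where e: "env n a s2" and x: "vec_at s2 3 n x" and inv: "barrier_inv n a x (cell s2 14 0 0)"
      and c: "cell s2 21 0 0 = real c" and t: "tau n x < 10000 \<or> tau n x \<le> real n - real c / real n ^ 4" by blast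
    have "tau n x < 10000"
    proof (cases "n = 0")
      case True
      then show ?thesis by (simp add: tau_def ip_def)
    next
      case False
      have "cell s2 10 0 0 = real n" using e by (simp add: env_def)
      moreover have "\<not> cell s2 21 0 0 < cell s2 10 0 0 ^ 5" using s2 by simp
      ultimately have "real n ^ 5 \<le> real c" unfolding c by (simp only: not_less)
      then have "real n * real n ^ 4 \<le> real c" by (simp add: eval_nat_numeral)
      then have "real n \<le> real c / real n ^ 4" using False by (simp add: pos_le_divide_eq)
      then show ?thesis using t by auto
    qed
    moreover have "ivar s2 0 = n" using e by (simp add: env_def)
    ultimately show ?thesis using wp_round[OF _ x] inv by (auto elim!: wp_post)
  qed
  show ?thesis
    unfolding main_prog_def main_time_def by (rule wp_seq[OF init], rule wp_seq[OF loop], assumption, rule round)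
qed

text \<open>Rounding moves coordinate \<open>j\<close> by \<open>1 - \<bar>x j\<bar>\<close>, at
  most \<open>1 - x j * x j\<close>, and these sum to \<open>tau\<close>; hence 10002 = 10000 + 2.
  If \<open>x\<close> vanishes the rows do too, which settles the second alternative of the
  invariant.\<close>

lemma inv_rounded:
  assumes a: "bounded_rows n a" and inv: "barrier_inv n a x \<mu>" and tau: "tau n x < 10000" and i: "i < n"
  shows "\<bar>row n a (sgn_vec x) i\<bar> \<le> 36741/10000 * sqrt n + 10002"
proof -
  have x1: "\<bar>x j\<bar> \<le> 1" if "j < n" for j using inv that by (simp add: barrier_inv_def)
  have "\<bar>row n a x i\<bar> \<le> bound n"
  proof (cases "\<forall>j<n. x j = 0")
    case True
    then show ?thesis by (simp add: row_zero bound_def)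
  next
    case False
    then have psi: "psi n a \<mu> x + growth n (tau n x) \<le> bound n" and s: "\<forall>i<n. 1 \<le> \<mu> - \<bar>row n a x i\<bar>"
      using inv by (auto simp: barrier_inv_def)
    have "0 \<le> growth n (tau n x)" by (simp add: growth_def)
    moreover have "\<mu> \<le> psi n a \<mu> x" using pot_nonneg[OF s, of 5] by (simp add: psi_def)
    moreover have "1 \<le> \<mu> - \<bar>row n a x i\<bar>" using s i by simp
    ultimately show ?thesis using psi by linarith
  qed
  moreover have "\<bar>row n a (sgn_vec x) i - row n a x i\<bar> \<le> tau n x"
  proof -
    have "row n a (sgn_vec x) i - row n a x i = (\<Sum>j<n. a i j * (sgn_vec x j - x j))"
      by (simp add: row_def ip_def sum_subtractf right_diff_distrib)
    also have "\<bar>\<dots>\<bar> \<le> (\<Sum>j<n. \<bar>a i j * (sgn_vec x j - x j)\<bar>)" by (rule sum_abs)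
    also have "\<dots> \<le> (\<Sum>j<n. 1 - x j * x j)"
    proof (rule sum_mono)
      fix j assume "j \<in> {..<n}"
      then have j: "j < n" by simp
      have "\<bar>a i j\<bar> * \<bar>sgn_vec x j - x j\<bar> \<le> 1 * \<bar>sgn_vec x j - x j\<bar>"
        using a i j by (intro mult_right_mono) (auto simp: bounded_rows_def)
      also have "\<dots> = 1 - \<bar>x j\<bar>" using x1[OF j] by (auto simp: sgn_vec_def)
      also have "\<dots> \<le> 1 - \<bar>x j\<bar> * \<bar>x j\<bar>" using mult_right_mono[OF x1[OF j], of "\<bar>x j\<bar>"] by simp
      finally show "\<bar>a i j * (sgn_vec x j - x j)\<bar> \<le> 1 - x j * x j" by (simp add: abs_mult)
    qed
    also have "\<dots> = tau n x" by (simp add: tau_def ip_def sum_subtractf)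
    finally show ?thesis .
  qed
  ultimately show ?thesis using tau by (auto simp: bound_def)
qed

text \<open>The program never tosses, so this holds for every list of coins, in particular for the
  empty one.\<close>

lemma yields_main:
  assumes A: "bounded_square_mat n A"
  shows "\<exists>x. yields main_prog (main_time n) n A cs x \<and> sign_vec n x \<and>
     linf_norm (A *\<^sub>v x) \<le> 36741/10000 * sqrt n + 10002"
proof -
  define a where "a i j = A $$ (i, j)" for i j
  have dim: "A \<in> carrier_mat n n" and el: "elements_mat A \<subseteq> {-1..1}" using A by (auto simp: bounded_square_mat_def)
  have ab: "bounded_rows n a"
  proof
    fix i j assume "i < n" "j < n"
    then have "A $$ (i, j) \<in> elements_mat A" using dim by (intro elements_matI) auto
    then have "A $$ (i, j) \<in> {-1..1}" using el by blast
    then show "\<bar>a i j\<bar> \<le> 1" by (simp add: a_def abs_le_iff)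
  qed
  have "wp main_prog (main_time n) (input_state n A cs) (\<lambda>s'. \<exists>x \<mu>. barrier_inv n a x \<mu> \<and> tau n x < 10000 \<and>
    (\<forall>j<n. cell s' 1 j 0 = sgn_vec x j))"
    by (rule wp_main) (use ab in \<open>auto simp: input_state_def a_def\<close>)
  then obtain t s' x \<mu> where ex: "t \<le> main_time n" "exec main_prog (input_state n A cs) t s'"
    and x: "barrier_inv n a x \<mu>" "tau n x < 10000" "\<forall>j<n. cell s' 1 j 0 = sgn_vec x j"
    by (auto simp: wp_def)
  let ?v = "output_vec n s'"
  have v: "?v = Matrix.vec n (sgn_vec x)" using x(3) by (auto simp: output_vec_def)
  have sign: "sign_vec n ?v"
    unfolding v sign_vec_def by (auto simp: vec_set_def sgn_vec_def)
  have entry: "(A *\<^sub>v ?v) $ i = row n a (sgn_vec x) i" if "i < n" for i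
  proof -
    have "(A *\<^sub>v ?v) $ i = (\<Sum>j = 0..<n. A $$ (i, j) * sgn_vec x j)"
      using that dim by (auto simp: v scalar_prod_def)
    then show ?thesis by (simp add: row_def ip_def a_def atLeast0LessThan)
  qed
  have "\<bar>(A *\<^sub>v ?v) $ i\<bar> \<le> 36741/10000 * sqrt n + 10002" if "i < n" for i
    using inv_rounded[OF ab x(1,2) that] entry[OF that] by simp
  moreover have "dim_vec (A *\<^sub>v ?v) = n" using dim by simp
  ultimately have "linf_norm (A *\<^sub>v ?v) \<le> 36741/10000 * sqrt n + 10002"
    unfolding linf_norm_def by (subst Max_le_iff) (auto simp: vec_set_def)
  moreover have "yields main_prog (main_time n) n A cs ?v" using ex by (auto simp: yields_def)
  ultimately show ?thesis using sign by blast
qed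

section \<open>Polynomial running time and the two claims\<close>

definition poly_bounded :: "(nat \<Rightarrow> nat) \<Rightarrow> bool" where
  "poly_bounded f \<longleftrightarrow> (\<exists>p :: nat poly. \<forall>n. f n = poly p n)"

lemma poly_bounded_intros:
  "poly_bounded (\<lambda>n. n)" "poly_bounded (\<lambda>n. c)"
  "poly_bounded f \<Longrightarrow> poly_bounded g \<Longrightarrow> poly_bounded (\<lambda>n. f n + g n)"
  "poly_bounded f \<Longrightarrow> poly_bounded g \<Longrightarrow> poly_bounded (\<lambda>n. f n * g n)"
  "poly_bounded f \<Longrightarrow> poly_bounded (\<lambda>n. f n ^ k)"
  "poly_bounded f \<Longrightarrow> poly_bounded (\<lambda>n. Suc (f n))"
proof -
  show "poly_bounded (\<lambda>n. n)" unfolding poly_bounded_def by (intro exI[of _ "[:0, 1:]"]) simp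
  show const: "poly_bounded (\<lambda>n. c)" for c unfolding poly_bounded_def by (intro exI[of _ "[:c:]"]) simp
  show "poly_bounded f \<Longrightarrow> poly_bounded g \<Longrightarrow> poly_bounded (\<lambda>n. f n + g n)"
    unfolding poly_bounded_def by (metis poly_add)
  show "poly_bounded f \<Longrightarrow> poly_bounded g \<Longrightarrow> poly_bounded (\<lambda>n. f n * g n)"
    unfolding poly_bounded_def by (metis poly_mult)
  show "poly_bounded f \<Longrightarrow> poly_bounded (\<lambda>n. f n ^ k)"
    unfolding poly_bounded_def by (metis poly_power)
  show "poly_bounded f \<Longrightarrow> poly_bounded (\<lambda>n. Suc (f n))"
    unfolding poly_bounded_def by (metis poly_add poly_1 Suc_eq_plus1)
qed

lemma poly_bounded_main_time: "poly_bounded main_time"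
  unfolding main_time_def[abs_def] iterate_time_def step_time_def by (intro poly_bounded_intros)

lemma main_finds:
  assumes "36741/10000 \<le> c" "10002 \<le> C"
  shows "randomized_poly_time_finds main_prog bounded_square_mat
    (\<lambda>n A x. sign_vec n x \<and> linf_norm (A *\<^sub>v x) \<le> c * sqrt (real n) + C)"
proof -
  obtain p :: "nat poly" where p: "\<And>n. main_time n = poly p n"
    using poly_bounded_main_time by (auto simp: poly_bounded_def)
  have ex: "\<exists>x. yields main_prog (poly p n) n A cs x \<and>
      sign_vec n x \<and> linf_norm (A *\<^sub>v x) \<le> c * sqrt (real n) + C" if "bounded_square_mat n A" for n A cs
  proof -
    have "36741/10000 * sqrt n + 10002 \<le> c * sqrt n + C"
      using assms by (intro add_mono mult_right_mono) auto
    then show ?thesis using yields_main[OF that, of cs] unfolding p by (meson order_trans)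
  qed
  show ?thesis
    unfolding randomized_poly_time_finds_def
  proof (intro exI[of _ p] allI impI conjI)
    fix n A assume A: "bounded_square_mat n A"
    show "\<forall>cs\<in>coin_lists (poly p n). \<exists>x. yields main_prog (poly p n) n A cs x" using ex[OF A] by blast
    \<comment> \<open>Every coin list succeeds, so the probability is 1.\<close>
    have "{cs. \<exists>x. yields main_prog (poly p n) n A cs x \<and>
        sign_vec n x \<and> linf_norm (A *\<^sub>v x) \<le> c * sqrt (real n) + C} = UNIV"
      using ex[OF A] by blast
    then show "2 / 3 \<le> measure_pmf.prob (pmf_of_set (coin_lists (poly p n)))
       {cs. \<exists>x. yields main_prog (poly p n) n A cs x \<and>
        sign_vec n x \<and> linf_norm (A *\<^sub>v x) \<le> c * sqrt (real n) + C}"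
      by (simp add: measure_pmf.prob_space[simplified])
  qed
qed

lemma constant_le: "36741/10000 \<le> 3 * sqrt (3/2 :: real)"
proof -
  have "12247/10000 \<le> sqrt (3/2 :: real)" by (rule real_le_rsqrt) (simp add: power2_eq_square)
  then show ?thesis by simp
qed

theorem theorem4p7:
  shows "(\<exists>C::real. C > 0 \<and> (\<forall>n A. bounded_square_mat n A \<longrightarrow>
            (\<exists>x. sign_vec n x \<and> linf_norm (A *\<^sub>v x) \<le> 3 * sqrt (3 * real n / 2) + C))) \<and>
         (\<forall>\<epsilon>::real. \<epsilon> > 0 \<longrightarrow> (\<exists>(C'::real) (P::prog).
            randomized_poly_time_finds P bounded_square_mat
              (\<lambda>n A x. sign_vec n x \<and>
                 linf_norm (A *\<^sub>v x) \<le> (3 * sqrt (3 / 2) + \<epsilon>) * sqrt (real n) + C')))"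
proof (intro conjI allI impI)
  have "\<exists>x. sign_vec n x \<and> linf_norm (A *\<^sub>v x) \<le> 3 * sqrt (3 * real n / 2) + 10002"
    if A: "bounded_square_mat n A" for n A
  proof -
    have "36741/10000 * sqrt n \<le> 3 * sqrt (3/2) * sqrt n"
      using constant_le by (intro mult_right_mono) auto
    also have "\<dots> = 3 * sqrt (3 * real n / 2)" by (simp add: real_sqrt_mult[symmetric])
    \<comment> \<open>Existence is read off from the run without coins.\<close>
    finally show ?thesis using yields_main[OF A, of "[]"] by force
  qed
  then show "\<exists>C::real. C > 0 \<and> (\<forall>n A. bounded_square_mat n A \<longrightarrow>
      (\<exists>x. sign_vec n x \<and> linf_norm (A *\<^sub>v x) \<le> 3 * sqrt (3 * real n / 2) + C))"
    by (intro exI[of _ 10002]) auto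
  fix \<epsilon> :: real assume "\<epsilon> > 0"
  then show "\<exists>(C'::real) (P::prog). randomized_poly_time_finds P bounded_square_mat
      (\<lambda>n A x. sign_vec n x \<and> linf_norm (A *\<^sub>v x) \<le> (3 * sqrt (3 / 2) + \<epsilon>) * sqrt (real n) + C')"
    using constant_le by (intro exI[of _ 10002] exI[of _ main_prog] main_finds) auto
qed

end
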